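(* Let $X\subset\mathbb{R}^n$ be unimodular, and let $Z(X)=\{\sum_{x\in X}t_x x:\ t\in[0,1]^X\}$ be the associated zonotope. Then: (1) $\dim\ker\mathcal{I}_+(X)=\#(Z(X)\cap\mathbb{Z}^n)$; (2) $\dim\ker\mathcal{I}(X)=\mathrm{vol}(Z(X))$; (3) $\dim\ker\mathcal{I}_-(X)=\#(\mathrm{int}(Z(X))\cap\mathbb{Z}^n)$.
   Context: $X$ is a finite multiset of nonzero vectors in $\mathbb{R}^n$ spanning $\mathbb{R}^n$ (repeated vectors are treated as distinct elements; subsets, set differences and cardinalities are taken with multiplicity). $X$ is unimodular if $X\subset\mathbb{Z}^n$ and every $B\subset X$ that is a basis of $\mathbb{R}^n$ satisfies $\det B=\pm1$. $\Pi=\mathbb{C}[t_1,\dots,t_n]$. For $y\in\mathbb{R}^n$, $p_y(t)=y\cdot t$. A facet hyperplane of $X$ is a linear subspace $H\subset\mathbb{R}^n$ with $\dim H=n-1$ and $\mathrm{span}(X\cap H)=H$; $\mathcal{F}(X)$ is the set of facet hyperplanes. For $H\in\mathcal{F}(X)$, $\eta_H$ is a nonzero normal vector to $H$ and $m(H)=\#(X\setminus H)$. Define the ideals of $\Pi$ $$\mathcal{I}_+(X)=\langle p_{\eta_H}^{m(H)+1}:H\in\mathcal{F}(X)\rangle,\quad \mathcal{I}(X)=\langle p_{\eta_H}^{m(H)}:H\in\mathcal{F}(X)\rangle,\quad \mathcal{I}_-(X)=\langle p_{\eta_H}^{m(H)-1}:H\in\mathcal{F}(X)\rangle.$$ For a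 homogeneous ideal $I\subset\Pi$, $\ker I=\{p\in\Pi:\ q(D)p=0\ \ \forall q\in I\}$, where $q(D)=q(\partial/\partial t_1,\dots,\partial/\partial t_n)$. Dimensions are over $\mathbb{C}$; $\mathrm{vol}$ is Lebesgue measure and $\mathrm{int}$ is topological interior. *)

theory Defs
  imports "HOL-Analysis.Analysis" "HOL-Library.Multiset" "HOL-Library.Poly_Mapping"
begin

subsection \<open>The polynomial ring and its constant-coefficient differential operators\<close>

text \<open>A polynomial maps exponent vectors (finitely supported maps from the index type of the
  variables to \<^typ>\<open>nat\<close>) to coefficients; multiplication is the convolution of
  \<^theory>\<open>HOL-Library.Poly_Mapping\<close>.\<close>

type_synonym 'n cpoly = "('n \<Rightarrow>\<^sub>0 nat) \<Rightarrow>\<^sub>0 complex"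

definition cpoly_scale :: "complex \<Rightarrow> 'n cpoly \<Rightarrow> 'n cpoly" where
  "cpoly_scale c p = Poly_Mapping.single 0 c * p"

global_interpretation cpoly: vector_space cpoly_scale
  by unfold_locales
    (simp_all add: cpoly_scale_def distrib_left distrib_right single_add mult_single
      flip: mult.assoc)

text \<open>A submodule of a commutative ring over itself is an ideal. An interpretation of
  \<^locale>\<open>module\<close> would add the reversed associativity law to the simpset.\<close>

lemma module_times: "module ((*) :: 'a::comm_ring_1 \<Rightarrow> 'a \<Rightarrow> 'a)"
  by unfold_locales (simp_all add: algebra_simps)

definition ideal_gen :: "'a::comm_ring_1 set \<Rightarrow> 'a set" where
  "ideal_gen S = module.span (*) S"

text \<open>The dimension function of the library is \<open>0\<close> on spaces of infinite dimension.\<close>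

definition cpoly_finite_dim :: "'n cpoly set \<Rightarrow> bool" where
  "cpoly_finite_dim V \<longleftrightarrow> (\<exists>B. finite B \<and> V \<subseteq> cpoly.span B)"

text \<open>If \<open>\<beta>\<close> does not involve the variable \<open>i\<close>, then the exponent \<open>\<beta> - e\<^sub>i\<close> is
  truncated, but the coefficient vanishes.\<close>

definition partial :: "'n \<Rightarrow> 'n cpoly \<Rightarrow> 'n cpoly" where
  "partial i p = (\<Sum>\<beta>\<in>Poly_Mapping.keys p.
     Poly_Mapping.single (\<beta> - Poly_Mapping.single i 1)
       (of_nat (Poly_Mapping.lookup \<beta> i) * Poly_Mapping.lookup p \<beta>))"

lemma lookup_partial:
  "Poly_Mapping.lookup (partial i p) \<gamma> =
     of_nat (Poly_Mapping.lookup \<gamma> i + 1) * Poly_Mapping.lookup p (\<gamma> + Poly_Mapping.single i 1)"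
proof -
  let ?e = "Poly_Mapping.single i (1::nat)"
  have eq: "\<beta> = \<gamma> + ?e" if "\<beta> - ?e = \<gamma>" "Poly_Mapping.lookup \<beta> i \<noteq> 0" for \<beta>
    using that by (intro poly_mapping_eqI) (auto simp: lookup_add lookup_minus lookup_single when_def)
  have "Poly_Mapping.lookup (partial i p) \<gamma> =
      (\<Sum>\<beta>\<in>Poly_Mapping.keys p. if \<beta> = \<gamma> + ?e
        then of_nat (Poly_Mapping.lookup \<beta> i) * Poly_Mapping.lookup p \<beta> else 0)"
    unfolding partial_def lookup_sum
    by (intro sum.cong refl) (use eq in \<open>auto simp: lookup_single when_def\<close>)
  also have "\<dots> = of_nat (Poly_Mapping.lookup (\<gamma> + ?e) i) * Poly_Mapping.lookup p (\<gamma> + ?e)"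
    by (simp add: sum.delta in_keys_iff)
  finally show ?thesis
    by (simp add: lookup_add)
qed

lemma partial_commute: "partial i (partial j p) = partial j (partial i p)"
  by (intro poly_mapping_eqI, cases "i = j")
    (auto simp: lookup_partial lookup_add lookup_single when_def ac_simps)

text \<open>The fold composes \<open>(\<partial>/\<partial>t\<^sub>i)\<^bsup>\<alpha> i\<^esup>\<close> over all variables; these operators commute.\<close>

definition partial_monom :: "('n::finite \<Rightarrow>\<^sub>0 nat) \<Rightarrow> 'n cpoly \<Rightarrow> 'n cpoly" where
  "partial_monom \<alpha> p =
     Finite_Set.fold (\<lambda>i. partial i ^^ Poly_Mapping.lookup \<alpha> i) p UNIV"

lemma comp_fun_commute_partial:
  "comp_fun_commute (\<lambda>i. partial i ^^ Poly_Mapping.lookup \<alpha> i)"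
proof
  fix i j :: 'a
  have *: "partial i ((partial j ^^ m) p) = (partial j ^^ m) (partial i p)" for m p
    by (induction m) (simp_all add: partial_commute[of i j])
  have "(partial i ^^ k) ((partial j ^^ m) p) = (partial j ^^ m) ((partial i ^^ k) p)" for k m p
    by (induction k) (simp_all add: *)
  then show "(partial j ^^ Poly_Mapping.lookup \<alpha> j) \<circ> (partial i ^^ Poly_Mapping.lookup \<alpha> i) =
      (partial i ^^ Poly_Mapping.lookup \<alpha> i) \<circ> (partial j ^^ Poly_Mapping.lookup \<alpha> j)"
    by (simp add: fun_eq_iff)
qed

text \<open>\<open>diff_op q p\<close> is \<open>q(D) p\<close>.\<close>

definition diff_op :: "('n::finite) cpoly \<Rightarrow> 'n cpoly \<Rightarrow> 'n cpoly" where
  "diff_op q p =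
     (\<Sum>\<alpha>\<in>Poly_Mapping.keys q. cpoly_scale (Poly_Mapping.lookup q \<alpha>) (partial_monom \<alpha> p))"

definition ideal_ker :: "('n::finite) cpoly set \<Rightarrow> 'n cpoly set" where
  "ideal_ker I = {p. \<forall>q\<in>I. diff_op q p = 0}"

definition linear_form :: "real ^ ('n::finite) \<Rightarrow> 'n cpoly" where
  "linear_form y = (\<Sum>i\<in>UNIV. Poly_Mapping.single (Poly_Mapping.single i 1) (of_real (y $ i)))"


subsection \<open>Unimodular multisets, facet hyperplanes and the zonotope\<close>

definition int_lattice :: "(real ^ 'n) set" where
  "int_lattice = {x. \<forall>i. x $ i \<in> \<int>}"

text \<open>A basis contains no repeated vector, so the bases contained in a multiset are those
  contained in its underlying set. The determinant of a basis is that of the matrix whose rows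
  are its elements in an arbitrary order \<open>b\<close>.\<close>

definition unimodular :: "(real ^ 'n) multiset \<Rightarrow> bool" where
  "unimodular X \<longleftrightarrow> set_mset X \<subseteq> int_lattice \<and>
     (\<forall>B. B \<subseteq> set_mset X \<and> independent B \<and> span B = UNIV \<longrightarrow>
       (\<forall>b :: 'n \<Rightarrow> real ^ 'n. bij_betw b UNIV B \<longrightarrow> det (\<chi> i. b i) \<in> {1, -1}))"

definition facet_hyperplanes :: "(real ^ 'n) multiset \<Rightarrow> (real ^ 'n) set set" where
  "facet_hyperplanes X =
     {H. subspace H \<and> dim H = CARD('n) - 1 \<and> span (set_mset X \<inter> H) = H}"

definition facet_mult :: "(real ^ 'n) multiset \<Rightarrow> (real ^ 'n) set \<Rightarrow> nat" where
  "facet_mult X H = size {#x \<in># X. x \<notin> H#}"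

definition facet_normals ::
    "(real ^ 'n) multiset \<Rightarrow> ((real ^ 'n) set \<Rightarrow> real ^ 'n) \<Rightarrow> bool" where
  "facet_normals X \<eta> \<longleftrightarrow>
     (\<forall>H\<in>facet_hyperplanes X. \<eta> H \<noteq> 0 \<and> (\<forall>h\<in>H. \<eta> H \<bullet> h = 0))"

definition external_ideal ::
    "(real ^ 'n) multiset \<Rightarrow> ((real ^ 'n) set \<Rightarrow> real ^ 'n) \<Rightarrow> ('n::finite) cpoly set" where
  "external_ideal X \<eta> =
     ideal_gen ((\<lambda>H. linear_form (\<eta> H) ^ (facet_mult X H + 1)) ` facet_hyperplanes X)"

definition central_ideal ::
    "(real ^ 'n) multiset \<Rightarrow> ((real ^ 'n) set \<Rightarrow> real ^ 'n) \<Rightarrow> ('n::finite) cpoly set" where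
  "central_ideal X \<eta> =
     ideal_gen ((\<lambda>H. linear_form (\<eta> H) ^ facet_mult X H) ` facet_hyperplanes X)"

text \<open>If \<open>X\<close> spans the whole space, then \<open>facet_mult X H \<ge> 1\<close> and the subtraction is not
  truncated.\<close>

definition internal_ideal ::
    "(real ^ 'n) multiset \<Rightarrow> ((real ^ 'n) set \<Rightarrow> real ^ 'n) \<Rightarrow> ('n::finite) cpoly set" where
  "internal_ideal X \<eta> =
     ideal_gen ((\<lambda>H. linear_form (\<eta> H) ^ (facet_mult X H - 1)) ` facet_hyperplanes X)"

text \<open>The \<open>count X x\<close> copies of \<open>x\<close> carry independent coefficients \<open>t x k\<close>.\<close>

definition zonotope :: "(real ^ 'n) multiset \<Rightarrow> (real ^ 'n) set" where
  "zonotope X = {\<Sum>x\<in>set_mset X. \<Sum>k<count X x. t x k *\<^sub>R x | t.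
     \<forall>x\<in>set_mset X. \<forall>k<count X x. 0 \<le> t x k \<and> t x k \<le> (1::real)}"

end

theory Submission
  imports Defs "HOL-Computational_Algebra.Polynomial"
begin

text \<open>The lower bounds come from interpolation. Unimodularity scales every facet normal \<open>\<eta>\<close> to an
  integral vector with values in \<open>{0, 1, -1}\<close> on \<open>X\<close>. Hence \<open>\<eta>\<close> takes at most \<open>m(H) + 1\<close> values on the
  lattice points of the zonotope, at most \<open>m(H) - 1\<close> on those of its interior, and at most \<open>m(H)\<close> on
  those of a generic translate. For a finite set \<open>\<Theta>\<close> on which each \<open>\<eta>\<close> takes at most as many values as
  the exponent of its power in the ideal, the lowest homogeneous parts of the exponential sums with
  frequencies in \<open>\<Theta>\<close> lie in the kernel and separate the points of \<open>\<Theta>\<close>.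

  The upper bounds come from deletion and contraction of a vector \<open>x\<close>. Restriction to the hyperplane
  orthogonal to \<open>x\<close> maps the kernel of \<open>X\<close> to that of \<open>X / x\<close>. A polynomial that vanishes there is the
  linear form of \<open>x\<close> times an element of the kernel of \<open>X\<close> without \<open>x\<close>. On the other side, each line
  in direction \<open>x\<close> through a lattice point that meets the zonotope contains one more lattice point of
  the zonotope of \<open>X\<close> than of that of \<open>X\<close> without \<open>x\<close>.

  The volume is the average number of lattice points of the translates of the zonotope.\<close>

subsection \<open>Polynomials as functions and their restrictions to lines\<close>


text \<open>Neither number is computed by an exact recursion. Deletion and contraction produce the
  upper bound together with a set \<open>A\<close> of lattice points such that dim <= card A.
  Interpolation works for every finite \<open>T\<close> that has few values under each normal. As
  \<open>A\<close> lies in \<open>T\<close>, the chain dim <= card A <= card T <= dim closes. Thus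
  the internal case can build \<open>A\<close> from coefficients in the open interval and take for
  \<open>T\<close> the lattice points of the topological interior, and genericity of the translation
  enters only through \<open>T\<close>.

  The obstacle is a vector whose removal leaves a set that does not span, so that the zonotope of
  the deletion degenerates. The span of the other vectors is then a facet with m(H) = 1, and its
  exponent is 2, 1 or 0 in the external, central and internal case. These small exponents allow a
  direct argument, and they reflect two, one or no layers of lattice points over the contraction.

  A contraction lives in a quotient of R^n, but an induction has to stay in one type. Therefore
  quotients are represented by the subspace that is divided out.\<close>

lemma cpoly_induct_single [case_names single add]:
  fixes p :: "'n cpoly"
  assumes single: "\<And>\<beta> c. P (Poly_Mapping.single \<beta> c)"
    and add: "\<And>p q. P p \<Longrightarrow> P q \<Longrightarrow> P (p + q)"
  shows "P p"
proof -
  have "P (\<Sum>\<beta>\<in>A. Poly_Mapping.single \<beta> (Poly_Mapping.lookup p \<beta>))" for A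
    by (induction A rule: infinite_finite_induct)
      (use single[of 0 0] in \<open>auto intro: single add\<close>)
  moreover have "(\<Sum>\<beta>\<in>Poly_Mapping.keys p. Poly_Mapping.single \<beta> (Poly_Mapping.lookup p \<beta>)) = p"
    by (intro poly_mapping_eqI)
      (auto simp: lookup_sum lookup_single when_def in_keys_iff sum.delta)
  ultimately show ?thesis
    by metis
qed

text \<open>The polynomial \<open>p (t + s y)\<close> in the single variable \<open>s\<close>. Its
  coefficients are the Taylor coefficients of \<open>p\<close> at \<open>t\<close> in direction
  \<open>y\<close>, which turns questions on differential operators into questions on
  degrees.\<close>

definition line_poly :: "('n::finite) cpoly \<Rightarrow> real ^ 'n \<Rightarrow> real ^ 'n \<Rightarrow> complex poly" where
  "line_poly p t y = (\<Sum>\<beta>\<in>Poly_Mapping.keys p. smult (Poly_Mapping.lookup p \<beta>)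
     (\<Prod>i\<in>UNIV. [:of_real (t $ i), of_real (y $ i):] ^ Poly_Mapping.lookup \<beta> i))"

definition cpoly_eval :: "('n::finite) cpoly \<Rightarrow> real ^ 'n \<Rightarrow> complex" where
  "cpoly_eval p t = (\<Sum>\<beta>\<in>Poly_Mapping.keys p. Poly_Mapping.lookup p \<beta> *
     (\<Prod>i\<in>UNIV. of_real (t $ i) ^ Poly_Mapping.lookup \<beta> i))"

definition dir_deriv :: "real ^ 'n \<Rightarrow> ('n::finite) cpoly \<Rightarrow> 'n cpoly" where
  "dir_deriv y p = (\<Sum>i\<in>UNIV. cpoly_scale (of_real (y $ i)) (partial i p))"

lemma line_poly_add: "line_poly (p + q) t y = line_poly p t y + line_poly q t y"
  unfolding line_poly_def by (rule setsum_keys_plus_distrib) (simp_all add: smult_add_left)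

lemma line_poly_single: "line_poly (Poly_Mapping.single \<beta> c) t y =
    smult c (\<Prod>i\<in>UNIV. [:of_real (t $ i), of_real (y $ i):] ^ Poly_Mapping.lookup \<beta> i)"
  by (simp add: line_poly_def)

lemma cpoly_eval_add: "cpoly_eval (p + q) t = cpoly_eval p t + cpoly_eval q t"
  unfolding cpoly_eval_def by (rule setsum_keys_plus_distrib) (simp_all add: algebra_simps)

lemma cpoly_eval_single: "cpoly_eval (Poly_Mapping.single \<beta> c) t =
    c * (\<Prod>i\<in>UNIV. of_real (t $ i) ^ Poly_Mapping.lookup \<beta> i)"
  by (simp add: cpoly_eval_def)

lemma cpoly_eval_0 [simp]: "cpoly_eval 0 t = 0"
  by (simp add: cpoly_eval_def)

lemma cpoly_eval_mult: "cpoly_eval (p * q) t = cpoly_eval p t * cpoly_eval q t"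
proof (induction p rule: cpoly_induct_single)
  case (single \<alpha> a)
  show ?case
  proof (induction q rule: cpoly_induct_single)
    case (single \<beta> b)
    show ?case
      by (simp add: mult_single cpoly_eval_single lookup_add power_add prod.distrib)
  qed (simp add: cpoly_eval_add distrib_left)
qed (simp add: cpoly_eval_add distrib_right)

lemma cpoly_eval_scale: "cpoly_eval (cpoly_scale c p) t = c * cpoly_eval p t"
  by (simp add: cpoly_scale_def cpoly_eval_mult cpoly_eval_single)

lemma cpoly_eval_minus: "cpoly_eval (p - q) t = cpoly_eval p t - cpoly_eval q t"
  using cpoly_eval_add[of "p - q" q t] by simp

lemma cpoly_eval_sum: "cpoly_eval (\<Sum>x\<in>A. f x) t = (\<Sum>x\<in>A. cpoly_eval (f x) t)"
  by (induction A rule: infinite_finite_induct) (simp_all add: cpoly_eval_add)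

lemma cpoly_eval_const: "cpoly_eval (Poly_Mapping.single 0 c) t = c"
  by (simp add: cpoly_eval_single)

lemma cpoly_eval_var: "cpoly_eval (Poly_Mapping.single (Poly_Mapping.single i 1) 1) t = of_real (t $ i)"
proof -
  have "(\<Prod>j\<in>UNIV. (of_real (t $ j) :: complex) ^ Poly_Mapping.lookup (Poly_Mapping.single i 1) j) =
      (\<Prod>j\<in>UNIV. if j = i then of_real (t $ j) else 1)"
    by (intro prod.cong) (auto simp: lookup_single when_def)
  then show ?thesis
    by (simp add: cpoly_eval_single)
qed

lemma single_eq_scale: "Poly_Mapping.single \<beta> c = cpoly_scale c (Poly_Mapping.single \<beta> 1)"
  by (simp add: cpoly_scale_def mult_single)

lemma cpoly_eval_linear_form: "cpoly_eval (linear_form y) t = of_real (y \<bullet> t)"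
  unfolding linear_form_def cpoly_eval_sum inner_vec_def
  by (subst single_eq_scale) (simp add: cpoly_eval_scale cpoly_eval_var del: One_nat_def)

lemma cpoly_eval_power: "cpoly_eval (p ^ n) t = cpoly_eval p t ^ n"
  by (induction n) (simp_all add: cpoly_eval_mult flip: single_one add: cpoly_eval_const)

lemma poly_line_poly: "poly (line_poly p t y) (of_real s) = cpoly_eval p (t + s *\<^sub>R y)"
  by (simp add: line_poly_def cpoly_eval_def poly_sum poly_prod)

lemma complex_poly_eqI_real:
  fixes p q :: "complex poly"
  assumes "\<And>s::real. poly p (of_real s) = poly q (of_real s)"
  shows "p = q"
proof (rule ccontr)
  assume "p \<noteq> q"
  then have "finite {z. poly (p - q) z = 0}"
    by (intro poly_roots_finite) simp
  moreover have "range (of_real :: real \<Rightarrow> complex) \<subseteq> {z. poly (p - q) z = 0}"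
    using assms by auto
  ultimately have "finite (range (of_real :: real \<Rightarrow> complex))"
    by (rule rev_finite_subset)
  then show False
    by (simp add: finite_image_iff inj_of_real infinite_UNIV_char_0)
qed

text \<open>Values at real parameters determine a polynomial, so identities between restrictions
  reduce to evaluation, which is multiplicative.\<close>

lemma line_poly_unique:
  assumes "\<And>s::real. cpoly_eval p (t + s *\<^sub>R y) = poly q (of_real s)"
  shows "line_poly p t y = q"
  by (rule complex_poly_eqI_real) (simp add: poly_line_poly assms)

lemma line_poly_mult: "line_poly (p * q) t y = line_poly p t y * line_poly q t y"
  by (rule line_poly_unique) (simp add: cpoly_eval_mult poly_line_poly)

lemma line_poly_linear_form:
  "line_poly (linear_form x) t y = [:of_real (x \<bullet> t), of_real (x \<bullet> y):]"
  by (rule line_poly_unique) (simp add: cpoly_eval_linear_form inner_add_right)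

section \<open>Directional derivatives and degrees along lines\<close>

lemma partial_add: "partial i (p + q) = partial i p + partial i q"
  by (rule poly_mapping_eqI) (simp add: lookup_partial lookup_add algebra_simps)

lemma partial_0 [simp]: "partial i 0 = 0"
  by (simp add: partial_def)

lemma lookup_scale: "Poly_Mapping.lookup (cpoly_scale c p) \<beta> = c * Poly_Mapping.lookup p \<beta>"
  unfolding cpoly_scale_def mult_map_scale_conv_mult[symmetric]
  by (simp add: Poly_Mapping.map.rep_eq when_def)

lemma partial_scale: "partial i (cpoly_scale c p) = cpoly_scale c (partial i p)"
  by (rule poly_mapping_eqI) (simp add: lookup_partial lookup_scale)

lemma partial_single: "partial i (Poly_Mapping.single \<beta> c) =
    Poly_Mapping.single (\<beta> - Poly_Mapping.single i 1) (of_nat (Poly_Mapping.lookup \<beta> i) * c)"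
  by (simp add: partial_def)

lemma dir_deriv_add: "dir_deriv y (p + q) = dir_deriv y p + dir_deriv y q"
  by (simp add: dir_deriv_def partial_add cpoly.scale_right_distrib sum.distrib)

lemma dir_deriv_0 [simp]: "dir_deriv y 0 = 0"
  by (simp add: dir_deriv_def)

lemma dir_deriv_scale: "dir_deriv y (cpoly_scale c p) = cpoly_scale c (dir_deriv y p)"
  by (simp add: dir_deriv_def partial_scale cpoly.scale_sum_right mult.commute)

lemma dir_deriv_add_left: "dir_deriv (y + z) p = dir_deriv y p + dir_deriv z p"
  by (simp add: dir_deriv_def cpoly.scale_left_distrib sum.distrib)

lemma dir_deriv_scaleR_left: "dir_deriv (r *\<^sub>R y) p = cpoly_scale (of_real r) (dir_deriv y p)"
  by (simp add: dir_deriv_def cpoly.scale_sum_right)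

lemma dir_deriv_axis: "dir_deriv (axis i 1) p = partial i p"
proof -
  have "dir_deriv (axis i 1) p = (\<Sum>j\<in>UNIV. if j = i then partial i p else 0)"
    unfolding dir_deriv_def by (intro sum.cong) (auto simp: axis_def)
  then show ?thesis
    by simp
qed

lemma line_poly_scale: "line_poly (cpoly_scale c p) t y = smult c (line_poly p t y)"
  by (rule line_poly_unique) (simp add: cpoly_eval_scale poly_line_poly)

lemma line_poly_0 [simp]: "line_poly 0 t y = 0"
  by (simp add: line_poly_def)

lemma line_poly_sum: "line_poly (\<Sum>x\<in>A. f x) t y = (\<Sum>x\<in>A. line_poly (f x) t y)"
  by (induction A rule: infinite_finite_induct) (simp_all add: line_poly_add)

lemma smult_sum_distrib: "smult c (\<Sum>x\<in>A. f x) = (\<Sum>x\<in>A. smult c (f x))"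
  by (induction A rule: infinite_finite_induct) (simp_all add: smult_add_right)

lemma pderiv_linear_power:
  "pderiv ([:a, b:] ^ n) = smult (of_nat n * b) ([:a, b:] ^ (n - 1))" for a b :: complex
  by (cases n) (simp_all add: pderiv_power pderiv_pCons mult.commute del: power_Suc)

lemma line_poly_dir_deriv: "line_poly (dir_deriv y p) t y = pderiv (line_poly p t y)"
proof (induction p rule: cpoly_induct_single)
  case (single \<beta> c)
  let ?l = "\<lambda>i. [:of_real (t $ i), of_real (y $ i):] :: complex poly"
  let ?b = "Poly_Mapping.lookup \<beta>"
  \<comment> \<open>Truncation is harmless: an exponent 0 stays 0 on both sides, and the factor
    \<open>of_nat (?b i)\<close> later removes that term.\<close>
  have *: "(\<Prod>j\<in>UNIV. ?l j ^ Poly_Mapping.lookup (\<beta> - Poly_Mapping.single i 1) j) =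
      (\<Prod>j\<in>UNIV - {i}. ?l j ^ ?b j) * ?l i ^ (?b i - 1)" for i
  proof -
    have "(\<Prod>j\<in>UNIV. ?l j ^ Poly_Mapping.lookup (\<beta> - Poly_Mapping.single i 1) j) =
        ?l i ^ (?b i - 1) * (\<Prod>j\<in>UNIV - {i}. ?l j ^ Poly_Mapping.lookup (\<beta> - Poly_Mapping.single i 1) j)"
      by (subst prod.remove[of _ i]) (simp_all add: lookup_minus)
    also have "(\<Prod>j\<in>UNIV - {i}. ?l j ^ Poly_Mapping.lookup (\<beta> - Poly_Mapping.single i 1) j) =
        (\<Prod>j\<in>UNIV - {i}. ?l j ^ ?b j)"
      by (intro prod.cong) (auto simp: lookup_minus lookup_single when_def)
    finally show ?thesis
      by (simp add: mult.commute)
  qed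
  have "line_poly (dir_deriv y (Poly_Mapping.single \<beta> c)) t y = (\<Sum>i\<in>UNIV. smult (of_real (y $ i))
      (smult (of_nat (?b i) * c) ((\<Prod>j\<in>UNIV - {i}. ?l j ^ ?b j) * ?l i ^ (?b i - 1))))"
    unfolding dir_deriv_def line_poly_sum line_poly_scale partial_single line_poly_single * ..
  also have "\<dots> = smult c (\<Sum>i\<in>UNIV. (\<Prod>j\<in>UNIV - {i}. ?l j ^ ?b j) * pderiv (?l i ^ ?b i))"
    unfolding smult_sum_distrib by (intro sum.cong refl) (simp add: pderiv_linear_power mult_ac)
  also have "\<dots> = pderiv (line_poly (Poly_Mapping.single \<beta> c) t y)"
    by (simp add: line_poly_single pderiv_smult pderiv_prod)
  finally show ?case .
qed (simp add: dir_deriv_add line_poly_add pderiv_add)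

lemma line_poly_dir_deriv_power:
  "line_poly ((dir_deriv y ^^ m) p) t y = (pderiv ^^ m) (line_poly p t y)"
  by (induction m) (simp_all add: line_poly_dir_deriv)

lemma cpoly_eval_line_poly: "cpoly_eval p t = poly (line_poly p t y) 0"
  using poly_line_poly[of p t y 0] by simp

lemma cpoly_eval_dir_deriv_power:
  "cpoly_eval ((dir_deriv y ^^ m) p) t = fact m * coeff (line_poly p t y) m"
  by (simp add: cpoly_eval_line_poly[of _ t y] line_poly_dir_deriv_power poly_0_coeff_0
      coeff_higher_pderiv pochhammer_fact)

text \<open>Induction on the total degree of an exponent: differentiating in a variable that occurs
  in it lowers the degree, and the derivative again vanishes everywhere. In degree 0 the coefficient
  is the value at the origin.\<close>

lemma cpoly_eval_eq_0D:
  fixes p :: "('n::finite) cpoly"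
  assumes "\<And>t. cpoly_eval p t = 0"
  shows "p = 0"
proof -
  have "Poly_Mapping.lookup p \<beta> = 0" if "(\<Sum>i\<in>UNIV. Poly_Mapping.lookup \<beta> i) = k" for \<beta> k
    using assms that
  proof (induction k arbitrary: p \<beta>)
    case 0
    then have "\<beta> = 0"
      by (intro poly_mapping_eqI) simp
    moreover have "cpoly_eval q 0 = Poly_Mapping.lookup q 0" for q :: "'n cpoly"
    proof (induction q rule: cpoly_induct_single)
      case (single \<beta> c)
      show ?case
      proof (cases "\<beta> = 0")
        case False
        then obtain i where "Poly_Mapping.lookup \<beta> i \<noteq> 0"
          by (metis poly_mapping_eqI lookup_zero)
        then show ?thesis
          using False by (auto simp: cpoly_eval_single lookup_single when_def prod_zero_iff)
      qed (simp add: cpoly_eval_single)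
    qed (simp add: cpoly_eval_add lookup_add)
    ultimately show ?case
      using 0 by metis
  next
    case (Suc k)
    then obtain i where i: "Poly_Mapping.lookup \<beta> i \<noteq> 0"
      by (metis sum.neutral Zero_not_Suc)
    define \<gamma> where "\<gamma> = \<beta> - Poly_Mapping.single i 1"
    have \<beta>: "\<beta> = \<gamma> + Poly_Mapping.single i 1"
      using i by (intro poly_mapping_eqI) (auto simp: \<gamma>_def lookup_add lookup_minus lookup_single when_def)
    have "line_poly p t (axis i 1) = 0" for t
      by (rule line_poly_unique) (simp add: Suc.prems)
    then have "cpoly_eval (partial i p) t = 0" for t
      using line_poly_dir_deriv[of "axis i 1" p t]
      by (simp add: cpoly_eval_line_poly[of _ t "axis i 1"] dir_deriv_axis)
    moreover have "(\<Sum>j\<in>UNIV. Poly_Mapping.lookup \<gamma> j) = k"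
    proof -
      have "(\<Sum>j\<in>UNIV. Poly_Mapping.lookup (Poly_Mapping.single i (1::nat)) j) = 1"
        by (simp add: lookup_single when_def)
      then show ?thesis
        using Suc.prems(2) unfolding \<beta> lookup_add sum.distrib by simp
    qed
    ultimately have "Poly_Mapping.lookup (partial i p) \<gamma> = 0"
      by (rule Suc.IH)
    then show ?case
      by (simp add: lookup_partial \<beta> del: of_nat_add of_nat_Suc)
  qed
  then show ?thesis
    by (intro poly_mapping_eqI) simp
qed

lemma cpoly_eqI:
  assumes "\<And>t. cpoly_eval p t = cpoly_eval q t"
  shows "p = q"
  using cpoly_eval_eq_0D[of "p - q"] assms by (simp add: cpoly_eval_minus)

text \<open>Taylor coefficients along a line are derivatives divided by factorials. A power of a
  linear form in the ideal thus means degree below \<open>m\<close> on every line in direction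
  \<open>y\<close>; the kernels are handled in this form.\<close>

lemma dir_deriv_power_eq_0_iff:
  "(dir_deriv y ^^ m) p = 0 \<longleftrightarrow> (\<forall>t. \<forall>i\<ge>m. coeff (line_poly p t y) i = 0)"
proof
  assume *: "(dir_deriv y ^^ m) p = 0"
  show "\<forall>t. \<forall>i\<ge>m. coeff (line_poly p t y) i = 0"
  proof (intro allI impI)
    fix t i assume "m \<le> i"
    then have "(dir_deriv y ^^ i) p = 0"
      by (induction i rule: dec_induct) (simp_all add: *)
    then show "coeff (line_poly p t y) i = 0"
      using cpoly_eval_dir_deriv_power[where y = y and m = i and p = p and t = t] by simp
  qed
next
  assume "\<forall>t. \<forall>i\<ge>m. coeff (line_poly p t y) i = 0"
  then show "(dir_deriv y ^^ m) p = 0"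
    by (intro cpoly_eval_eq_0D) (simp add: cpoly_eval_dir_deriv_power)
qed

lemma dir_deriv_power_eq_0_mono:
  "(dir_deriv y ^^ m) p = 0 \<Longrightarrow> m \<le> n \<Longrightarrow> (dir_deriv y ^^ n) p = 0"
  by (auto simp: dir_deriv_power_eq_0_iff)

text \<open>The product with the linear form of \<open>x\<close> vanishes everywhere, and on lines
  in direction \<open>x\<close> that form is a nonzero univariate polynomial, which cancels.\<close>

lemma cpoly_eq_0_off_hyperplane:
  fixes x :: "real ^ 'n"
  assumes "x \<noteq> 0" and "\<And>t. x \<bullet> t \<noteq> 0 \<Longrightarrow> cpoly_eval p t = 0"
  shows "p = 0"
proof (rule cpoly_eval_eq_0D)
  fix t
  have "linear_form x * p = 0"
    using assms(2) by (intro cpoly_eval_eq_0D) (auto simp: cpoly_eval_mult cpoly_eval_linear_form)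
  then have "line_poly (linear_form x) t x * line_poly p t x = 0"
    by (simp flip: line_poly_mult)
  moreover have "line_poly (linear_form x) t x \<noteq> 0"
    using assms(1) by (simp add: line_poly_linear_form)
  ultimately have "line_poly p t x = 0"
    by (simp only: mult_eq_0_iff) simp
  then show "cpoly_eval p t = 0"
    by (simp add: cpoly_eval_line_poly[of p t x])
qed

text \<open>Algebra generators suffice for constructions that respect products, such as the
  substitution behind \<open>cpoly_restrict\<close>.\<close>

lemma cpoly_induct [case_names const var add mult]:
  fixes p :: "('n::finite) cpoly"
  assumes const: "\<And>c. P (Poly_Mapping.single 0 c)"
    and var: "\<And>i. P (Poly_Mapping.single (Poly_Mapping.single i 1) 1)"
    and add: "\<And>p q. P p \<Longrightarrow> P q \<Longrightarrow> P (p + q)"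
    and mult: "\<And>p q. P p \<Longrightarrow> P q \<Longrightarrow> P (p * q)"
  shows "P p"
proof (induction p rule: cpoly_induct_single)
  case (single \<beta> c)
  let ?X = "\<lambda>i. Poly_Mapping.single (Poly_Mapping.single i 1) 1 :: 'n cpoly"
  have pow: "P (?X i ^ k)" for i k
    by (induction k) (use const[of 1] in \<open>auto intro: mult var simp del: One_nat_def\<close>)
  have "P (\<Prod>i\<in>A. ?X i ^ Poly_Mapping.lookup \<beta> i)" for A
    by (induction A rule: infinite_finite_induct) (use const[of 1] in \<open>auto intro: mult pow simp del: One_nat_def\<close>)
  then have "P (Poly_Mapping.single 0 c * (\<Prod>i\<in>UNIV. ?X i ^ Poly_Mapping.lookup \<beta> i))"
    by (intro mult const)
  moreover have eval_prod: "cpoly_eval (\<Prod>i\<in>A. f i) t = (\<Prod>i\<in>A. cpoly_eval (f i) t)"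
    for f :: "'n \<Rightarrow> 'n cpoly" and A t
    by (induction A rule: infinite_finite_induct)
      (simp_all add: cpoly_eval_mult flip: single_one add: cpoly_eval_const)
  have "Poly_Mapping.single 0 c * (\<Prod>i\<in>UNIV. ?X i ^ Poly_Mapping.lookup \<beta> i) = Poly_Mapping.single \<beta> c"
    by (rule cpoly_eqI)
      (simp add: cpoly_eval_mult cpoly_eval_single[of \<beta>] cpoly_eval_const eval_prod cpoly_eval_power
        cpoly_eval_var del: One_nat_def)
  ultimately show ?case
    by simp
qed (rule add)


subsection \<open>Kernels of ideals generated by powers of linear forms\<close>

lemma partial_power_commute: "(partial i ^^ k) ((partial j ^^ m) p) = (partial j ^^ m) ((partial i ^^ k) p)"
proof -
  have *: "partial i ((partial j ^^ m) p) = (partial j ^^ m) (partial i p)" for m p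
    by (induction m) (simp_all add: partial_commute[of i j])
  show ?thesis
    by (induction k) (simp_all add: *)
qed

lemma fold_partial_insert:
  assumes "finite A" "a \<notin> A"
  shows "Finite_Set.fold (\<lambda>i. partial i ^^ Poly_Mapping.lookup \<alpha> i) p (insert a A) =
    (partial a ^^ Poly_Mapping.lookup \<alpha> a)
      (Finite_Set.fold (\<lambda>i. partial i ^^ Poly_Mapping.lookup \<alpha> i) p A)"
  using comp_fun_commute_on.fold_insert[OF comp_fun_commute_partial[unfolded comp_fun_commute_def']]
    assms by simp

lemma partial_power_fold:
  assumes "finite A"
  shows "(partial j ^^ m) (Finite_Set.fold (\<lambda>i. partial i ^^ Poly_Mapping.lookup \<alpha> i) p A) =
    Finite_Set.fold (\<lambda>i. partial i ^^ Poly_Mapping.lookup \<alpha> i) ((partial j ^^ m) p) A"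
  using assms
  by (induction A)
    (simp_all add: fold_partial_insert partial_power_commute[where i = j])

lemma partial_monom_add: "partial_monom (\<alpha> + \<beta>) p = partial_monom \<alpha> (partial_monom \<beta> p)"
proof -
  have "Finite_Set.fold (\<lambda>i. partial i ^^ Poly_Mapping.lookup (\<alpha> + \<beta>) i) p A =
      Finite_Set.fold (\<lambda>i. partial i ^^ Poly_Mapping.lookup \<alpha> i)
        (Finite_Set.fold (\<lambda>i. partial i ^^ Poly_Mapping.lookup \<beta> i) p A) A" if "finite A" for A
    using that
  proof (induction A)
    case (insert a A)
    then show ?case
      by (simp add: fold_partial_insert)
        (simp add: lookup_add funpow_add partial_power_fold)
  qed simp
  then show ?thesis
    by (simp add: partial_monom_def)
qed

lemma partial_power_linear:
  "(partial i ^^ k) (p + q) = (partial i ^^ k) p + (partial i ^^ k) q"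
  "(partial i ^^ k) (cpoly_scale c p) = cpoly_scale c ((partial i ^^ k) p)"
  by (induction k) (simp_all add: partial_add partial_scale)

lemma partial_monom_linear:
  "partial_monom \<alpha> (p + q) = partial_monom \<alpha> p + partial_monom \<alpha> q"
  "partial_monom \<alpha> (cpoly_scale c p) = cpoly_scale c (partial_monom \<alpha> p)"
proof -
  let ?F = "\<lambda>p A. Finite_Set.fold (\<lambda>i. partial i ^^ Poly_Mapping.lookup \<alpha> i) p A"
  have "?F (p + q) A = ?F p A + ?F q A \<and> ?F (cpoly_scale c p) A = cpoly_scale c (?F p A)"
    if "finite A" for A
    using that by (induction A)
      (simp_all add: fold_partial_insert partial_power_linear)
  then show "partial_monom \<alpha> (p + q) = partial_monom \<alpha> p + partial_monom \<alpha> q"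
    "partial_monom \<alpha> (cpoly_scale c p) = cpoly_scale c (partial_monom \<alpha> p)"
    by (simp_all add: partial_monom_def)
qed

lemma partial_fold_id:
  assumes "finite A" and "\<And>i. i \<in> A \<Longrightarrow> Poly_Mapping.lookup \<alpha> i = 0"
  shows "Finite_Set.fold (\<lambda>i. partial i ^^ Poly_Mapping.lookup \<alpha> i) p A = p"
  using assms
  by (induction A) (simp_all add: fold_partial_insert)

lemma partial_monom_0: "partial_monom 0 p = p"
  unfolding partial_monom_def by (rule partial_fold_id) simp_all

lemma partial_monom_single: "partial_monom (Poly_Mapping.single i 1) p = partial i p"
proof -
  have "UNIV = insert i (UNIV - {i})"
    by auto
  then have "partial_monom (Poly_Mapping.single i 1) p =
    Finite_Set.fold (\<lambda>j. partial j ^^ Poly_Mapping.lookup (Poly_Mapping.single i 1) j) p (insert i (UNIV - {i}))"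
    by (simp add: partial_monom_def)
  also have "\<dots> = partial i p"
    by (subst fold_partial_insert, simp, simp, subst partial_fold_id)
      (simp_all add: lookup_single when_def)
  finally show ?thesis .
qed

lemma diff_op_add: "diff_op (a + b) p = diff_op a p + diff_op b p"
  unfolding diff_op_def by (rule setsum_keys_plus_distrib) (simp_all add: cpoly.scale_left_distrib)

lemma diff_op_single: "diff_op (Poly_Mapping.single \<alpha> c) p = cpoly_scale c (partial_monom \<alpha> p)"
  by (simp add: diff_op_def)

lemma diff_op_0 [simp]: "diff_op 0 p = 0"
  by (simp add: diff_op_def)

lemma diff_op_sum: "diff_op (\<Sum>x\<in>A. f x) p = (\<Sum>x\<in>A. diff_op (f x) p)"
  by (induction A rule: infinite_finite_induct) (simp_all add: diff_op_add)

lemma diff_op_add_right: "diff_op a (p + q) = diff_op a p + diff_op a q"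
  by (simp add: diff_op_def partial_monom_linear cpoly.scale_right_distrib sum.distrib)

lemma diff_op_0_right [simp]: "diff_op a 0 = 0"
  using diff_op_add_right[of a 0 0] by simp

lemma diff_op_mult: "diff_op (a * b) p = diff_op a (diff_op b p)"
proof (induction a rule: cpoly_induct_single)
  case (single \<alpha> c)
  show ?case
    by (induction b rule: cpoly_induct_single)
      (simp_all add: mult_single diff_op_single partial_monom_add partial_monom_linear
        distrib_left diff_op_add diff_op_add_right)
qed (simp add: distrib_right diff_op_add)

lemma diff_op_linear_form: "diff_op (linear_form y) p = dir_deriv y p"
  by (simp add: linear_form_def dir_deriv_def diff_op_sum diff_op_single partial_monom_single
      del: One_nat_def)

lemma diff_op_linear_form_power: "diff_op (linear_form y ^ m) p = (dir_deriv y ^^ m) p"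
proof (induction m)
  case 0
  show ?case
    by (simp add: diff_op_single partial_monom_0 flip: single_one)
qed (simp add: diff_op_mult diff_op_linear_form)

text \<open>Multiplication becomes composition of operators, so the \<open>q\<close> with
  \<open>diff_op q p = 0\<close> form an ideal and generators suffice.\<close>

lemma ideal_ker_ideal_gen: "ideal_ker (ideal_gen G) = {p. \<forall>g\<in>G. diff_op g p = 0}"
proof -
  have "diff_op q p = 0" if "\<forall>g\<in>G. diff_op g p = 0" "q \<in> ideal_gen G" for p q
  proof -
    have "ideal_gen G \<subseteq> {q. diff_op q p = 0}"
      unfolding ideal_gen_def using that(1)
      by (intro module.span_minimal[OF module_times])
        (auto simp: module.subspace_def[OF module_times] diff_op_add diff_op_mult)
    then show ?thesis
      using that(2) by auto
  qed
  moreover have "G \<subseteq> ideal_gen G"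
    unfolding ideal_gen_def by (rule module.span_superset[OF module_times])
  ultimately show ?thesis
    by (auto simp: ideal_ker_def)
qed

text \<open>A pair \<open>(y, m)\<close> stands for the \<open>m\<close>-th power of the linear form
  of \<open>y\<close>. Without reference to facets, pairs can be added and exponents lowered when a
  vector is contracted or deleted.\<close>

definition power_kernel :: "((real ^ 'n) \<times> nat) set \<Rightarrow> ('n::finite) cpoly set" where
  "power_kernel C = {p. \<forall>(y, m)\<in>C. (dir_deriv y ^^ m) p = 0}"

lemma ideal_ker_powers:
  "ideal_ker (ideal_gen ((\<lambda>H. linear_form (\<eta> H) ^ m H) ` F)) = power_kernel ((\<lambda>H. (\<eta> H, m H)) ` F)"
  by (auto simp: ideal_ker_ideal_gen power_kernel_def diff_op_linear_form_power)

lemma power_kernel_mono: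
  assumes "\<And>y m. (y, m) \<in> D \<Longrightarrow> \<exists>k\<le>m. (y, k) \<in> C"
  shows "power_kernel C \<subseteq> power_kernel D"
proof
  fix p assume p: "p \<in> power_kernel C"
  have "(dir_deriv y ^^ m) p = 0" if ym: "(y, m) \<in> D" for y m
  proof -
    obtain k where "k \<le> m" "(y, k) \<in> C"
      using assms[OF ym] by blast
    then show ?thesis
      using p dir_deriv_power_eq_0_mono[of k y p m] by (auto simp: power_kernel_def)
  qed
  then show "p \<in> power_kernel D"
    by (auto simp: power_kernel_def)
qed

lemma dir_deriv_power_linear:
  "(dir_deriv y ^^ k) (p + q) = (dir_deriv y ^^ k) p + (dir_deriv y ^^ k) q"
  "(dir_deriv y ^^ k) (cpoly_scale c p) = cpoly_scale c ((dir_deriv y ^^ k) p)"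
  by (induction k) (simp_all add: dir_deriv_add dir_deriv_scale)

lemma subspace_power_kernel: "cpoly.subspace (power_kernel C)"
proof -
  have [simp]: "(dir_deriv y ^^ k) 0 = 0" for y :: "real ^ 'n" and k
    by (induction k) simp_all
  show ?thesis
    by (fastforce simp: cpoly.subspace_def power_kernel_def dir_deriv_power_linear)
qed

section \<open>Dimension bounds and restriction to a hyperplane\<close>

text \<open>Asserts finite dimension along with the bound, unlike an inequality for
  \<open>cpoly.dim\<close>.\<close>

definition cpoly_dim_le :: "'n cpoly set \<Rightarrow> nat \<Rightarrow> bool" where
  "cpoly_dim_le V N \<longleftrightarrow> (\<exists>B. finite B \<and> card B \<le> N \<and> V \<subseteq> cpoly.span B)"

lemma cpoly_dim_le_mono: "cpoly_dim_le V N \<Longrightarrow> W \<subseteq> V \<Longrightarrow> N \<le> M \<Longrightarrow> cpoly_dim_le W M"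
  unfolding cpoly_dim_le_def by (meson order_trans)

lemma cpoly_dim_le_image:
  assumes "module_hom cpoly_scale cpoly_scale T" and "cpoly_dim_le V N"
  shows "cpoly_dim_le (T ` V) N"
proof -
  interpret module_hom cpoly_scale cpoly_scale T by fact
  obtain B where B: "finite B" "card B \<le> N" "V \<subseteq> cpoly.span B"
    using assms(2) by (auto simp: cpoly_dim_le_def)
  then have "T ` V \<subseteq> cpoly.span (T ` B)"
    by (auto simp: span_image)
  moreover have "card (T ` B) \<le> N"
    using B card_image_le order_trans by blast
  ultimately show ?thesis
    using B by (auto simp: cpoly_dim_le_def)
qed

lemma cpoly_dim_le_rank_nullity:
  assumes T: "module_hom cpoly_scale cpoly_scale T" and V: "cpoly.subspace V"
    and image: "cpoly_dim_le (T ` V) M" and kernel: "cpoly_dim_le {p \<in> V. T p = 0} N"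
  shows "cpoly_dim_le V (M + N)"
proof -
  interpret module_hom cpoly_scale cpoly_scale T by fact
  obtain B where B: "finite B" "card B \<le> N" "{p \<in> V. T p = 0} \<subseteq> cpoly.span B"
    using kernel by (auto simp: cpoly_dim_le_def)
  obtain E where E: "finite E" "card E \<le> M" "T ` V \<subseteq> cpoly.span E"
    using image by (auto simp: cpoly_dim_le_def)
  obtain D where D: "D \<subseteq> T ` V" "cpoly.independent D" "T ` V \<subseteq> cpoly.span D"
    using cpoly.maximal_independent_subset by blast
  have fin: "finite D" "card D \<le> M"
    using cpoly.independent_span_bound[OF E(1) D(2)] order_trans[OF D(1) E(3)] E(2) by simp_all
  \<comment> \<open>Lift a basis of the image: up to a combination of the lifts, every vector of
    \<open>V\<close> lies in the kernel.\<close>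
  obtain C where C: "C \<subseteq> V" "inj_on T C" "D = T ` C"
    using D(1) by (auto simp: subset_image_inj)
  have "finite C" "card C \<le> M"
    using fin C by (auto simp: card_image finite_image_iff)
  moreover have "V \<subseteq> cpoly.span (B \<union> C)"
  proof
    fix v assume v: "v \<in> V"
    then have "T v \<in> T ` cpoly.span C"
      using D(3) C(3) by (auto simp: span_image)
    then obtain u where u: "u \<in> cpoly.span C" "T u = T v"
      by auto
    have "u \<in> V"
      using u(1) C(1) V cpoly.span_minimal by blast
    then have "v - u \<in> cpoly.span B"
      using v u V B(3) by (auto simp: diff cpoly.subspace_diff)
    then have "(v - u) + u \<in> cpoly.span (B \<union> C)"
      using u(1) by (intro cpoly.span_add) (auto intro: cpoly.span_mono[THEN subsetD, rotated])
    then show "v \<in> cpoly.span (B \<union> C)"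
      by simp
  qed
  moreover have "card (B \<union> C) \<le> M + N"
    using card_Un_le[of B C] B \<open>card C \<le> M\<close> by linarith
  ultimately show ?thesis
    using B by (auto simp: cpoly_dim_le_def)
qed

text \<open>The pullback \<open>q\<close> along the orthogonal projection and the quotient
  \<open>g\<close> of the difference by the linear form are built together. Both pass to sums and
  products.\<close>

lemma cpoly_restrict_exists:
  fixes x :: "real ^ 'n" and p :: "'n cpoly"
  assumes "x \<noteq> 0"
  shows "\<exists>q g. \<forall>t. cpoly_eval q t = cpoly_eval p (t - ((x \<bullet> t) / (x \<bullet> x)) *\<^sub>R x) \<and>
      cpoly_eval p t = cpoly_eval q t + of_real (x \<bullet> t) * cpoly_eval g t"
proof (induction p rule: cpoly_induct)
  case (const c)
  show ?case
    by (rule exI[of _ "Poly_Mapping.single 0 c"], rule exI[of _ 0]) (simp add: cpoly_eval_const)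
next
  case (var i)
  show ?case
    by (rule exI[of _ "Poly_Mapping.single (Poly_Mapping.single i 1) 1 -
          cpoly_scale (of_real (x $ i / (x \<bullet> x))) (linear_form x)"],
        rule exI[of _ "Poly_Mapping.single 0 (of_real (x $ i / (x \<bullet> x)))"])
      (simp add: cpoly_eval_const cpoly_eval_minus cpoly_eval_var cpoly_eval_scale
        cpoly_eval_linear_form field_simps del: One_nat_def)
next
  case (add p1 p2)
  then obtain q1 g1 q2 g2 where
    q: "\<And>t. cpoly_eval q1 t = cpoly_eval p1 (t - ((x \<bullet> t) / (x \<bullet> x)) *\<^sub>R x)"
      "\<And>t. cpoly_eval q2 t = cpoly_eval p2 (t - ((x \<bullet> t) / (x \<bullet> x)) *\<^sub>R x)" and
    p: "\<And>t. cpoly_eval p1 t = cpoly_eval q1 t + of_real (x \<bullet> t) * cpoly_eval g1 t"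
      "\<And>t. cpoly_eval p2 t = cpoly_eval q2 t + of_real (x \<bullet> t) * cpoly_eval g2 t"
    by metis
  show ?case
    by (intro exI[of _ "q1 + q2"] exI[of _ "g1 + g2"] allI conjI)
      (simp add: cpoly_eval_add flip: q, simp add: cpoly_eval_add p algebra_simps)
next
  case (mult p1 p2)
  then obtain q1 g1 q2 g2 where
    q: "\<And>t. cpoly_eval q1 t = cpoly_eval p1 (t - ((x \<bullet> t) / (x \<bullet> x)) *\<^sub>R x)"
      "\<And>t. cpoly_eval q2 t = cpoly_eval p2 (t - ((x \<bullet> t) / (x \<bullet> x)) *\<^sub>R x)" and
    p: "\<And>t. cpoly_eval p1 t = cpoly_eval q1 t + of_real (x \<bullet> t) * cpoly_eval g1 t"
      "\<And>t. cpoly_eval p2 t = cpoly_eval q2 t + of_real (x \<bullet> t) * cpoly_eval g2 t"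
    by metis
  \<comment> \<open>From \<open>p1 p2 - q1 q2 = (p1 - q1) p2 + q1 (p2 - q2)\<close>.\<close>
  show ?case
    by (intro exI[of _ "q1 * q2"] exI[of _ "g1 * p2 + q1 * g2"] allI conjI)
      (simp add: cpoly_eval_mult flip: q, simp add: cpoly_eval_add cpoly_eval_mult p algebra_simps)
qed

text \<open>Composition with the orthogonal projection keeps the restriction a polynomial in all
  variables. It is determined by its values, so the choice is unique for nonzero
  \<open>x\<close>.\<close>

definition cpoly_restrict :: "real ^ 'n \<Rightarrow> 'n cpoly \<Rightarrow> ('n::finite) cpoly" where
  "cpoly_restrict x p =
     (SOME q. \<forall>t. cpoly_eval q t = cpoly_eval p (t - ((x \<bullet> t) / (x \<bullet> x)) *\<^sub>R x))"

lemma cpoly_eval_restrict: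
  assumes "x \<noteq> 0"
  shows "cpoly_eval (cpoly_restrict x p) t = cpoly_eval p (t - ((x \<bullet> t) / (x \<bullet> x)) *\<^sub>R x)"
proof -
  have "\<exists>q. \<forall>t. cpoly_eval q t = cpoly_eval p (t - ((x \<bullet> t) / (x \<bullet> x)) *\<^sub>R x)"
    using cpoly_restrict_exists[OF assms] by metis
  from someI_ex[OF this] show ?thesis
    by (simp add: cpoly_restrict_def)
qed

lemma module_hom_cpoly_restrict:
  "x \<noteq> 0 \<Longrightarrow> module_hom cpoly_scale cpoly_scale (cpoly_restrict x)"
  by unfold_locales
    (auto intro!: cpoly_eqI simp: cpoly_eval_restrict cpoly_eval_add cpoly_eval_scale)

lemma module_hom_cpoly_times: "module_hom cpoly_scale cpoly_scale ((*) q)"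
  by unfold_locales (simp_all add: cpoly_scale_def algebra_simps)

lemma cpoly_restrict_eq_0D:
  assumes "x \<noteq> 0" "cpoly_restrict x p = 0"
  obtains g where "p = linear_form x * g"
proof -
  obtain q g where *: "\<And>t. cpoly_eval q t = cpoly_eval p (t - ((x \<bullet> t) / (x \<bullet> x)) *\<^sub>R x)"
      "\<And>t. cpoly_eval p t = cpoly_eval q t + of_real (x \<bullet> t) * cpoly_eval g t"
    using cpoly_restrict_exists[OF assms(1)] by metis
  have "cpoly_eval q t = 0" for t
    using cpoly_eval_restrict[OF assms(1), of p t] assms(2) *(1) by simp
  then have "p = linear_form x * g"
    using *(2) by (intro cpoly_eqI) (simp add: cpoly_eval_mult cpoly_eval_linear_form)
  then show ?thesis
    by (rule that)
qed

text \<open>On lines in direction \<open>y\<close> the linear form of \<open>x\<close> is the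
  constant \<open>x \<bullet> t\<close>; where it is nonzero, it cancels.\<close>

lemma dir_deriv_power_linear_form_mult_orthogonal:
  assumes x: "x \<noteq> 0" "y \<bullet> x = 0" and "(dir_deriv y ^^ m) (linear_form x * g) = 0"
  shows "(dir_deriv y ^^ m) g = 0"
proof (rule cpoly_eq_0_off_hyperplane[OF x(1)])
  fix t assume t: "x \<bullet> t \<noteq> 0"
  have "coeff (line_poly (linear_form x * g) t y) m = 0"
    using assms(3) by (simp add: dir_deriv_power_eq_0_iff)
  then show "cpoly_eval ((dir_deriv y ^^ m) g) t = 0"
    using t x(2) by (simp add: cpoly_eval_dir_deriv_power line_poly_mult line_poly_linear_form
        inner_commute[of x y])
qed

lemma coeff_linear_times_eq_0D:
  fixes q :: "complex poly"
  assumes "b \<noteq> 0" "\<And>i. i \<ge> m \<Longrightarrow> coeff ([:a, b:] * q) i = 0" "i \<ge> m - 1"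
  shows "coeff q i = 0"
proof (cases "q = 0")
  case False
  have "[:a, b:] \<noteq> 0" "degree [:a, b:] = 1"
    using assms(1) by simp_all
  then have "degree ([:a, b:] * q) = Suc (degree q)"
    using degree_mult_eq[of "[:a, b:]" q] False by linarith
  moreover have "[:a, b:] * q \<noteq> 0"
    using False assms(1) by (simp only: mult_eq_0_iff) simp
  ultimately have "Suc (degree q) < m"
    using assms(2)[of "degree ([:a, b:] * q)"] by (metis leading_coeff_0_iff not_le)
  then show ?thesis
    using assms(3) by (intro coeff_eq_0) simp
qed simp

text \<open>On lines in direction \<open>y\<close> the linear form has degree exactly 1, so the
  cofactor has degree one less than the product. For \<open>m = 0\<close> the product and hence
  \<open>g\<close> is zero, in accordance with the truncated \<open>m - 1\<close>.\<close>

lemma dir_deriv_power_linear_form_mult: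
  assumes "y \<bullet> x \<noteq> 0" and "(dir_deriv y ^^ m) (linear_form x * g) = 0"
  shows "(dir_deriv y ^^ (m - 1)) g = 0"
  unfolding dir_deriv_power_eq_0_iff
proof (intro allI impI)
  fix t i assume i: "m - 1 \<le> i"
  show "coeff (line_poly g t y) i = 0"
  proof (rule coeff_linear_times_eq_0D[OF _ _ i])
    show "complex_of_real (x \<bullet> y) \<noteq> 0"
      using assms(1) by (simp add: inner_commute)
    show "coeff ([:of_real (x \<bullet> t), of_real (x \<bullet> y):] * line_poly g t y) i = 0" if "m \<le> i" for i
      using assms(2) that unfolding dir_deriv_power_eq_0_iff line_poly_mult line_poly_linear_form
      by blast
  qed
qed

text \<open>Restriction to the hyperplane orthogonal to \<open>x\<close>; a polynomial that vanishes there is a multiple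
  of the linear form of \<open>x\<close>, and the quotient has smaller degree along every line transversal to
  that hyperplane.\<close>

lemma cpoly_dim_le_power_kernel_split:
  fixes x :: "real ^ 'n"
  assumes x: "x \<noteq> 0"
    and M: "cpoly_dim_le (power_kernel (insert (x, 1) {(y, m). (y, m) \<in> C \<and> y \<bullet> x = 0})) M"
    and N: "cpoly_dim_le (power_kernel {(y, m). (y, m) \<in> C \<and> y \<bullet> x = 0 \<or>
      y \<bullet> x \<noteq> 0 \<and> (\<exists>k. (y, k) \<in> C \<and> m = k - 1)}) N"
  shows "cpoly_dim_le (power_kernel C) (M + N)"
proof (rule cpoly_dim_le_rank_nullity[OF module_hom_cpoly_restrict[OF x] subspace_power_kernel])
  let ?\<pi> = "\<lambda>t. t - ((x \<bullet> t) / (x \<bullet> x)) *\<^sub>R x"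
  show "cpoly_dim_le (cpoly_restrict x ` power_kernel C) M"
  proof (rule cpoly_dim_le_mono[OF M _ order_refl])
    show "cpoly_restrict x ` power_kernel C \<subseteq>
        power_kernel (insert (x, 1) {(y, m). (y, m) \<in> C \<and> y \<bullet> x = 0})"
    proof
      fix r assume "r \<in> cpoly_restrict x ` power_kernel C"
      then obtain p where p: "p \<in> power_kernel C" and r: "r = cpoly_restrict x p"
        by auto
      have "(dir_deriv y ^^ m) r = 0" if "(y, m) \<in> C" "y \<bullet> x = 0" for y m
      proof -
        \<comment> \<open>As \<open>y\<close> is orthogonal to \<open>x\<close>, the projection maps
          a line in direction \<open>y\<close> to a parallel line.\<close>
        have "line_poly r t y = line_poly p (?\<pi> t) y" for t
          by (rule line_poly_unique)
            (use that in \<open>simp add: r cpoly_eval_restrict x poly_line_poly inner_add_right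
              inner_commute[of x y] algebra_simps\<close>)
        moreover have "(dir_deriv y ^^ m) p = 0"
          using p that by (auto simp: power_kernel_def)
        ultimately show ?thesis
          unfolding dir_deriv_power_eq_0_iff by simp
      qed
      moreover have "(dir_deriv x ^^ 1) r = 0"
      proof -
        \<comment> \<open>The projection collapses lines in direction \<open>x\<close>.\<close>
        have "line_poly r t x = [:cpoly_eval p (?\<pi> t):]" for t
        proof (rule line_poly_unique)
          fix s :: real
          have "(x \<bullet> (t + s *\<^sub>R x)) / (x \<bullet> x) = (x \<bullet> t) / (x \<bullet> x) + s"
            using x by (simp add: inner_add_right add_divide_distrib)
          then show "cpoly_eval r (t + s *\<^sub>R x) = poly [:cpoly_eval p (?\<pi> t):] (of_real s)"
            by (simp add: r cpoly_eval_restrict x algebra_simps)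
        qed
        then show ?thesis
          unfolding dir_deriv_power_eq_0_iff by (auto simp: coeff_pCons split: nat.splits)
      qed
      ultimately show "r \<in> power_kernel (insert (x, 1) {(y, m). (y, m) \<in> C \<and> y \<bullet> x = 0})"
        by (auto simp: power_kernel_def)
    qed
  qed
  show "cpoly_dim_le {p \<in> power_kernel C. cpoly_restrict x p = 0} N"
  proof (rule cpoly_dim_le_mono[OF cpoly_dim_le_image[OF module_hom_cpoly_times[of "linear_form x"] N] _ order_refl])
    show "{p \<in> power_kernel C. cpoly_restrict x p = 0} \<subseteq> (*) (linear_form x) `
        power_kernel {(y, m). (y, m) \<in> C \<and> y \<bullet> x = 0 \<or> y \<bullet> x \<noteq> 0 \<and> (\<exists>k. (y, k) \<in> C \<and> m = k - 1)}"
    proof clarify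
      fix p assume p: "p \<in> power_kernel C" "cpoly_restrict x p = 0"
      obtain g where g: "p = linear_form x * g"
        using cpoly_restrict_eq_0D[OF x p(2)] by blast
      have *: "(dir_deriv y ^^ m) (linear_form x * g) = 0" if "(y, m) \<in> C" for y m
        using p(1) that by (auto simp: power_kernel_def g)
      have "g \<in> power_kernel {(y, m). (y, m) \<in> C \<and> y \<bullet> x = 0 \<or>
          y \<bullet> x \<noteq> 0 \<and> (\<exists>k. (y, k) \<in> C \<and> m = k - 1)}"
        unfolding power_kernel_def mem_Collect_eq
      proof clarify
        fix y m
        assume "(y, m) \<in> C \<and> y \<bullet> x = 0 \<or> y \<bullet> x \<noteq> 0 \<and> (\<exists>k. (y, k) \<in> C \<and> m = k - 1)"
        then show "(dir_deriv y ^^ m) g = 0"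
          using dir_deriv_power_linear_form_mult_orthogonal[OF x _ *, of y m]
            dir_deriv_power_linear_form_mult[OF _ *, of y] by blast
      qed
      then show "p \<in> (*) (linear_form x) ` power_kernel {(y, m). (y, m) \<in> C \<and> y \<bullet> x = 0 \<or>
          y \<bullet> x \<noteq> 0 \<and> (\<exists>k. (y, k) \<in> C \<and> m = k - 1)}"
        unfolding g by (rule imageI)
    qed
  qed
qed

text \<open>The start of the induction: the whole space has been contracted, and only constants
  remain.\<close>

lemma power_kernel_constants:
  fixes C :: "((real ^ 'n) \<times> nat) set"
  assumes "\<And>u. (u, 1) \<in> C"
  shows "cpoly_dim_le (power_kernel C) 1"
proof -
  have "p \<in> cpoly.span {1}" if "p \<in> power_kernel C" for p
  proof -
    have "cpoly_eval p u = cpoly_eval p 0" for u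
    proof -
      have "(dir_deriv u ^^ 1) p = 0"
        using assms that unfolding power_kernel_def by blast
      then have "degree (line_poly p 0 u) = 0"
        unfolding dir_deriv_power_eq_0_iff using degree_le[of 0 "line_poly p 0 u"] by auto
      then have "poly (line_poly p 0 u) (of_real 1) = poly (line_poly p 0 u) (of_real 0)"
        by (auto elim!: degree_eq_zeroE)
      then show ?thesis
        unfolding poly_line_poly by simp
    qed
    then have "p = cpoly_scale (cpoly_eval p 0) 1"
      by (intro cpoly_eqI) (simp add: cpoly_scale_def cpoly_eval_const)
    then show ?thesis
      using cpoly.span_scale[OF cpoly.span_base[of 1 "{1}"]] by (metis insertI1)
  qed
  then show ?thesis
    unfolding cpoly_dim_le_def by (intro exI[of _ "{1}"]) auto
qed

text \<open>Exponent 0 puts the constant 1 into the ideal. This arises from a vector whose removal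
  destroys spanning.\<close>

lemma power_kernel_trivial:
  assumes "(y, 0) \<in> C"
  shows "cpoly_dim_le (power_kernel C) 0"
  unfolding cpoly_dim_le_def using assms by (intro exI[of _ "{}"]) (auto simp: power_kernel_def)

lemma cpoly_dim_le_imp_dim:
  assumes "cpoly_dim_le V N"
  shows "cpoly_finite_dim V" "cpoly.dim V \<le> N"
  using assms cpoly.dim_le_card[of V] order_trans unfolding cpoly_dim_le_def cpoly_finite_dim_def
  by blast+


subsection \<open>The lower bound\<close>

text \<open>Gaussian elimination: the equation \<open>b\<close> is solved for an unknown
  \<open>t0\<close> with nonzero coefficient, and the remaining equations are corrected
  accordingly.\<close>

lemma homogeneous_system_nontrivial:
  fixes M :: "'b \<Rightarrow> 'a \<Rightarrow> complex"
  assumes "finite B" "finite T" "card B < card T"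
  shows "\<exists>a. (\<exists>t\<in>T. a t \<noteq> 0) \<and> (\<forall>b\<in>B. (\<Sum>t\<in>T. a t * M b t) = 0)"
  using assms
proof (induction B arbitrary: T M)
  case empty
  then obtain t where "t \<in> T"
    by fastforce
  then show ?case
    by (intro exI[of _ "\<lambda>_. 1"]) auto
next
  case (insert b B)
  show ?case
  proof (cases "\<forall>t\<in>T. M b t = 0")
    case True
    have "card B < card T"
      using insert by simp
    from insert.IH[OF insert.prems(1) this] show ?thesis
      using True by fastforce
  next
    case False
    then obtain t0 where t0: "t0 \<in> T" "M b t0 \<noteq> 0"
      by blast
    let ?T = "T - {t0}"
    have "card B < card ?T"
      using insert t0 by simp
    from insert.IH[OF _ this, of "\<lambda>c t. M c t - M c t0 * M b t / M b t0"] insert.prems(1)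
    obtain a where a: "\<exists>t\<in>?T. a t \<noteq> 0"
      "\<And>c. c \<in> B \<Longrightarrow> (\<Sum>t\<in>?T. a t * (M c t - M c t0 * M b t / M b t0)) = 0"
      by auto
    define s where "s = - (\<Sum>t\<in>?T. a t * M b t) / M b t0"
    define a' where "a' = a(t0 := s)"
    have sum: "(\<Sum>t\<in>T. a' t * M c t) = s * M c t0 + (\<Sum>t\<in>?T. a t * M c t)" for c
      using insert.prems(1) t0(1)
      by (subst sum.remove[of _ t0]) (auto simp: a'_def intro!: sum.cong)
    have "(\<Sum>t\<in>T. a' t * M c t) = 0" if "c \<in> insert b B" for c
    proof (cases "c = b")
      case True
      then show ?thesis
        using t0(2) unfolding sum by (simp add: s_def)
    next
      case False
      have "(\<Sum>t\<in>?T. a t * M c t) - (\<Sum>t\<in>?T. a t * M b t) / M b t0 * M c t0 =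
          (\<Sum>t\<in>?T. a t * (M c t - M c t0 * M b t / M b t0))"
        unfolding sum_divide_distrib sum_distrib_right sum_subtractf[symmetric]
        by (intro sum.cong refl) (simp add: field_simps t0)
      then show ?thesis
        using a(2)[of c] that False unfolding sum by (simp add: s_def)
    qed
    moreover have "\<exists>t\<in>T. a' t \<noteq> 0"
      using a(1) by (auto simp: a'_def)
    ultimately show ?thesis
      by blast
  qed
qed

section \<open>Moments of complex weights on a finite set\<close>

text \<open>Since \<open>(u \<bullet> v) ^ j\<close> is the inner product of the \<open>j\<close>-th
  tensor powers of \<open>u\<close> and \<open>v\<close>, the double sum is the squared norm of a
  weighted sum of tensor powers. If it is 0, the tensor is zero and so is the form that it defines.
  The induction splits off one tensor factor by coordinates, which changes the weights from
  \<open>b u\<close> to \<open>b u * u $ i\<close>.\<close>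

lemma gram_power_psd:
  fixes b :: "real ^ 'n \<Rightarrow> complex"
  shows "\<exists>r\<ge>0. (\<Sum>u\<in>T. \<Sum>v\<in>T. b u * cnj (b v) * of_real ((u \<bullet> v) ^ j)) = of_real r \<and>
    (r = 0 \<longrightarrow> (\<forall>t. (\<Sum>u\<in>T. b u * of_real ((u \<bullet> t) ^ j)) = 0))"
proof (induction j arbitrary: b)
  case 0
  have "(\<Sum>u\<in>T. \<Sum>v\<in>T. b u * cnj (b v)) = of_real ((cmod (\<Sum>u\<in>T. b u))\<^sup>2)"
    unfolding complex_norm_square by (simp add: sum_product)
  then show ?case
    by (intro exI[of _ "(cmod (\<Sum>u\<in>T. b u))\<^sup>2"]) auto
next
  case (Suc j)
  define r where "r b = Re (\<Sum>u\<in>T. \<Sum>v\<in>T. b u * cnj (b v) * of_real ((u \<bullet> v) ^ j))"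
    for b :: "real ^ 'n \<Rightarrow> complex"
  have r: "r b \<ge> 0"
    "(\<Sum>u\<in>T. \<Sum>v\<in>T. b u * cnj (b v) * of_real ((u \<bullet> v) ^ j)) = of_real (r b)"
    "r b = 0 \<Longrightarrow> (\<Sum>u\<in>T. b u * of_real ((u \<bullet> t) ^ j)) = 0" for b t
  proof -
    obtain s where s: "s \<ge> 0"
        "(\<Sum>u\<in>T. \<Sum>v\<in>T. b u * cnj (b v) * of_real ((u \<bullet> v) ^ j)) = of_real s"
        "s = 0 \<longrightarrow> (\<forall>t. (\<Sum>u\<in>T. b u * of_real ((u \<bullet> t) ^ j)) = 0)"
      using Suc.IH[of b] by blast
    have "r b = s"
      unfolding r_def s(2) by simp
    then show "r b \<ge> 0"
      "(\<Sum>u\<in>T. \<Sum>v\<in>T. b u * cnj (b v) * of_real ((u \<bullet> v) ^ j)) = of_real (r b)"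
      "r b = 0 \<Longrightarrow> (\<Sum>u\<in>T. b u * of_real ((u \<bullet> t) ^ j)) = 0"
      using s by blast+
  qed
  let ?b = "\<lambda>i u. b u * of_real (u $ i)"
  have "(\<Sum>u\<in>T. \<Sum>v\<in>T. b u * cnj (b v) * of_real ((u \<bullet> v) ^ Suc j)) =
      (\<Sum>u\<in>T. \<Sum>v\<in>T. \<Sum>i\<in>UNIV. ?b i u * cnj (?b i v) * of_real ((u \<bullet> v) ^ j))"
  proof (intro sum.cong refl)
    fix u v :: "real ^ 'n"
    have "complex_of_real ((u \<bullet> v) ^ Suc j) =
        (\<Sum>i\<in>UNIV. of_real (u $ i) * of_real (v $ i) * of_real ((u \<bullet> v) ^ j))"
      by (simp add: inner_vec_def flip: sum_distrib_right)
    then show "b u * cnj (b v) * of_real ((u \<bullet> v) ^ Suc j) =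
        (\<Sum>i\<in>UNIV. ?b i u * cnj (?b i v) * of_real ((u \<bullet> v) ^ j))"
      by (simp add: sum_distrib_left mult_ac)
  qed
  also have "\<dots> = (\<Sum>i\<in>UNIV. \<Sum>u\<in>T. \<Sum>v\<in>T. ?b i u * cnj (?b i v) * of_real ((u \<bullet> v) ^ j))"
    by (subst (2) sum.swap, subst sum.swap) (rule refl)
  also have "\<dots> = of_real (\<Sum>i\<in>UNIV. r (?b i))"
    unfolding r(2) by simp
  finally have eq: "(\<Sum>u\<in>T. \<Sum>v\<in>T. b u * cnj (b v) * of_real ((u \<bullet> v) ^ Suc j)) =
    of_real (\<Sum>i\<in>UNIV. r (?b i))" .
  have "(\<Sum>u\<in>T. b u * of_real ((u \<bullet> t) ^ Suc j)) = 0" if "(\<Sum>i\<in>UNIV. r (?b i)) = 0" for t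
  proof -
    have "r (?b i) = 0" for i
      using that r(1) by (simp add: sum_nonneg_eq_0_iff)
    then have "(\<Sum>u\<in>T. ?b i u * of_real ((u \<bullet> t) ^ j)) = 0" for i
      using r(3)[of "?b i"] by blast
    then have "0 = (\<Sum>i\<in>UNIV. of_real (t $ i) * (\<Sum>u\<in>T. ?b i u * of_real ((u \<bullet> t) ^ j)))"
      by simp
    also have "\<dots> = (\<Sum>i\<in>UNIV. \<Sum>u\<in>T. b u * (of_real (u $ i) * of_real (t $ i) * of_real ((u \<bullet> t) ^ j)))"
      by (simp add: sum_distrib_left mult_ac)
    also have "\<dots> = (\<Sum>u\<in>T. \<Sum>i\<in>UNIV. b u * (of_real (u $ i) * of_real (t $ i) * of_real ((u \<bullet> t) ^ j)))"
      by (rule sum.swap)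
    also have "\<dots> = (\<Sum>u\<in>T. b u * of_real ((u \<bullet> t) ^ Suc j))"
      by (intro sum.cong refl)
        (simp add: inner_vec_def flip: sum_distrib_left sum_distrib_right)
    finally show ?thesis
      by simp
  qed
  then show ?case
    using eq r(1) by (intro exI[of _ "\<Sum>i\<in>UNIV. r (?b i)"]) (auto intro: sum_nonneg)
qed

text \<open>Polarization: up to a nonzero binomial coefficient, the mixed sum is the coefficient of
  \<open>s ^ l\<close> in the pure moment at \<open>t + s y\<close>.\<close>

lemma mixed_moments_eq_0:
  fixes b :: "real ^ 'n \<Rightarrow> complex"
  assumes "\<And>t. (\<Sum>u\<in>T. b u * of_real ((u \<bullet> t) ^ (k + l))) = 0"
  shows "(\<Sum>u\<in>T. b u * (of_real ((u \<bullet> t) ^ k) * of_real ((u \<bullet> y) ^ l))) = 0"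
proof -
  define q where "q = (\<Sum>u\<in>T. smult (b u) ([:of_real (u \<bullet> t), of_real (u \<bullet> y):] ^ (k + l)))"
  have "poly q (of_real s) = (\<Sum>u\<in>T. b u * of_real ((u \<bullet> (t + s *\<^sub>R y)) ^ (k + l)))" for s
    by (simp add: q_def poly_sum inner_add_right)
  then have "q = 0"
    using assms by (intro complex_poly_eqI_real) simp
  then have "0 = coeff q l"
    by simp
  also have "\<dots> = of_nat ((k + l) choose l) * (\<Sum>u\<in>T. b u * (of_real ((u \<bullet> t) ^ k) * of_real ((u \<bullet> y) ^ l)))"
    by (simp add: q_def coeff_sum coeff_linear_poly_power sum_distrib_left mult_ac)
  finally show ?thesis
    by simp
qed

text \<open>A generic \<open>t\<close> separates \<open>v\<close> from the other points. The weights
  then annihilate every polynomial in \<open>u \<bullet> t\<close>, in particular one that vanishes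
  at all points of \<open>T\<close> except \<open>v\<close>.\<close>

lemma moments_determine_weights:
  fixes b :: "real ^ 'n \<Rightarrow> complex"
  assumes T: "finite T" and mom: "\<And>j t. (\<Sum>u\<in>T. b u * of_real ((u \<bullet> t) ^ j)) = 0" and v: "v \<in> T"
  shows "b v = 0"
proof -
  have "negligible (\<Union>w\<in>T - {v}. {t. (w - v) \<bullet> t = 0})"
    using T by (intro negligible_Union) (auto intro!: negligible_hyperplane)
  then have "(\<Union>w\<in>T - {v}. {t. (w - v) \<bullet> t = 0}) \<noteq> UNIV"
    using non_negligible_UNIV by metis
  then obtain t where t: "\<And>w. w \<in> T - {v} \<Longrightarrow> w \<bullet> t \<noteq> v \<bullet> t"
    by (auto simp: inner_diff_left)
  have t': "v \<bullet> t \<noteq> w \<bullet> t" if "w \<in> T \<and> w \<noteq> v" for w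
    using t[of w] that by auto
  have poly0: "(\<Sum>u\<in>T. b u * poly g (of_real (u \<bullet> t))) = 0" for g
  proof -
    have "(\<Sum>u\<in>T. b u * poly g (of_real (u \<bullet> t))) =
        (\<Sum>i\<le>degree g. coeff g i * (\<Sum>u\<in>T. b u * of_real ((u \<bullet> t) ^ i)))"
      unfolding poly_altdef sum_distrib_left
      by (subst sum.swap) (intro sum.cong refl, simp)
    then show ?thesis
      unfolding mom by simp
  qed
  define g where "g = (\<Prod>w\<in>T - {v}. [:- of_real (w \<bullet> t), 1:] :: complex poly)"
  have "poly g (of_real (u \<bullet> t)) = 0" if "u \<in> T - {v}" for u
    using T that by (auto simp: g_def poly_prod prod_zero_iff)
  then have "b v * poly g (of_real (v \<bullet> t)) = 0"
    using poly0[of g] T v by (subst (asm) sum.remove[of _ v]) simp_all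
  moreover have "poly g (of_real (v \<bullet> t)) \<noteq> 0"
    using T t' by (simp add: g_def poly_prod prod_zero_iff)
  ultimately show ?thesis
    by simp
qed

text \<open>On \<open>T\<close> the linear form of \<open>y\<close> is a zero of a monic polynomial of degree at most \<open>i\<close>, so its
  \<open>i\<close>-th power can be replaced by lower ones.\<close>

lemma lowest_moment_eq_0:
  fixes b :: "real ^ 'n \<Rightarrow> complex"
  assumes T: "finite T" and mom: "\<And>k t. k < j \<Longrightarrow> (\<Sum>u\<in>T. b u * of_real ((u \<bullet> t) ^ k)) = 0"
    and card: "card ((\<bullet>) y ` T) \<le> i" and "i \<le> j"
  shows "(\<Sum>u\<in>T. b u * (of_real ((u \<bullet> t) ^ (j - i)) * of_real ((u \<bullet> y) ^ i))) = 0"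
proof -
  define d where "d = card ((\<bullet>) y ` T)"
  define w where "w = (\<Prod>c\<in>(\<bullet>) y ` T. [:- of_real c, 1:] :: complex poly)"
  have "degree w = d"
    by (simp add: w_def d_def degree_prod_sum_eq)
  moreover have "lead_coeff w = 1"
    unfolding w_def lead_coeff_prod by simp
  ultimately have w: "poly w z = z ^ d + (\<Sum>k<d. coeff w k * z ^ k)" for z
    by (simp add: poly_altdef lessThan_Suc_atMost[symmetric])
  have "poly w (of_real (u \<bullet> y)) = 0" if "u \<in> T" for u
    using that T by (auto simp: w_def poly_prod prod_zero_iff inner_commute)
  then have red: "of_real ((u \<bullet> y) ^ d) = - (\<Sum>k<d. coeff w k * of_real ((u \<bullet> y) ^ k))" if "u \<in> T" for u
    using w[of "of_real (u \<bullet> y)"] that by (simp add: add_eq_0_iff2)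
  have "(\<Sum>u\<in>T. b u * (of_real ((u \<bullet> t) ^ (j - i)) * of_real ((u \<bullet> y) ^ i))) =
    (\<Sum>u\<in>T. \<Sum>k<d. - coeff w k * (b u * (of_real ((u \<bullet> t) ^ (j - i)) * of_real ((u \<bullet> y) ^ (k + (i - d))))))"
  proof (intro sum.cong refl)
    fix u assume u: "u \<in> T"
    have "complex_of_real ((u \<bullet> y) ^ i) = of_real ((u \<bullet> y) ^ d) * of_real ((u \<bullet> y) ^ (i - d))"
      using card by (simp add: d_def flip: power_add)
    also have "\<dots> = (\<Sum>k<d. - coeff w k * of_real ((u \<bullet> y) ^ (k + (i - d))))"
      unfolding red[OF u] sum_negf[symmetric] sum_distrib_right by (simp add: power_add mult_ac)
    finally show "b u * (of_real ((u \<bullet> t) ^ (j - i)) * of_real ((u \<bullet> y) ^ i)) =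
        (\<Sum>k<d. - coeff w k * (b u * (of_real ((u \<bullet> t) ^ (j - i)) * of_real ((u \<bullet> y) ^ (k + (i - d))))))"
      by (simp add: sum_distrib_left mult_ac)
  qed
  also have "\<dots> = (\<Sum>k<d. - coeff w k *
      (\<Sum>u\<in>T. b u * (of_real ((u \<bullet> t) ^ (j - i)) * of_real ((u \<bullet> y) ^ (k + (i - d))))))"
    by (subst sum.swap) (simp only: sum_distrib_left)
  also have "\<dots> = 0"
  proof (intro sum.neutral ballI)
    fix k assume "k \<in> {..<d}"
    \<comment> \<open>The total degree drops from \<open>j\<close> to \<open>j - (d - k)\<close>,
      and moments of lower degree vanish by assumption.\<close>
    then have lt: "j - i + (k + (i - d)) < j"
      using card \<open>i \<le> j\<close> by (simp add: d_def)
    show "- coeff w k * (\<Sum>u\<in>T. b u * (of_real ((u \<bullet> t) ^ (j - i)) * of_real ((u \<bullet> y) ^ (k + (i - d))))) = 0"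
      unfolding mixed_moments_eq_0[OF mom[OF lt]] by simp
  qed
  finally show ?thesis .
qed

text \<open>If not, some nonzero weights \<open>a\<close> on \<open>T\<close> annihilate the kernel. The lowest nonzero homogeneous part of
  the exponential sum with weights \<open>cnj a\<close> and frequencies in \<open>T\<close> lies in the kernel, and pairing it
  with \<open>a\<close> gives the squared norm of a nonzero tensor.\<close>

lemma card_le_dim_power_kernel:
  fixes C :: "((real ^ 'n) \<times> nat) set"
  assumes T: "finite T" and C: "\<And>y m. (y, m) \<in> C \<Longrightarrow> card ((\<bullet>) y ` T) \<le> m"
    and dim: "cpoly_dim_le (power_kernel C) N"
  shows "card T \<le> N"
proof (rule ccontr)
  assume "\<not> card T \<le> N"
  obtain B where B: "finite B" "card B \<le> N" "power_kernel C \<subseteq> cpoly.span B"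
    using dim by (auto simp: cpoly_dim_le_def)
  have "card B < card T"
    using B(2) \<open>\<not> card T \<le> N\<close> by simp
  then obtain a where a: "\<exists>u\<in>T. a u \<noteq> 0" "\<And>p. p \<in> B \<Longrightarrow> (\<Sum>u\<in>T. a u * cpoly_eval p u) = 0"
    using homogeneous_system_nontrivial[OF B(1) T, of cpoly_eval] by blast
  have "cpoly.subspace {p. (\<Sum>u\<in>T. a u * cpoly_eval p u) = 0}"
    by (auto simp: cpoly.subspace_def cpoly_eval_add cpoly_eval_scale distrib_left sum.distrib
        mult.left_commute[of _ c for c] simp flip: sum_distrib_left)
  then have "cpoly.span B \<subseteq> {p. (\<Sum>u\<in>T. a u * cpoly_eval p u) = 0}"
    using a(2) by (intro cpoly.span_minimal) auto
  then have annih: "(\<Sum>u\<in>T. a u * cpoly_eval p u) = 0" if "p \<in> power_kernel C" for p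
    using that B(3) by auto
  define b where "b = (\<lambda>u. cnj (a u))"
  define P where "P = (\<lambda>j. \<exists>t. (\<Sum>u\<in>T. b u * of_real ((u \<bullet> t) ^ j)) \<noteq> 0)"
  have "\<exists>j. P j"
  proof (rule ccontr)
    assume "\<nexists>j. P j"
    then have "b u = 0" if "u \<in> T" for u
      using moments_determine_weights[OF T _ that, of b] by (auto simp: P_def)
    then show False
      using a(1) by (auto simp: b_def)
  qed
  \<comment> \<open>Minimality makes all lower moments vanish, as \<open>lowest_moment_eq_0\<close>
    requires.\<close>
  define j where "j = (LEAST j. P j)"
  have j: "P j"
    unfolding j_def using \<open>\<exists>j. P j\<close> by (rule LeastI_ex)
  have mom: "(\<Sum>u\<in>T. b u * of_real ((u \<bullet> t) ^ k)) = 0" if "k < j" for k t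
    using not_less_Least[of k P] that unfolding j_def[symmetric] by (auto simp: P_def simp del: of_real_power)
  \<comment> \<open>Up to the factor \<open>j!\<close>, the homogeneous part of degree
    \<open>j\<close> of the exponential sum.\<close>
  define e where "e = (\<Sum>u\<in>T. cpoly_scale (b u) (linear_form u ^ j))"
  have eval_e: "cpoly_eval e t = (\<Sum>u\<in>T. b u * of_real ((u \<bullet> t) ^ j))" for t
    by (simp add: e_def cpoly_eval_sum cpoly_eval_scale cpoly_eval_power cpoly_eval_linear_form)
  have "(dir_deriv y ^^ m) e = 0" if "(y, m) \<in> C" for y m
    unfolding dir_deriv_power_eq_0_iff
  proof (intro allI impI)
    fix t i assume i: "m \<le> i"
    have e: "line_poly e t y = (\<Sum>u\<in>T. smult (b u) ([:of_real (u \<bullet> t), of_real (u \<bullet> y):] ^ j))"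
      by (rule line_poly_unique) (simp add: eval_e poly_sum inner_add_right)
    show "coeff (line_poly e t y) i = 0"
    proof (cases "i \<le> j")
      case True
      have "coeff (line_poly e t y) i =
          of_nat (j choose i) * (\<Sum>u\<in>T. b u * (of_real ((u \<bullet> t) ^ (j - i)) * of_real ((u \<bullet> y) ^ i)))"
        using True by (simp add: e coeff_sum coeff_linear_poly_power sum_distrib_left mult_ac)
      also have "\<dots> = 0"
        using lowest_moment_eq_0[OF T mom _ True] C[OF that] i by simp
      finally show ?thesis .
    next
      case False
      have "coeff ([:of_real (u \<bullet> t), of_real (u \<bullet> y):] ^ j) i = (0::complex)" for u
      proof (rule coeff_eq_0)
        have "degree ([:of_real (u \<bullet> t), of_real (u \<bullet> y):] ^ j :: complex poly) \<le>
            degree ([:of_real (u \<bullet> t), of_real (u \<bullet> y):] :: complex poly) * j"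
          by (rule degree_power_le)
        also have "\<dots> \<le> 1 * j"
          by (intro mult_right_mono) simp_all
        finally show "degree ([:of_real (u \<bullet> t), of_real (u \<bullet> y):] ^ j :: complex poly) < i"
          using False by simp
      qed
      then show ?thesis
        by (simp add: e coeff_sum)
    qed
  qed
  then have "e \<in> power_kernel C"
    by (auto simp: power_kernel_def)
  then have "0 = (\<Sum>v\<in>T. a v * cpoly_eval e v)"
    using annih by simp
  also have "\<dots> = (\<Sum>v\<in>T. \<Sum>u\<in>T. b u * cnj (b v) * of_real ((u \<bullet> v) ^ j))"
    by (simp add: eval_e sum_distrib_left b_def mult_ac)
  also have "\<dots> = (\<Sum>u\<in>T. \<Sum>v\<in>T. b u * cnj (b v) * of_real ((u \<bullet> v) ^ j))"
    by (rule sum.swap)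
  finally have "(\<Sum>u\<in>T. b u * of_real ((u \<bullet> t) ^ j)) = 0" for t
    using gram_power_psd[where b = b and T = T and j = j] by auto
  then show False
    using j by (simp add: P_def)
qed


subsection \<open>Zonotopes and lattice points\<close>

text \<open>In the open case this stands in for the topological interior, which has no evident
  recursion over the vectors.\<close>

definition zono :: "real set \<Rightarrow> (real ^ 'n) multiset \<Rightarrow> (real ^ 'n) set" where
  "zono I X = {\<Sum>x\<in>set_mset X. \<Sum>k<count X x. t x k *\<^sub>R x | t.
     \<forall>x\<in>set_mset X. \<forall>k<count X x. t x k \<in> I}"

lemma zonotope_eq_zono: "zonotope X = zono {0..1} X"
  by (simp add: zonotope_def zono_def)

lemma zono_mono: "I \<subseteq> J \<Longrightarrow> zono I X \<subseteq> zono J X"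
  unfolding zono_def by blast

lemma zono_open_subset_zonotope: "zono {0<..<1} X \<subseteq> zonotope X"
  unfolding zonotope_eq_zono by (rule zono_mono) auto

lemma zono_empty: "zono I {#} = {0}"
  by (auto simp: zono_def)

text \<open>The added copy of \<open>x\<close> has index \<open>count X x\<close>, so the old copies
  keep their indices.\<close>

lemma zono_sum_add_mset:
  fixes t :: "real ^ 'n \<Rightarrow> nat \<Rightarrow> real"
  shows "(\<Sum>y\<in>set_mset (add_mset x X). \<Sum>k<count (add_mset x X) y. t y k *\<^sub>R y) =
    (\<Sum>y\<in>set_mset X. \<Sum>k<count X y. t y k *\<^sub>R y) + t x (count X x) *\<^sub>R x"
proof -
  let ?A = "insert x (set_mset X)"
  have "(\<Sum>y\<in>?A. \<Sum>k<count (add_mset x X) y. t y k *\<^sub>R y) =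
      (\<Sum>k<Suc (count X x). t x k *\<^sub>R x) + (\<Sum>y\<in>?A - {x}. \<Sum>k<count X y. t y k *\<^sub>R y)"
    by (subst sum.remove[of _ x]) (auto intro!: sum.cong)
  also have "\<dots> = t x (count X x) *\<^sub>R x +
      ((\<Sum>k<count X x. t x k *\<^sub>R x) + (\<Sum>y\<in>?A - {x}. \<Sum>k<count X y. t y k *\<^sub>R y))"
    by simp
  also have "(\<Sum>k<count X x. t x k *\<^sub>R x) + (\<Sum>y\<in>?A - {x}. \<Sum>k<count X y. t y k *\<^sub>R y) =
      (\<Sum>y\<in>?A. \<Sum>k<count X y. t y k *\<^sub>R y)"
    by (rule sum.remove[symmetric, of ?A x]) simp_all
  also have "\<dots> = (\<Sum>y\<in>set_mset X. \<Sum>k<count X y. t y k *\<^sub>R y)"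
    by (rule sum.mono_neutral_right) (auto simp: not_in_iff)
  finally show ?thesis
    by simp
qed

lemma zono_add_mset: "zono I (add_mset x X) = {p + r *\<^sub>R x | p r. p \<in> zono I X \<and> r \<in> I}"
proof (intro equalityI subsetI)
  fix q assume "q \<in> zono I (add_mset x X)"
  then obtain t where t: "\<forall>y\<in>set_mset (add_mset x X). \<forall>k<count (add_mset x X) y. t y k \<in> I"
    and q: "q = (\<Sum>y\<in>set_mset (add_mset x X). \<Sum>k<count (add_mset x X) y. t y k *\<^sub>R y)"
    unfolding zono_def by blast
  have "\<forall>y\<in>set_mset X. \<forall>k<count X y. t y k \<in> I" "t x (count X x) \<in> I"
    using t by auto
  then show "q \<in> {p + r *\<^sub>R x | p r. p \<in> zono I X \<and> r \<in> I}"
    unfolding q zono_sum_add_mset unfolding zono_def by blast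
next
  fix q assume "q \<in> {p + r *\<^sub>R x | p r. p \<in> zono I X \<and> r \<in> I}"
  then obtain t r where t: "\<forall>y\<in>set_mset X. \<forall>k<count X y. t y k \<in> I" and r: "r \<in> I"
    and q: "q = (\<Sum>y\<in>set_mset X. \<Sum>k<count X y. t y k *\<^sub>R y) + r *\<^sub>R x"
    unfolding zono_def by blast
  define t' where "t' = (\<lambda>y k. if y = x \<and> k = count X x then r else t y k)"
  have "(\<Sum>y\<in>set_mset X. \<Sum>k<count X y. t y k *\<^sub>R y) = (\<Sum>y\<in>set_mset X. \<Sum>k<count X y. t' y k *\<^sub>R y)"
    by (intro sum.cong refl) (auto simp: t'_def)
  then have "q = (\<Sum>y\<in>set_mset (add_mset x X). \<Sum>k<count (add_mset x X) y. t' y k *\<^sub>R y)"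
    unfolding q zono_sum_add_mset by (simp add: t'_def)
  moreover have "\<forall>y\<in>set_mset (add_mset x X). \<forall>k<count (add_mset x X) y. t' y k \<in> I"
  proof (intro ballI allI impI)
    fix y k assume yk: "y \<in> set_mset (add_mset x X)" "k < count (add_mset x X) y"
    show "t' y k \<in> I"
    proof (cases "y = x \<and> k = count X x")
      case False
      then have "k < count X y"
        using yk(2) by (auto split: if_splits)
      moreover from this have "y \<in># X"
        by (metis count_eq_zero_iff less_nat_zero_code)
      ultimately show ?thesis
        using t False by (auto simp: t'_def)
    qed (simp add: t'_def r)
  qed
  ultimately show "q \<in> zono I (add_mset x X)"
    unfolding zono_def by blast
qed

lemma zono_nonempty: "I \<noteq> {} \<Longrightarrow> zono I X \<noteq> {}"
  by (induction X) (auto simp: zono_empty zono_add_mset)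

lemma zono_subset_subspace: "subspace H \<Longrightarrow> set_mset X \<subseteq> H \<Longrightarrow> zono I X \<subseteq> H"
  by (induction X)
    (auto simp: zono_empty zono_add_mset subspace_0 intro!: subspace_add subspace_scale)

lemma zono_add_mset_eq_sums: "zono I (add_mset x X) = {p + q | p q. p \<in> zono I X \<and> q \<in> (\<lambda>r. r *\<^sub>R x) ` I}"
  unfolding zono_add_mset by blast

lemma convex_zono: "convex I \<Longrightarrow> convex (zono I X)"
proof (induction X)
  case (add x X)
  have "convex ((\<lambda>r. r *\<^sub>R x) ` I)"
    using add.prems by (intro convex_linear_image) (auto intro: linear_scale_left bounded_linear.linear bounded_linear_scaleR_left)
  then have "convex (\<Union>p\<in>zono I X. \<Union>q\<in>(\<lambda>r. r *\<^sub>R x) ` I. {p + q})"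
    using add by (intro convex_sums)
  also have "(\<Union>p\<in>zono I X. \<Union>q\<in>(\<lambda>r. r *\<^sub>R x) ` I. {p + q}) = zono I (add_mset x X)"
    unfolding zono_add_mset_eq_sums by blast
  finally show ?case .
qed (simp add: zono_empty)

lemma compact_zonotope: "compact (zonotope X)"
  unfolding zonotope_eq_zono
proof (induction X)
  case (add x X)
  have "compact ((\<lambda>r. r *\<^sub>R x) ` {0..1})"
    by (intro compact_continuous_image continuous_intros) simp
  then show ?case
    using add unfolding zono_add_mset_eq_sums by (intro compact_sums)
qed (simp add: zono_empty)

text \<open>The directions in which one can move from \<open>p\<close> a little both ways, modulo
  \<open>S\<close>, form a subspace that contains \<open>S\<close> and every vector of
  \<open>X\<close>.\<close>

lemma zono_open_absorbing:
  assumes S: "subspace S" and p: "p \<in> zono {0<..<1} X" and u: "u \<in> span (S \<union> set_mset X)"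
  shows "\<exists>\<epsilon>>0. \<forall>\<delta>. \<bar>\<delta>\<bar> \<le> \<epsilon> \<longrightarrow> (\<exists>s\<in>S. p + \<delta> *\<^sub>R u + s \<in> zono {0<..<1} X)"
proof -
  let ?Z = "zono {0<..<1} X"
  let ?P = "\<lambda>u. \<exists>\<epsilon>>0. \<forall>\<delta>. \<bar>\<delta>\<bar> \<le> \<epsilon> \<longrightarrow> (\<exists>s\<in>S. p + \<delta> *\<^sub>R u + s \<in> ?Z)"
  have "subspace {u. ?P u}"
    unfolding subspace_def mem_Collect_eq
  proof (intro conjI ballI allI impI)
    show "?P 0"
      using p subspace_0[OF S] by (intro exI[of _ 1]) (auto intro!: bexI[of _ 0])
  next
    fix u w assume "u \<in> {u. ?P u}" "w \<in> {u. ?P u}"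
    then have "?P u" "?P w"
      by auto
    then obtain e f where e: "e > 0" "\<And>\<delta>. \<bar>\<delta>\<bar> \<le> e \<Longrightarrow> \<exists>s\<in>S. p + \<delta> *\<^sub>R u + s \<in> ?Z"
      and f: "f > 0" "\<And>\<delta>. \<bar>\<delta>\<bar> \<le> f \<Longrightarrow> \<exists>s\<in>S. p + \<delta> *\<^sub>R w + s \<in> ?Z"
      by metis
    have "\<exists>s\<in>S. p + \<delta> *\<^sub>R (u + w) + s \<in> ?Z" if \<delta>: "\<bar>\<delta>\<bar> \<le> min e f / 2" for \<delta>
    proof -
      have "\<bar>2 * \<delta>\<bar> \<le> e" "\<bar>2 * \<delta>\<bar> \<le> f"
        using \<delta> by auto
      then obtain s s' where s: "s \<in> S" "p + (2 * \<delta>) *\<^sub>R u + s \<in> ?Z"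
        and s': "s' \<in> S" "p + (2 * \<delta>) *\<^sub>R w + s' \<in> ?Z"
        using e(2) f(2) by blast
      \<comment> \<open>By convexity: the midpoint of two moves of double length.\<close>
      have "(1/2) *\<^sub>R (p + (2 * \<delta>) *\<^sub>R u + s) + (1/2) *\<^sub>R (p + (2 * \<delta>) *\<^sub>R w + s') \<in> ?Z"
        using s s' by (intro convexD[OF convex_zono]) auto
      also have "(1/2) *\<^sub>R (p + (2 * \<delta>) *\<^sub>R u + s) + (1/2) *\<^sub>R (p + (2 * \<delta>) *\<^sub>R w + s') =
          ((1/2) *\<^sub>R p + (1/2) *\<^sub>R p) + \<delta> *\<^sub>R (u + w) + (1/2) *\<^sub>R (s + s')"
        by (simp add: algebra_simps)
      also have "(1/2) *\<^sub>R p + (1/2) *\<^sub>R p = p"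
        by (simp flip: scaleR_left_distrib)
      finally show ?thesis
        using S s s' by (intro bexI[of _ "(1/2) *\<^sub>R (s + s')"]) (auto intro: subspace_scale subspace_add)
    qed
    then show "?P (u + w)"
      using e f by (intro exI[of _ "min e f / 2"]) auto
  next
    fix c u assume "u \<in> {u. ?P u}"
    then obtain e where e: "e > 0" "\<And>\<delta>. \<bar>\<delta>\<bar> \<le> e \<Longrightarrow> \<exists>s\<in>S. p + \<delta> *\<^sub>R u + s \<in> ?Z"
      by auto
    have "\<exists>s\<in>S. p + \<delta> *\<^sub>R c *\<^sub>R u + s \<in> ?Z" if \<delta>: "\<bar>\<delta>\<bar> \<le> e / (\<bar>c\<bar> + 1)" for \<delta>
    proof -
      have "\<bar>\<delta> * c\<bar> \<le> \<bar>\<delta>\<bar> * (\<bar>c\<bar> + 1)"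
        unfolding abs_mult by (intro mult_left_mono) auto
      also have "\<dots> \<le> e"
        using \<delta> by (simp add: pos_le_divide_eq add_nonneg_pos)
      finally show ?thesis
        using e(2)[of "\<delta> * c"] by simp
    qed
    then show "?P (c *\<^sub>R u)"
      using e(1) by (intro exI[of _ "e / (\<bar>c\<bar> + 1)"]) (auto simp: add_nonneg_pos)
  qed
  moreover have "?P u" if "u \<in> S" for u
  proof -
    have "\<exists>s\<in>S. p + \<delta> *\<^sub>R u + s \<in> ?Z" for \<delta>
      using S p that by (intro bexI[of _ "- (\<delta> *\<^sub>R u)"]) (auto intro: subspace_neg subspace_scale)
    then show ?thesis
      by (intro exI[of _ 1]) auto
  qed
  moreover have "?P u" if uX: "u \<in># X" for u
  proof -
    obtain Y where Y: "X = add_mset u Y"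
      using multi_member_split[OF uX] by blast
    then obtain q r where q: "p = q + r *\<^sub>R u" "q \<in> zono {0<..<1} Y" "0 < r" "r < 1"
      using p by (auto simp: zono_add_mset)
    \<comment> \<open>One coefficient \<open>r\<close> of \<open>u\<close> lies strictly between 0
      and 1, so it can be changed a little both ways.\<close>
    have "\<exists>s\<in>S. p + \<delta> *\<^sub>R u + s \<in> ?Z" if "\<bar>\<delta>\<bar> \<le> min r (1 - r) / 2" for \<delta>
    proof (rule bexI[of _ 0])
      have "p + \<delta> *\<^sub>R u + 0 = q + (r + \<delta>) *\<^sub>R u" "r + \<delta> \<in> {0<..<1}"
        using that q by (auto simp: algebra_simps min_def abs_if split: if_splits)
      then show "p + \<delta> *\<^sub>R u + 0 \<in> ?Z"
        using q(2) unfolding Y zono_add_mset by blast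
    qed (rule subspace_0[OF S])
    then show ?thesis
      using q by (intro exI[of _ "min r (1 - r) / 2"]) auto
  qed
  ultimately have "span (S \<union> set_mset X) \<subseteq> {u. ?P u}"
    by (intro span_minimal) auto
  then show ?thesis
    using u by blast
qed

text \<open>A convex set that allows a small step from its point \<open>p\<close> in every direction
  has full affine hull and contains \<open>p\<close> in its relative interior.\<close>

lemma zono_open_subset_interior:
  fixes X :: "(real ^ 'n) multiset"
  assumes "span (set_mset X) = UNIV"
  shows "zono {0<..<1} X \<subseteq> interior (zonotope X)"
proof
  fix p assume p: "p \<in> zono {0<..<1} X"
  let ?Z = "zonotope X"
  have abs: "\<exists>\<epsilon>>0. p + \<epsilon> *\<^sub>R u \<in> ?Z" for u
  proof -
    have "u \<in> span ({0} \<union> set_mset X)"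
      using assms by (simp add: span_insert_0)
    from zono_open_absorbing[OF subspace_single_0 p this] obtain e where
      e: "e > 0" "\<forall>\<delta>. \<bar>\<delta>\<bar> \<le> e \<longrightarrow> (\<exists>s\<in>{0}. p + \<delta> *\<^sub>R u + s \<in> zono {0<..<1} X)"
      by blast
    then have "p + e *\<^sub>R u \<in> zono {0<..<1} X"
      by auto
    then have "p + e *\<^sub>R u \<in> ?Z"
      using zono_open_subset_zonotope by blast
    then show ?thesis
      using e(1) by blast
  qed
  have pZ: "p \<in> ?Z"
    using p zono_open_subset_zonotope by blast
  have "affine hull ?Z = UNIV"
  proof -
    have "w \<in> affine hull ?Z" for w
    proof -
      obtain e where e: "e > 0" "p + e *\<^sub>R (w - p) \<in> ?Z"
        using abs by blast
      then have "(1 - 1/e) *\<^sub>R p + (1/e) *\<^sub>R (p + e *\<^sub>R (w - p)) \<in> affine hull ?Z"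
        using pZ by (intro mem_affine[OF affine_affine_hull]) (auto simp: hull_inc)
      also have "(1 - 1/e) *\<^sub>R p + (1/e) *\<^sub>R (p + e *\<^sub>R (w - p)) = w"
        using e(1) by (simp add: algebra_simps)
      finally show ?thesis .
    qed
    then show ?thesis
      by auto
  qed
  moreover have "p \<in> rel_interior ?Z"
  proof (subst convex_rel_interior_iff)
    show "convex ?Z"
      unfolding zonotope_eq_zono by (rule convex_zono) simp
    show "?Z \<noteq> {}"
      using pZ by auto
    show "\<forall>x\<in>?Z. \<exists>e>1. (1 - e) *\<^sub>R x + e *\<^sub>R p \<in> ?Z"
    proof
      fix x
      obtain e where "e > 0" "p + e *\<^sub>R (p - x) \<in> ?Z"
        using abs by blast
      then show "\<exists>e>1. (1 - e) *\<^sub>R x + e *\<^sub>R p \<in> ?Z"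
        by (intro exI[of _ "1 + e"]) (auto simp: algebra_simps)
    qed
  qed
  ultimately show "p \<in> interior ?Z"
    by (simp add: rel_interior_interior)
qed

section \<open>Lattice points in the fibres of a projection\<close>

lemma int_lattice_add: "a \<in> int_lattice \<Longrightarrow> b \<in> int_lattice \<Longrightarrow> a + b \<in> int_lattice"
  by (simp add: int_lattice_def)

lemma int_lattice_scale: "a \<in> int_lattice \<Longrightarrow> of_int j *\<^sub>R a \<in> int_lattice"
  by (simp add: int_lattice_def)

lemma int_lattice_0: "0 \<in> int_lattice"
  by (simp add: int_lattice_def)

lemma mem_span_subspace: "subspace S \<Longrightarrow> z \<in> span S \<longleftrightarrow> z \<in> S"
  by (metis span_eq_iff)

lemma span_insert_subspace:
  assumes "subspace S" "z \<in> span (insert x S)"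
  obtains s r where "s \<in> S" "z = s + r *\<^sub>R x"
proof -
  obtain r where "z - r *\<^sub>R x \<in> span S"
    using assms(2) by (auto simp: span_insert)
  then show ?thesis
    using that[of "z - r *\<^sub>R x" r] mem_span_subspace[OF assms(1)] by simp
qed

text \<open>Every fibre over \<open>A\<^sub>2\<close> of the projection along \<open>x\<close> contains one more point than it has in
  \<open>A\<^sub>1\<close>: the translate by \<open>x\<close> of the topmost such point.\<close>

lemma merge_lattice_points:
  fixes x :: "real ^ 'n"
  assumes S: "subspace S" and x: "x \<notin> S" "x \<in> int_lattice"
    and A1: "finite A1" "A1 \<subseteq> int_lattice" "\<And>a b. a \<in> A1 \<Longrightarrow> b \<in> A1 \<Longrightarrow> a - b \<in> S \<Longrightarrow> a = b"
    and A2: "finite A2" "A2 \<subseteq> int_lattice"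
      "\<And>a b. a \<in> A2 \<Longrightarrow> b \<in> A2 \<Longrightarrow> a - b \<in> span (insert x S) \<Longrightarrow> a = b"
    and Q1: "\<And>a. a \<in> A1 \<Longrightarrow> Q a \<and> Q (a + x)"
    and Q2: "\<And>c. c \<in> A2 \<Longrightarrow> \<exists>j. Q (c + of_int j *\<^sub>R x)"
  shows "\<exists>A. finite A \<and> A \<subseteq> int_lattice \<and> (\<forall>a\<in>A. \<forall>b\<in>A. a - b \<in> S \<longrightarrow> a = b) \<and>
    (\<forall>a\<in>A. Q a) \<and> card A = card A1 + card A2"
proof -
  let ?S = "span (insert x S)"
  have S': "S \<subseteq> ?S" "x \<in> ?S"
    using span_superset[of "insert x S"] by auto
  \<comment> \<open>The part \<open>y\<close> of \<open>x\<close> orthogonal to \<open>S\<close>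
    measures height in a fibre: it ignores \<open>S\<close> and increases along
    \<open>x\<close>.\<close>
  obtain s0 y where y: "s0 \<in> span S" "\<And>w. w \<in> span S \<Longrightarrow> orthogonal y w" "x = s0 + y"
    using orthogonal_subspace_decomp_exists[of S x] by metis
  have yS: "y \<bullet> w = 0" if "w \<in> S" for w
    using y(2)[of w] that by (simp add: orthogonal_def span_base)
  have s0: "s0 \<in> S"
    using y(1) mem_span_subspace[OF S] by simp
  have "y \<noteq> 0"
    using y(3) x(1) s0 by auto
  then have yx: "y \<bullet> x > 0"
    using y(3) yS[OF s0] by (simp add: inner_add_right)
  have "\<exists>w. w \<in> int_lattice \<and> Q w \<and> w - c \<in> ?S \<and> (\<forall>b\<in>A1. b - w \<notin> S)" if c: "c \<in> A2" for c
  proof (cases "\<exists>a\<in>A1. a - c \<in> ?S")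
    case True
    let ?F = "{a \<in> A1. a - c \<in> ?S}"
    have "finite ?F" "?F \<noteq> {}"
      using A1(1) True by auto
    then have "\<exists>a\<in>?F. \<forall>b\<in>?F. y \<bullet> b \<le> y \<bullet> a"
      using Max_in[of "(\<bullet>) y ` ?F"] Max_ge[of "(\<bullet>) y ` ?F"] by fastforce
    then obtain a where a: "a \<in> A1" "a - c \<in> ?S"
      and max: "\<And>b. b \<in> A1 \<Longrightarrow> b - c \<in> ?S \<Longrightarrow> y \<bullet> b \<le> y \<bullet> a"
      by auto
    have ax: "a + x - c \<in> ?S"
      using span_add[OF a(2) S'(2)] by (simp add: algebra_simps)
    have "b - (a + x) \<notin> S" if "b \<in> A1" for b
    proof
      assume *: "b - (a + x) \<in> S"
      then have "(b - (a + x)) + (a + x - c) \<in> ?S"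
        using S'(1) ax by (intro span_add) auto
      then have "y \<bullet> b \<le> y \<bullet> a"
        using max[OF that] by simp
      moreover have "y \<bullet> b = y \<bullet> a + y \<bullet> x"
        using yS[OF *] by (simp add: inner_diff_right inner_add_right)
      ultimately show False
        using yx by simp
    qed
    then show ?thesis
      using a(1) ax A1(2) Q1 x(2) by (intro exI[of _ "a + x"]) (auto intro: int_lattice_add)
  next
    case False
    \<comment> \<open>No point of \<open>A1\<close> lies over \<open>c\<close>, so any lattice point
      of the fibre with property \<open>Q\<close> is new.\<close>
    obtain j where j: "Q (c + of_int j *\<^sub>R x)"
      using Q2[OF c] by blast
    have "b - (c + of_int j *\<^sub>R x) \<notin> S" if "b \<in> A1" for b
    proof
      assume "b - (c + of_int j *\<^sub>R x) \<in> S"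
      then have "(b - (c + of_int j *\<^sub>R x)) + of_int j *\<^sub>R x \<in> ?S"
        using S' by (intro span_add span_scale) auto
      then show False
        using False that by simp
    qed
    then show ?thesis
      using j c A2(2) x(2) S'(2)
      by (intro exI[of _ "c + of_int j *\<^sub>R x"]) (auto intro: int_lattice_add int_lattice_scale span_scale)
  qed
  then obtain h where h: "\<And>c. c \<in> A2 \<Longrightarrow> h c \<in> int_lattice" "\<And>c. c \<in> A2 \<Longrightarrow> Q (h c)"
    "\<And>c. c \<in> A2 \<Longrightarrow> h c - c \<in> ?S" "\<And>c b. c \<in> A2 \<Longrightarrow> b \<in> A1 \<Longrightarrow> b - h c \<notin> S"
    by metis
  have hh: "c = d" if "c \<in> A2" "d \<in> A2" "h c - h d \<in> S" for c d
  proof (rule A2(3)[OF that(1,2)])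
    have "h c - h d \<in> ?S"
      using that(3) S'(1) by blast
    from span_add[OF span_diff[OF this h(3)[OF that(1)]] h(3)[OF that(2)]]
    show "c - d \<in> ?S"
      by (simp add: algebra_simps)
  qed
  have inj: "inj_on h A2"
    using hh subspace_0[OF S] by (auto intro!: inj_onI)
  have disj: "A1 \<inter> h ` A2 = {}"
    using h(4) subspace_0[OF S] by force
  have "\<forall>a\<in>A1 \<union> h ` A2. \<forall>b\<in>A1 \<union> h ` A2. a - b \<in> S \<longrightarrow> a = b"
  proof (intro ballI impI)
    fix a b assume ab: "a \<in> A1 \<union> h ` A2" "b \<in> A1 \<union> h ` A2" "a - b \<in> S"
    have "b - a \<in> S"
      using subspace_neg[OF S ab(3)] by simp
    then show "a = b"
      using ab A1(3) h(4) hh by blast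
  qed
  moreover have "card (A1 \<union> h ` A2) = card A1 + card A2"
    using A1(1) A2(1) disj by (simp add: card_Un_disjoint card_image[OF inj])
  moreover have "A1 \<union> h ` A2 \<subseteq> int_lattice" "\<forall>a\<in>A1 \<union> h ` A2. Q a"
    using A1(2) h(1,2) Q1 by blast+
  ultimately show ?thesis
    using A1(1) A2(1) by (intro exI[of _ "A1 \<union> h ` A2"]) simp
qed

subsection \<open>Deletion and contraction\<close>

text \<open>\<open>S\<close> is the contracted subspace: facets of the contraction are the facets that contain \<open>S\<close>, and
  polynomials on the quotient are the polynomials that are invariant under translations by \<open>S\<close>.\<close>

definition rel_facets :: "(real ^ 'n) multiset \<Rightarrow> (real ^ 'n) set \<Rightarrow> (real ^ 'n) set set" where
  "rel_facets X S = {H. subspace H \<and> dim H = CARD('n) - 1 \<and> S \<subseteq> H \<and> span (S \<union> (set_mset X \<inter> H)) = H}"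

lemma rel_facets_0: "rel_facets X {0} = facet_hyperplanes X"
  unfolding rel_facets_def facet_hyperplanes_def insert_is_Un[symmetric] span_insert_0
  using subspace_0 by blast

lemma rel_facets_delete: "rel_facets Y S \<subseteq> rel_facets (add_mset x Y) S"
proof
  fix H assume H: "H \<in> rel_facets Y S"
  then have "span (S \<union> (set_mset Y \<inter> H)) \<subseteq> span (S \<union> (set_mset (add_mset x Y) \<inter> H))"
    by (intro span_mono) auto
  moreover have "span (S \<union> (set_mset (add_mset x Y) \<inter> H)) \<subseteq> H"
    using H unfolding rel_facets_def by (intro span_minimal) blast+
  ultimately have "span (S \<union> (set_mset (add_mset x Y) \<inter> H)) = H"
    using H unfolding rel_facets_def by blast
  then show "H \<in> rel_facets (add_mset x Y) S"
    using H unfolding rel_facets_def by blast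
qed

lemma rel_facets_contract:
  assumes "x \<in># X"
  shows "rel_facets X (span (insert x S)) \<subseteq> rel_facets X S"
proof
  fix H assume H: "H \<in> rel_facets X (span (insert x S))"
  then have sub: "span (insert x S) \<subseteq> H"
    by (simp add: rel_facets_def)
  then have xH: "x \<in> H" "S \<subseteq> H"
    using span_superset[of "insert x S"] by auto
  have "span (insert x S) \<subseteq> span (S \<union> (set_mset X \<inter> H))"
    using assms xH by (intro span_mono) auto
  then have "span (span (insert x S) \<union> (set_mset X \<inter> H)) \<subseteq> span (S \<union> (set_mset X \<inter> H))"
    using span_superset[of "S \<union> (set_mset X \<inter> H)"] by (intro span_minimal) auto
  moreover have "span (S \<union> (set_mset X \<inter> H)) \<subseteq> H"
    using H xH unfolding rel_facets_def by (intro span_minimal) blast+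
  ultimately have "span (S \<union> (set_mset X \<inter> H)) = H"
    using H unfolding rel_facets_def by blast
  then show "H \<in> rel_facets X S"
    using H xH unfolding rel_facets_def by blast
qed

lemma hyperplane_normal_inner_neq_0:
  fixes x :: "real ^ 'n"
  assumes H: "subspace H" "dim H = CARD('n) - 1" and y: "y \<noteq> 0" "\<And>h. h \<in> H \<Longrightarrow> y \<bullet> h = 0"
    and x: "x \<notin> H"
  shows "y \<bullet> x \<noteq> 0"
proof
  assume yx: "y \<bullet> x = 0"
  have "dim (insert x H) = CARD('n)"
    using H x by (simp add: dim_insert mem_span_subspace)
  then have "span (insert x H) = UNIV"
    by (simp add: flip: dim_eq_full)
  moreover have "span (insert x H) \<subseteq> {z. y \<bullet> z = 0}"
    using y yx by (intro span_minimal) (auto simp: subspace_hyperplane)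
  ultimately have "y \<bullet> y = 0"
    by blast
  then show False
    using y(1) by simp
qed

text \<open>The pairs \<open>(s, 1)\<close> impose invariance under \<open>S\<close>. A contraction
  leaves \<open>X\<close> as it is: contracted vectors lie in every facet above \<open>S\<close> and
  do not count in \<open>facet_mult X H\<close>.\<close>

definition rel_constraints ::
    "(nat \<Rightarrow> nat) \<Rightarrow> ((real ^ 'n) set \<Rightarrow> real ^ 'n) \<Rightarrow> (real ^ 'n) multiset \<Rightarrow> (real ^ 'n) set \<Rightarrow>
      ((real ^ 'n) \<times> nat) set" where
  "rel_constraints e \<eta> X S =
     (\<lambda>s. (s, 1)) ` S \<union> (\<lambda>H. (\<eta> H, e (facet_mult X H))) ` rel_facets X S"

lemma facet_mult_add_mset:
  "facet_mult (add_mset x Y) H = (if x \<in> H then facet_mult Y H else Suc (facet_mult Y H))"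
  by (simp add: facet_mult_def)


lemma dir_deriv_span:
  assumes "\<And>y. y \<in> A \<Longrightarrow> dir_deriv y p = 0" and "z \<in> span A"
  shows "dir_deriv z p = 0"
proof -
  have "dir_deriv 0 p = 0"
    using dir_deriv_scaleR_left[of 0 0 p] by simp
  then have "subspace {y. dir_deriv y p = 0}"
    by (auto simp: subspace_def dir_deriv_add_left dir_deriv_scaleR_left)
  then have "span A \<subseteq> {y. dir_deriv y p = 0}"
    using assms(1) by (intro span_minimal) auto
  then show ?thesis
    using assms(2) by blast
qed

text \<open>In the external, central and internal case, \<open>e\<close> maps \<open>m(H)\<close> to the exponent in the ideal, \<open>I\<close> is
  the range of the coefficients in the zonotope, and \<open>v\<close> is the translation.\<close>

definition zonotopal_case :: "(nat \<Rightarrow> nat) \<Rightarrow> real set \<Rightarrow> real ^ 'n \<Rightarrow> bool" where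
  "zonotopal_case e I v \<longleftrightarrow> (e = (\<lambda>m. m + 1) \<and> I = {0..1} \<and> v = 0) \<or>
     (e = (\<lambda>m. m) \<and> I = {0..1}) \<or> (e = (\<lambda>m. m - 1) \<and> I = {0<..<1} \<and> v = 0)"

text \<open>What the induction retains of unimodularity: a multiple of the normal is an integral
  functional with values 0, 1, -1 on \<open>X\<close>. The factor is existential because the given
  normals have arbitrary length.\<close>

definition normalized_facets ::
    "((real ^ 'n) set \<Rightarrow> real ^ 'n) \<Rightarrow> (real ^ 'n) multiset \<Rightarrow> (real ^ 'n) set \<Rightarrow> bool" where
  "normalized_facets \<eta> X S \<longleftrightarrow> (\<forall>H\<in>rel_facets X S. \<eta> H \<noteq> 0 \<and> (\<forall>h\<in>H. \<eta> H \<bullet> h = 0) \<and>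
     (\<exists>\<rho>. \<rho> \<noteq> 0 \<and> (\<forall>z\<in>int_lattice. \<rho> * (\<eta> H \<bullet> z) \<in> \<int>) \<and>
       (\<forall>x\<in>#X. x \<notin> H \<longrightarrow> \<bar>\<rho> * (\<eta> H \<bullet> x)\<bar> = 1)))"

lemma normalized_facets_mono:
  assumes \<eta>: "normalized_facets \<eta> X S" and YX: "rel_facets Y T \<subseteq> rel_facets X S" "set_mset Y \<subseteq> set_mset X"
  shows "normalized_facets \<eta> Y T"
  unfolding normalized_facets_def
proof (intro ballI conjI)
  fix H assume "H \<in> rel_facets Y T"
  then have H: "H \<in> rel_facets X S"
    using YX(1) by blast
  show "\<eta> H \<noteq> 0" "\<And>h. h \<in> H \<Longrightarrow> \<eta> H \<bullet> h = 0"
    using \<eta> H unfolding normalized_facets_def by blast+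
  obtain \<rho> where "\<rho> \<noteq> 0" "\<forall>z\<in>int_lattice. \<rho> * (\<eta> H \<bullet> z) \<in> \<int>"
      "\<forall>x\<in>#X. x \<notin> H \<longrightarrow> \<bar>\<rho> * (\<eta> H \<bullet> x)\<bar> = 1"
    using \<eta> H unfolding normalized_facets_def by blast
  then show "\<exists>\<rho>. \<rho> \<noteq> 0 \<and> (\<forall>z\<in>int_lattice. \<rho> * (\<eta> H \<bullet> z) \<in> \<int>) \<and>
      (\<forall>x\<in>#Y. x \<notin> H \<longrightarrow> \<bar>\<rho> * (\<eta> H \<bullet> x)\<bar> = 1)"
    using YX(2) by (intro exI[of _ \<rho>]) auto
qed

text \<open>Representatives of distinct lattice points of the translated zonotope in the quotient by
  \<open>S\<close>. For \<open>S = {0}\<close> they are lattice points of the zonotope shifted by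
  \<open>-v\<close>.\<close>

definition lattice_transversal ::
    "real set \<Rightarrow> real ^ 'n \<Rightarrow> (real ^ 'n) multiset \<Rightarrow> (real ^ 'n) set \<Rightarrow> (real ^ 'n) set \<Rightarrow> bool" where
  "lattice_transversal I v X S A \<longleftrightarrow> finite A \<and> A \<subseteq> int_lattice \<and>
     (\<forall>a\<in>A. \<forall>b\<in>A. a - b \<in> S \<longrightarrow> a = b) \<and> (\<forall>a\<in>A. \<exists>s\<in>S. a + s + v \<in> zono I X)"

text \<open>Rounding up adds less than one copy of \<open>x\<close>, which the new summand
  supplies.\<close>

lemma ceiling_shift_in_zono:
  assumes p: "c + r *\<^sub>R x + s + v \<in> zono {0..1} Y"
  shows "c + of_int \<lceil>r\<rceil> *\<^sub>R x + s + v \<in> zono {0..1} (add_mset x Y)"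
proof -
  have "c + of_int \<lceil>r\<rceil> *\<^sub>R x + s + v = (c + r *\<^sub>R x + s + v) + (of_int \<lceil>r\<rceil> - r) *\<^sub>R x"
    by (simp add: algebra_simps)
  moreover have "of_int \<lceil>r\<rceil> - r \<in> {0..1}"
    using ceiling_correct[of r] by (simp only: atLeastAtMost_iff) linarith
  ultimately show ?thesis
    using p unfolding zono_add_mset by blast
qed

text \<open>The summand of \<open>x\<close> makes the fibre long enough for its position
  \<open>q\<close> to be rounded to an integer without leaving the zonotope modulo
  \<open>S\<close>.\<close>

lemma ex_int_shift_in_zono:
  assumes I: "I = {0..1} \<or> I = {0<..<1} \<and> span (S \<union> set_mset Y) = UNIV"
    and S: "subspace S" and t: "t \<in> span (insert x S)" "c + t + v \<in> zono I (add_mset x Y)"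
  shows "\<exists>j. \<exists>s\<in>S. (c + of_int j *\<^sub>R x) + s + v \<in> zono I (add_mset x Y)"
proof -
  obtain s r where s: "s \<in> S" "t = s + r *\<^sub>R x"
    using span_insert_subspace[OF S t(1)] by blast
  obtain p r' where p: "p \<in> zono I Y" "r' \<in> I" "c + t + v = p + r' *\<^sub>R x"
    using t(2) unfolding zono_add_mset by blast
  define q where "q = r - r'"
  have pq: "p = c + q *\<^sub>R x + s + v"
    using p(3) s(2) by (simp add: q_def algebra_simps)
  show ?thesis
    using I
  proof
    assume "I = {0..1}"
    then show ?thesis
      using ceiling_shift_in_zono[of c q x s v Y] p(1) s(1) unfolding pq by blast
  next
    assume I': "I = {0<..<1} \<and> span (S \<union> set_mset Y) = UNIV"
    show ?thesis
    proof (cases "of_int \<lceil>q\<rceil> = q")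
      case False
      have "c + of_int \<lceil>q\<rceil> *\<^sub>R x + s + v = p + (of_int \<lceil>q\<rceil> - q) *\<^sub>R x"
        by (simp add: pq algebra_simps)
      moreover have "of_int \<lceil>q\<rceil> - q \<in> I"
        using False ceiling_correct[of q] I' by (simp only: greaterThanLessThan_iff) linarith
      ultimately have "c + of_int \<lceil>q\<rceil> *\<^sub>R x + s + v \<in> zono I (add_mset x Y)"
        using p(1) unfolding zono_add_mset by blast
      then show ?thesis
        using s(1) by blast
    next
      case True
      \<comment> \<open>Rounding would now need the coefficient 0, which the open interval excludes.
        Instead \<open>p\<close> moves back by \<open>d\<close> copies of \<open>x\<close> within
        the zonotope of \<open>Y\<close>, and the new coefficient \<open>d\<close> makes up for
        it.\<close>
      obtain \<epsilon> where \<epsilon>: "\<epsilon> > 0" "\<forall>\<delta>. \<bar>\<delta>\<bar> \<le> \<epsilon> \<longrightarrow> (\<exists>s\<in>S. p + \<delta> *\<^sub>R x + s \<in> zono I Y)"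
        using zono_open_absorbing[OF S, of p Y x] p(1) I' by auto
      define d where "d = min \<epsilon> (1/2)"
      have d: "d \<in> I" "\<bar>- d\<bar> \<le> \<epsilon>"
        using \<epsilon>(1) I' by (auto simp: d_def)
      then obtain s' where s': "s' \<in> S" "p + (- d) *\<^sub>R x + s' \<in> zono I Y"
        using \<epsilon>(2) by blast
      have "c + of_int \<lceil>q\<rceil> *\<^sub>R x + (s + s') + v = (p + (- d) *\<^sub>R x + s') + d *\<^sub>R x"
        by (simp add: pq True algebra_simps)
      then have "c + of_int \<lceil>q\<rceil> *\<^sub>R x + (s + s') + v \<in> zono I (add_mset x Y)"
        using s'(2) d(1) unfolding zono_add_mset by blast
      then show ?thesis
        using subspace_add[OF S s(1) s'(1)] by blast
    qed
  qed
qed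

text \<open>The coefficients 0 and 1 of the new copy of \<open>x\<close> give the two points. For
  the open interval they become \<open>d\<close> and \<open>1 - d\<close>, and a small move in the
  zonotope of \<open>Y\<close>, possible because \<open>S\<close> and \<open>Y\<close> span,
  compensates.\<close>

lemma zono_add_mset_both_ends:
  assumes I: "I = {0..1} \<or> I = {0<..<1} \<and> span (S \<union> set_mset Y) = UNIV"
    and S: "subspace S" and a: "s \<in> S" "a + s + v \<in> zono I Y"
  shows "(\<exists>s\<in>S. a + s + v \<in> zono I (add_mset x Y)) \<and> (\<exists>s\<in>S. (a + x) + s + v \<in> zono I (add_mset x Y))"
  using I
proof
  assume I': "I = {0..1}"
  have "a + s + v = (a + s + v) + 0 *\<^sub>R x" "(a + x) + s + v = (a + s + v) + 1 *\<^sub>R x"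
    by simp_all
  moreover have "0 \<in> I" "1 \<in> I"
    using I' by simp_all
  ultimately have "a + s + v \<in> zono I (add_mset x Y)" "(a + x) + s + v \<in> zono I (add_mset x Y)"
    using a(2) unfolding zono_add_mset by blast+
  then show ?thesis
    using a(1) by blast
next
  assume I': "I = {0<..<1} \<and> span (S \<union> set_mset Y) = UNIV"
  let ?p = "a + s + v"
  obtain \<epsilon> where \<epsilon>: "\<epsilon> > 0" "\<forall>\<delta>. \<bar>\<delta>\<bar> \<le> \<epsilon> \<longrightarrow> (\<exists>s\<in>S. ?p + \<delta> *\<^sub>R x + s \<in> zono I Y)"
    using zono_open_absorbing[OF S, of ?p Y x] a(2) I' by auto
  define d where "d = min \<epsilon> (1/2)"
  have d: "d \<in> I" "1 - d \<in> I" "\<bar>- d\<bar> \<le> \<epsilon>" "\<bar>d\<bar> \<le> \<epsilon>"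
    using \<epsilon>(1) I' by (auto simp: d_def min_def split: if_splits)
  obtain s1 where s1: "s1 \<in> S" "?p + (- d) *\<^sub>R x + s1 \<in> zono I Y"
    using \<epsilon>(2) d(3) by blast
  obtain s2 where s2: "s2 \<in> S" "?p + d *\<^sub>R x + s2 \<in> zono I Y"
    using \<epsilon>(2) d(4) by blast
  have "a + (s + s1) + v = (?p + (- d) *\<^sub>R x + s1) + d *\<^sub>R x"
    "(a + x) + (s + s2) + v = (?p + d *\<^sub>R x + s2) + (1 - d) *\<^sub>R x"
    by (simp_all add: algebra_simps)
  then have "a + (s + s1) + v \<in> zono I (add_mset x Y)" "(a + x) + (s + s2) + v \<in> zono I (add_mset x Y)"
    using s1(2) s2(2) d(1,2) unfolding zono_add_mset by blast+
  then show ?thesis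
    using subspace_add[OF S a(1)] s1(1) s2(1) by blast
qed

text \<open>Modulo \<open>S\<close> the vectors \<open>x\<close> and \<open>x'\<close> agree, but
  \<open>x'\<close> is orthogonal to \<open>S\<close>, so the pairs \<open>(s, 1)\<close> pass the
  filter \<open>y \<bullet> x' = 0\<close>. So do the facets of the contraction, as they contain
  both \<open>x\<close> and \<open>S\<close>.\<close>

lemma power_kernel_contract:
  assumes x: "x \<in># X" and x': "s0 \<in> S" "x = s0 + x'" "\<And>s. s \<in> S \<Longrightarrow> s \<bullet> x' = 0"
    and \<eta>: "normalized_facets \<eta> X S"
  shows "power_kernel (insert (x', 1) {(y, m). (y, m) \<in> rel_constraints e \<eta> X S \<and> y \<bullet> x' = 0}) \<subseteq>
    power_kernel (rel_constraints e \<eta> X (span (insert x S)))" (is "power_kernel ?C \<subseteq> _")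
proof
  fix p assume p: "p \<in> power_kernel ?C"
  have pD: "(dir_deriv y ^^ m) p = 0" if "(y, m) \<in> ?C" for y m
    using p that unfolding power_kernel_def by blast
  have pS: "dir_deriv s p = 0" if "s \<in> S" for s
  proof -
    have "(s, 1) \<in> ?C"
      using that x'(3)[OF that] unfolding rel_constraints_def by blast
    from pD[OF this] show ?thesis
      by simp
  qed
  have "dir_deriv x' p = 0"
    using pD[of x' 1] by simp
  then have "dir_deriv x p = 0"
    using pS[OF x'(1)] x'(2) by (simp add: dir_deriv_add_left)
  then have span: "dir_deriv s p = 0" if "s \<in> span (insert x S)" for s
    using pS by (intro dir_deriv_span[OF _ that]) blast
  have facet: "(dir_deriv (\<eta> H) ^^ e (facet_mult X H)) p = 0" if H: "H \<in> rel_facets X (span (insert x S))" for H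
  proof (rule pD)
    have HS: "H \<in> rel_facets X S"
      using H rel_facets_contract[OF x] by blast
    have "span (insert x S) \<subseteq> H" "subspace H"
      using H unfolding rel_facets_def by blast+
    then have "x \<in> H" "s0 \<in> H" "subspace H"
      using span_superset[of "insert x S"] x'(1) by blast+
    then have "x' \<in> H"
      using x'(2) subspace_diff[of H x s0] by simp
    then have "\<eta> H \<bullet> x' = 0"
      using \<eta> HS unfolding normalized_facets_def by blast
    then show "(\<eta> H, e (facet_mult X H)) \<in> ?C"
      using HS unfolding rel_constraints_def by blast
  qed
  show "p \<in> power_kernel (rel_constraints e \<eta> X (span (insert x S)))"
    using span facet unfolding power_kernel_def rel_constraints_def by auto
qed

text \<open>Deletion of \<open>x\<close> lowers m(H) by one for the facets without \<open>x\<close>.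
  Their normals are the ones not orthogonal to \<open>x'\<close>, for which division by the linear
  form lowers the exponent.\<close>

lemma power_kernel_delete:
  fixes X :: "(real ^ 'n) multiset"
  assumes X: "X = add_mset x Y" and x': "s0 \<in> S" "x = s0 + x'" "\<And>s. s \<in> S \<Longrightarrow> s \<bullet> x' = 0"
    and \<eta>: "normalized_facets \<eta> X S" and e: "\<And>m. e (Suc m) - 1 \<le> e m"
  shows "power_kernel {(y, m). (y, m) \<in> rel_constraints e \<eta> X S \<and> y \<bullet> x' = 0 \<or>
      y \<bullet> x' \<noteq> 0 \<and> (\<exists>k. (y, k) \<in> rel_constraints e \<eta> X S \<and> m = k - 1)} \<subseteq>
    power_kernel (rel_constraints e \<eta> Y S)" (is "power_kernel ?C \<subseteq> _")
proof (rule power_kernel_mono)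
  fix y m assume "(y, m) \<in> rel_constraints e \<eta> Y S"
  then consider "y \<in> S" "m = 1" | H where "H \<in> rel_facets Y S" "y = \<eta> H" "m = e (facet_mult Y H)"
    unfolding rel_constraints_def by blast
  then show "\<exists>k\<le>m. (y, k) \<in> ?C"
  proof cases
    case 1
    then have "(y, m) \<in> ?C"
      using x'(3) unfolding rel_constraints_def by blast
    then show ?thesis
      by blast
  next
    case (2 H)
    have H: "H \<in> rel_facets X S"
      using 2(1) rel_facets_delete unfolding X by blast
    then have H': "subspace H" "dim H = CARD('n) - 1" "S \<subseteq> H"
      unfolding rel_facets_def by blast+
    have \<eta>H: "\<eta> H \<noteq> 0" "\<And>h. h \<in> H \<Longrightarrow> \<eta> H \<bullet> h = 0"
      using \<eta> H unfolding normalized_facets_def by blast+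
    have C: "(\<eta> H, e (facet_mult X H)) \<in> rel_constraints e \<eta> X S"
      using H unfolding rel_constraints_def by blast
    have inner: "\<eta> H \<bullet> x = \<eta> H \<bullet> x'"
      using \<eta>H(2)[of s0] x'(1) H'(3) unfolding x'(2) inner_add_right by auto
    show ?thesis
    proof (cases "x \<in> H")
      case True
      then have "(\<eta> H, e (facet_mult X H)) \<in> ?C"
        using C \<eta>H(2) inner by simp
      then show ?thesis
        using True 2 X by (auto simp: facet_mult_add_mset)
    next
      case False
      then have "\<eta> H \<bullet> x' \<noteq> 0"
        using hyperplane_normal_inner_neq_0[OF H'(1,2) \<eta>H False] inner by simp
      then have "(\<eta> H, e (facet_mult X H) - 1) \<in> ?C"
        using C by blast
      moreover have "e (facet_mult X H) - 1 \<le> m"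
        using False 2 X e by (simp add: facet_mult_add_mset)
      ultimately show ?thesis
        using 2 by blast
    qed
  qed
qed

text \<open>Induction on the number of vectors outside \<open>S\<close>: contraction moves
  \<open>x\<close> into \<open>S\<close>, deletion drops it. If \<open>S\<close> and the remaining
  vectors do not span, deletion would violate the induction hypotheses, and the small exponent of
  one facet takes its place.\<close>

lemma lattice_transversal_dim:
  fixes X :: "(real ^ 'n) multiset"
  assumes "zonotopal_case e I v"
    and "subspace S" "span (S \<union> set_mset X) = UNIV" "set_mset X \<subseteq> int_lattice" "normalized_facets \<eta> X S"
  shows "\<exists>A. lattice_transversal I v X S A \<and> cpoly_dim_le (power_kernel (rel_constraints e \<eta> X S)) (card A)"
  using assms(2-)
proof (induction "size {#x \<in># X. x \<notin> S#}" arbitrary: X S rule: less_induct)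
  case less
  note S = less.prems(1) and span = less.prems(2) and lat = less.prems(3) and \<eta> = less.prems(4)
  show ?case
  proof (cases "set_mset X \<subseteq> S")
    case True
    then have "S = UNIV"
      using span S by (metis Un_absorb2 span_eq_iff)
    obtain q where "q \<in> zono I X"
      using zono_nonempty[of I X] assms(1) by (auto simp: zonotopal_case_def)
    then have "0 + (q - v) + v \<in> zono I X"
      by simp
    \<comment> \<open>Modulo \<open>S = UNIV\<close> there is only one lattice point, and
      \<open>q - v\<close> is its correction in \<open>S\<close>.\<close>
    then have "lattice_transversal I v X S {0}"
      unfolding lattice_transversal_def \<open>S = UNIV\<close> using int_lattice_0 by blast
    moreover have "cpoly_dim_le (power_kernel (rel_constraints e \<eta> X S)) 1"
      by (rule power_kernel_constants) (simp add: rel_constraints_def \<open>S = UNIV\<close>)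
    ultimately show ?thesis
      by (intro exI[of _ "{0}"]) simp
  next
    case False
    then obtain x where x: "x \<in># X" "x \<notin> S"
      by blast
    then obtain Y where X: "X = add_mset x Y"
      using multi_member_split by metis
    have xlat: "x \<in> int_lattice"
      using lat x(1) by blast
    obtain s0 x' where "s0 \<in> span S" "\<And>w. w \<in> span S \<Longrightarrow> orthogonal x' w" "x = s0 + x'"
      using orthogonal_subspace_decomp_exists[of S x] by metis
    then have x': "s0 \<in> S" "x = s0 + x'" "\<And>s. s \<in> S \<Longrightarrow> s \<bullet> x' = 0"
      using mem_span_subspace[OF S] by (simp_all add: orthogonal_def inner_commute)
    have x'0: "x' \<noteq> 0"
      using x' x(2) by auto
    define S' where "S' = span (insert x S)"
    have SS': "S \<subseteq> S'" "x \<in> S'"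
      unfolding S'_def using span_superset[of "insert x S"] by auto
    let ?C = "rel_constraints e \<eta>"
    let ?D = "{(y, m). (y, m) \<in> ?C X S \<and> y \<bullet> x' = 0 \<or>
      y \<bullet> x' \<noteq> 0 \<and> (\<exists>k. (y, k) \<in> ?C X S \<and> m = k - 1)}"
    let ?Q = "\<lambda>a. \<exists>s\<in>S. a + s + v \<in> zono I X"
    have "size {#y \<in># X. y \<notin> S'#} \<le> size {#y \<in># Y. y \<notin> S#}"
      using SS' unfolding X by (auto intro!: size_mset_mono mset_subset_eqI)
    then have "size {#y \<in># X. y \<notin> S'#} < size {#y \<in># X. y \<notin> S#}"
      using x(2) unfolding X by simp
    moreover have "span (S' \<union> set_mset X) = UNIV"
      using span SS'(1) span_mono[of "S \<union> set_mset X" "S' \<union> set_mset X"] by blast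
    moreover have "normalized_facets \<eta> X S'"
      using \<eta> rel_facets_contract[OF x(1), of S] unfolding S'_def by (rule normalized_facets_mono) simp
    ultimately obtain A2 where A2: "lattice_transversal I v X S' A2" "cpoly_dim_le (power_kernel (?C X S')) (card A2)"
      using less.hyps[of S' X] lat by (auto simp: S'_def)
    have contract: "cpoly_dim_le (power_kernel (insert (x', 1) {(y, m). (y, m) \<in> ?C X S \<and> y \<bullet> x' = 0})) (card A2)"
      using cpoly_dim_le_mono[OF A2(2) power_kernel_contract[OF x(1) x' \<eta>, where e = e, folded S'_def] order_refl] .
    have A2': "finite A2" "A2 \<subseteq> int_lattice" "\<And>a b. a \<in> A2 \<Longrightarrow> b \<in> A2 \<Longrightarrow> a - b \<in> span (insert x S) \<Longrightarrow> a = b"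
      "\<And>a. a \<in> A2 \<Longrightarrow> \<exists>t\<in>span (insert x S). a + t + v \<in> zono I (add_mset x Y)"
      using A2(1) unfolding lattice_transversal_def S'_def X by blast+
    \<comment> \<open>The common end of the cases: \<open>A1\<close> plays the part of the lattice
      points of the deletion and bounds the cofactors of the linear form of
      \<open>x'\<close>.\<close>
    have conclude: ?thesis
      if A1: "finite A1" "A1 \<subseteq> int_lattice" "\<And>a b. a \<in> A1 \<Longrightarrow> b \<in> A1 \<Longrightarrow> a - b \<in> S \<Longrightarrow> a = b"
        and Q1: "\<And>a. a \<in> A1 \<Longrightarrow> \<exists>s\<in>S. a + s + v \<in> zono I Y"
        and I: "I = {0..1} \<or> I = {0<..<1} \<and> span (S \<union> set_mset Y) = UNIV"
        and dim: "cpoly_dim_le (power_kernel ?D) (card A1)" for A1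
    proof -
      have "?Q a \<and> ?Q (a + x)" if "a \<in> A1" for a
        using zono_add_mset_both_ends[OF I S, where x = x] Q1[OF that]
        unfolding X by blast
      moreover have "\<exists>j. ?Q (c + of_int j *\<^sub>R x)" if "c \<in> A2" for c
        using ex_int_shift_in_zono[OF I S] A2'(4)[OF that] unfolding X by blast
      ultimately obtain A where "finite A \<and> A \<subseteq> int_lattice \<and> (\<forall>a\<in>A. \<forall>b\<in>A. a - b \<in> S \<longrightarrow> a = b) \<and>
          (\<forall>a\<in>A. ?Q a) \<and> card A = card A1 + card A2"
        using merge_lattice_points[OF S x(2) xlat A1 A2'(1,2,3), where Q = ?Q] by blast
      then have A: "lattice_transversal I v X S A" "card A = card A2 + card A1"
        unfolding lattice_transversal_def by simp_all
      show ?thesis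
        using A cpoly_dim_le_power_kernel_split[OF x'0 contract dim] by metis
    qed
    show ?thesis
    proof (cases "span (S \<union> set_mset Y) = UNIV")
      case True
      have "size {#y \<in># Y. y \<notin> S#} < size {#y \<in># X. y \<notin> S#}"
        using x(2) unfolding X by simp
      moreover have "set_mset Y \<subseteq> int_lattice"
        using lat unfolding X by simp
      moreover have "normalized_facets \<eta> Y S"
        using \<eta> rel_facets_delete[of Y S x] unfolding X by (rule normalized_facets_mono) auto
      ultimately obtain A1 where A1: "lattice_transversal I v Y S A1"
          "cpoly_dim_le (power_kernel (?C Y S)) (card A1)"
        using less.hyps[of S Y] S True by auto
      have "e (Suc m) - 1 \<le> e m" for m
        using assms(1) by (auto simp: zonotopal_case_def)
      then have "cpoly_dim_le (power_kernel ?D) (card A1)"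
        using cpoly_dim_le_mono[OF A1(2) power_kernel_delete[OF X x' \<eta>] order_refl] by blast
      moreover have "I = {0..1} \<or> I = {0<..<1} \<and> span (S \<union> set_mset Y) = UNIV"
        using assms(1) True by (auto simp: zonotopal_case_def)
      moreover have "finite A1" "A1 \<subseteq> int_lattice" "\<And>a b. a \<in> A1 \<Longrightarrow> b \<in> A1 \<Longrightarrow> a - b \<in> S \<Longrightarrow> a = b"
        "\<And>a. a \<in> A1 \<Longrightarrow> \<exists>s\<in>S. a + s + v \<in> zono I Y"
        using A1(1) unfolding lattice_transversal_def by blast+
      ultimately show ?thesis
        by (intro conclude[of A1])
    next
      case False
      \<comment> \<open>The copy of \<open>x\<close> is the only vector outside this span, which is
        therefore a facet with multiplicity 1.\<close>
      define H where "H = span (S \<union> set_mset Y)"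
      have H: "subspace H" "S \<subseteq> H" "set_mset Y \<subseteq> H"
        unfolding H_def using span_superset[of "S \<union> set_mset Y"] by auto
      have "span (insert x H) = UNIV"
        using span span_mono[of "S \<union> set_mset X" "insert x H"] H unfolding X by auto
      have xH: "x \<notin> H"
      proof
        assume "x \<in> H"
        then have "span (insert x H) = H"
          using H(1) by (simp add: insert_absorb span_eq_iff[THEN iffD2])
        then show False
          using False \<open>span (insert x H) = UNIV\<close> by (simp add: H_def)
      qed
      have "dim (insert x H) = CARD('n)"
        using dim_span[of "insert x H"] unfolding \<open>span (insert x H) = UNIV\<close> by simp
      then have dimH: "dim H = CARD('n) - 1"
        using xH H(1) by (simp add: dim_insert mem_span_subspace)
      have "set_mset X \<inter> H = set_mset Y"
        using xH H(3) unfolding X by auto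
      then have HX: "H \<in> rel_facets X S"
        using H dimH unfolding rel_facets_def by (simp add: H_def)
      have "{#y \<in># Y. y \<notin> H#} = {#}"
        using filter_mset_cong[of Y Y "\<lambda>y. y \<notin> H" "\<lambda>_. False"] H(3) by auto
      then have mult: "facet_mult X H = 1"
        using xH by (simp add: X facet_mult_add_mset facet_mult_def)
      have \<eta>H: "\<eta> H \<noteq> 0" "\<And>h. h \<in> H \<Longrightarrow> \<eta> H \<bullet> h = 0"
        using \<eta> HX unfolding normalized_facets_def by blast+
      have "\<eta> H \<bullet> x = \<eta> H \<bullet> x'"
        using \<eta>H(2)[of s0] x'(1) H(2) unfolding x'(2) inner_add_right by auto
      then have \<eta>x': "\<eta> H \<bullet> x' \<noteq> 0"
        using hyperplane_normal_inner_neq_0[OF H(1) dimH \<eta>H xH] by simp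
      have "(\<eta> H, e (facet_mult X H)) \<in> ?C X S"
        using HX unfolding rel_constraints_def by blast
      then have C: "(\<eta> H, e 1) \<in> ?C X S"
        unfolding mult .
      then have D: "(\<eta> H, e 1 - 1) \<in> ?D"
        using \<eta>x' by blast
      consider (external) "e = (\<lambda>m. m + 1)" "I = {0..1}" "v = 0" | (central) "e = (\<lambda>m. m)" "I = {0..1}"
        | (internal) "e = (\<lambda>m. m - 1)"
        using assms(1) unfolding zonotopal_case_def by blast
      then show ?thesis
      proof cases
        case internal
        \<comment> \<open>The exponent is 0 and the kernel zero; correspondingly, a zonotope of
          width 1 has no lattice points inside.\<close>
        then have "cpoly_dim_le (power_kernel (?C X S)) (card {})"
          using power_kernel_trivial[of "\<eta> H" "?C X S"] C by simp
        moreover have "lattice_transversal I v X S {}"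
          by (simp add: lattice_transversal_def)
        ultimately show ?thesis
          by blast
      next
        case central
        \<comment> \<open>The exponent 1 becomes 0 after division by the linear form, so only the
          contraction contributes.\<close>
        then have "cpoly_dim_le (power_kernel ?D) (card {})"
          using power_kernel_trivial[of "\<eta> H" ?D] D by simp
        then show ?thesis
          using central by (intro conclude[of "{}"]) simp_all
      next
        case external
        \<comment> \<open>The exponent 2 has become 1 in \<open>?D\<close>. A second splitting makes
          it 0, so \<open>?D\<close> obeys the bound of the contraction: the zonotope is a prism
          with two layers of lattice points.\<close>
        let ?E = "{(y, m). (y, m) \<in> ?D \<and> y \<bullet> x' = 0 \<or> y \<bullet> x' \<noteq> 0 \<and> (\<exists>k. (y, k) \<in> ?D \<and> m = k - 1)}"
        have "\<exists>k. (\<eta> H, k) \<in> ?D \<and> 0 = k - 1"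
          using D external(1) by (intro exI[of _ 1]) simp
        then have "(\<eta> H, 0) \<in> ?E"
          using \<eta>x' by blast
        then have "cpoly_dim_le (power_kernel ?E) 0"
          by (rule power_kernel_trivial)
        moreover have "cpoly_dim_le (power_kernel (insert (x', 1) {(y, m). (y, m) \<in> ?D \<and> y \<bullet> x' = 0})) (card A2)"
          by (rule cpoly_dim_le_mono[OF contract _ order_refl], rule power_kernel_mono) auto
        ultimately have dimD: "cpoly_dim_le (power_kernel ?D) (card A2)"
          using cpoly_dim_le_power_kernel_split[OF x'0, of ?D "card A2" 0] by simp
        obtain \<rho> where "\<forall>z\<in>int_lattice. \<rho> * (\<eta> H \<bullet> z) \<in> \<int>" "\<forall>x\<in>#X. x \<notin> H \<longrightarrow> \<bar>\<rho> * (\<eta> H \<bullet> x)\<bar> = 1"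
          using \<eta> HX unfolding normalized_facets_def by blast
        then have \<rho>: "\<And>z. z \<in> int_lattice \<Longrightarrow> \<rho> * (\<eta> H \<bullet> z) \<in> \<int>" "\<bar>\<rho> * (\<eta> H \<bullet> x)\<bar> = 1"
          using x(1) xH by blast+
        \<comment> \<open>The zonotope of \<open>Y\<close> lies in \<open>H\<close>, where the
          normal vanishes. The scaled normal is integral at \<open>c\<close> and 1 or -1 at
          \<open>x\<close>, so the fibre meets \<open>H\<close> at an integral position
          \<open>q\<close>.\<close>
        have "\<exists>j. \<exists>s\<in>S. (c + of_int j *\<^sub>R x) + s + v \<in> zono I Y" if c: "c \<in> A2" for c
        proof -
          obtain t where t: "t \<in> span (insert x S)" "c + t + v \<in> zono I (add_mset x Y)"
            using A2'(4)[OF c] by blast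
          obtain s r where s: "s \<in> S" "t = s + r *\<^sub>R x"
            using span_insert_subspace[OF S t(1)] by blast
          obtain p r' where p: "p \<in> zono I Y" "c + t + v = p + r' *\<^sub>R x"
            using t(2) unfolding zono_add_mset by blast
          define q where "q = r - r'"
          have pq: "p = c + q *\<^sub>R x + s + v"
            using p(2) s(2) by (simp add: q_def algebra_simps)
          have "p \<in> H"
            using zono_subset_subspace[OF H(1,3)] p(1) by blast
          then have "\<eta> H \<bullet> p = 0" "\<eta> H \<bullet> s = 0"
            using \<eta>H(2) s(1) H(2) by blast+
          then have "\<eta> H \<bullet> c + q * (\<eta> H \<bullet> x) = 0"
            unfolding pq external(3) by (simp add: inner_add_right)
          then have "\<rho> * (\<eta> H \<bullet> c + q * (\<eta> H \<bullet> x)) = 0"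
            by simp
          then have "\<rho> * (\<eta> H \<bullet> c) + q * (\<rho> * (\<eta> H \<bullet> x)) = 0"
            by (simp add: algebra_simps)
          moreover have "\<rho> * (\<eta> H \<bullet> x) = 1 \<or> \<rho> * (\<eta> H \<bullet> x) = -1"
            using \<rho>(2) by linarith
          moreover have "\<rho> * (\<eta> H \<bullet> c) \<in> \<int>"
            using \<rho>(1) c A2'(2) by blast
          ultimately have "q \<in> \<int>"
            by (auto simp: add_eq_0_iff)
          then obtain j where "q = of_int j"
            by (elim Ints_cases)
          then show ?thesis
            using p(1) s(1) unfolding pq by blast
        qed
        then obtain j where j: "\<And>c. c \<in> A2 \<Longrightarrow> \<exists>s\<in>S. (c + of_int (j c) *\<^sub>R x) + s + v \<in> zono I Y"
          by metis
        define h where "h c = c + of_int (j c) *\<^sub>R x" for c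
        have hh: "c = d" if "c \<in> A2" "d \<in> A2" "h c - h d \<in> S" for c d
        proof (rule A2'(3)[OF that(1,2)])
          have "h c - h d \<in> S'"
            using that(3) SS'(1) by blast
          moreover have "(of_int (j c) - of_int (j d)) *\<^sub>R x \<in> S'"
            using SS'(2) unfolding S'_def by (rule span_scale)
          ultimately have "(h c - h d) - (of_int (j c) - of_int (j d)) *\<^sub>R x \<in> S'"
            unfolding S'_def by (rule span_diff)
          then show "c - d \<in> span (insert x S)"
            by (simp add: h_def S'_def algebra_simps)
        qed
        have "inj_on h A2"
          using hh subspace_0[OF S] by (auto intro!: inj_onI)
        then have "cpoly_dim_le (power_kernel ?D) (card (h ` A2))"
          using dimD by (simp add: card_image)
        moreover have "h ` A2 \<subseteq> int_lattice"
          using A2'(2) xlat by (auto simp: h_def intro!: int_lattice_add int_lattice_scale)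
        moreover have "finite (h ` A2)" "\<And>a b. a \<in> h ` A2 \<Longrightarrow> b \<in> h ` A2 \<Longrightarrow> a - b \<in> S \<Longrightarrow> a = b"
          using A2'(1) hh by blast+
        moreover have "\<exists>s\<in>S. a + s + v \<in> zono I Y" if "a \<in> h ` A2" for a
          using j that unfolding h_def by blast
        moreover have "I = {0..1} \<or> I = {0<..<1} \<and> span (S \<union> set_mset Y) = UNIV"
          using external(2) by blast
        ultimately show ?thesis
          by (intro conclude[of "h ` A2"])
      qed
    qed
  qed
qed


subsection \<open>Unimodularity\<close>

lemma det_int_lattice:
  fixes A :: "real ^ 'n ^ 'n"
  assumes "\<And>i. A $ i \<in> int_lattice"
  shows "det A \<in> \<int>"
  unfolding det_def using assms by (auto simp: int_lattice_def intro!: Ints_sum Ints_mult Ints_prod)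

text \<open>Complete a basis of \<open>H\<close> from \<open>X\<close> by a variable vector
  \<open>y\<close>. The determinant \<open>\<phi> y\<close> vanishes on \<open>H\<close>, is
  integral on the lattice, and is 1 or -1 for \<open>y\<close> in \<open>X\<close> outside
  \<open>H\<close>. Functionals vanishing on a hyperplane are proportional, and
  \<open>\<rho>\<close> is the factor.\<close>

lemma unimodular_normalized_facets:
  fixes X :: "(real ^ 'n) multiset"
  assumes span: "span (set_mset X) = UNIV" and uni: "unimodular X" and \<eta>: "facet_normals X \<eta>"
  shows "normalized_facets \<eta> X {0}"
  unfolding normalized_facets_def rel_facets_0
proof (intro ballI conjI)
  fix H assume H: "H \<in> facet_hyperplanes X"
  then have H': "subspace H" "dim H = CARD('n) - 1" "span (set_mset X \<inter> H) = H"
    by (auto simp: facet_hyperplanes_def)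
  show n: "\<eta> H \<noteq> 0" "\<And>h. h \<in> H \<Longrightarrow> \<eta> H \<bullet> h = 0"
    using \<eta> H by (auto simp: facet_normals_def)
  have lat: "set_mset X \<subseteq> int_lattice"
    using uni by (simp add: unimodular_def)
  have "\<not> set_mset X \<subseteq> H"
  proof
    assume "set_mset X \<subseteq> H"
    then have "H = UNIV"
      using span H'(1) span_minimal by blast
    then have "CARD('n) = CARD('n) - 1"
      using H'(2) by simp
    then show False
      using zero_less_card_finite[where 'a = 'n] by linarith
  qed
  then obtain x0 where x0: "x0 \<in># X" "x0 \<notin> H"
    by blast
  obtain B where B: "B \<subseteq> set_mset X \<inter> H" "independent B" "set_mset X \<inter> H \<subseteq> span B"
    using maximal_independent_subset by blast
  have "H \<subseteq> span B"
    using B(3) span_minimal[of "set_mset X \<inter> H" "span B"] H'(3) by simp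
  moreover have "span B \<subseteq> H"
    using B(1) H'(1) by (intro span_minimal) auto
  ultimately have spanB: "span B = H"
    by blast
  have finB: "finite B"
    using B(2) by (rule independent_imp_finite)
  have cardB: "card B = CARD('n) - 1"
    using dim_span_eq_card_independent[OF B(2)] H'(2) by (simp add: spanB)
  have basis: "independent (insert y B)" "span (insert y B) = UNIV" "card (insert y B) = CARD('n)"
    if "y \<notin> H" for y
  proof -
    have "y \<notin> B"
      using that B(1) by blast
    then show card: "card (insert y B) = CARD('n)"
      using finB cardB zero_less_card_finite[where 'a = 'n] by simp
    show ind: "independent (insert y B)"
      using B(2) that by (simp add: independent_insert spanB)
    have "dim (insert y B) = CARD('n)"
      using dim_eq_card_independent[OF ind] card by simp
    then show "span (insert y B) = UNIV"
      by (simp add: flip: dim_eq_full)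
  qed
  obtain b :: "'n \<Rightarrow> real ^ 'n" where b: "bij_betw b UNIV (insert x0 B)"
    using finite_same_card_bij[of "UNIV :: 'n set" "insert x0 B"] basis(3)[OF x0(2)] finB by auto
  then obtain i0 where i0: "b i0 = x0"
    unfolding bij_betw_def by (metis imageE insertI1)
  define \<phi> where "\<phi> y = det (\<chi> i. if i = i0 then y else b i)" for y
  have lin: "linear \<phi>"
    using det_row_add[of i0 "\<lambda>_. y" "\<lambda>_. z" b for y z] det_row_mul[of i0 c "\<lambda>_. y" b for c y]
    by (intro linearI) (simp_all add: \<phi>_def flip: scalar_mult_eq_scaleR)
  have b_B: "b i \<in> B" if "i \<noteq> i0" for i
  proof -
    have "b i \<noteq> x0"
      using that b i0 by (metis bij_betw_def inj_eq)
    then show ?thesis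
      using b by (auto simp: bij_betw_def)
  qed
  have \<phi>_basis: "\<phi> y \<in> {1, -1}" if y: "y \<in># X" "y \<notin> H" for y
  proof -
    have "bij_betw (\<lambda>i. if i = i0 then y else b i) UNIV (insert y B)"
      unfolding bij_betw_def
    proof
      have "b i \<noteq> y" if "i \<noteq> i0" for i
        using b_B[OF that] B(1) y(2) by blast
      then show "inj (\<lambda>i. if i = i0 then y else b i)"
        using bij_betw_imp_inj_on[OF b] by (intro injI) (auto dest: injD split: if_splits)
      have "b ` (UNIV - {i0}) = B"
      proof
        show "B \<subseteq> b ` (UNIV - {i0})"
        proof
          fix u assume "u \<in> B"
          then have "u \<in> range b" "u \<noteq> x0"
            using b B(1) x0(2) by (auto simp: bij_betw_def)
          then show "u \<in> b ` (UNIV - {i0})"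
            using i0 by blast
        qed
      qed (use b_B in blast)
      then show "range (\<lambda>i. if i = i0 then y else b i) = insert y B"
        by auto
    qed
    moreover have "insert y B \<subseteq> set_mset X"
      using y B(1) by auto
    ultimately show ?thesis
      using uni basis[OF y(2)] unfolding unimodular_def \<phi>_def by blast
  qed
  have \<phi>_int: "\<phi> y \<in> \<int>" if "y \<in> int_lattice" for y
    unfolding \<phi>_def using that b_B B(1) lat by (intro det_int_lattice) auto
  have \<phi>_B: "\<phi> y = 0" if y: "y \<in> B" for y
  proof -
    have "y \<in> range b"
      using b y by (simp add: bij_betw_def)
    then obtain j where j: "b j = y"
      by blast
    have "j \<noteq> i0"
      using j i0 y B(1) x0(2) by auto
    then show ?thesis
      unfolding \<phi>_def using j by (intro det_identical_rows[of i0 j]) (auto simp: row_def vec_eq_iff)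
  qed
  define \<rho> where "\<rho> = \<phi> x0 / (\<eta> H \<bullet> x0)"
  have \<eta>x0: "\<eta> H \<bullet> x0 \<noteq> 0"
    by (rule hyperplane_normal_inner_neq_0[OF H'(1,2) n x0(2)])
  have "\<phi> x0 \<noteq> 0"
    using \<phi>_basis[OF x0] by auto
  have eq: "\<rho> * (\<eta> H \<bullet> y) = \<phi> y" for y
  proof (rule linear_eq_on_span[of "\<lambda>y. \<rho> * (\<eta> H \<bullet> y)" \<phi> "insert x0 B"])
    show "linear (\<lambda>y. \<rho> * (\<eta> H \<bullet> y))"
      by (intro linearI) (simp_all add: inner_add_right algebra_simps)
    show "\<rho> * (\<eta> H \<bullet> y) = \<phi> y" if "y \<in> insert x0 B" for y
      using that \<phi>_B n(2) B(1) \<eta>x0 by (auto simp: \<rho>_def)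
    show "y \<in> span (insert x0 B)"
      using basis(2)[OF x0(2)] by simp
  qed (rule lin)
  show "\<exists>\<rho>. \<rho> \<noteq> 0 \<and> (\<forall>z\<in>int_lattice. \<rho> * (\<eta> H \<bullet> z) \<in> \<int>) \<and>
      (\<forall>x\<in>#X. x \<notin> H \<longrightarrow> \<bar>\<rho> * (\<eta> H \<bullet> x)\<bar> = 1)"
  proof (intro exI[of _ \<rho>] conjI ballI impI)
    show "\<rho> \<noteq> 0"
      using \<open>\<phi> x0 \<noteq> 0\<close> \<eta>x0 by (simp add: \<rho>_def)
    show "\<rho> * (\<eta> H \<bullet> z) \<in> \<int>" if "z \<in> int_lattice" for z
      unfolding eq by (rule \<phi>_int[OF that])
    show "\<bar>\<rho> * (\<eta> H \<bullet> x)\<bar> = 1" if "x \<in># X" "x \<notin> H" for x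
      unfolding eq using \<phi>_basis[OF that] by auto
  qed
qed

section \<open>Width of the zonotope across a facet\<close>

lemma zonotope_inner_bounds:
  assumes "p \<in> zonotope X"
  shows "(\<Sum>x\<in>#X. min 0 (w \<bullet> x)) \<le> w \<bullet> p" "w \<bullet> p \<le> (\<Sum>x\<in>#X. max 0 (w \<bullet> x))"
proof -
  have "(\<Sum>x\<in>#X. min 0 (w \<bullet> x)) \<le> w \<bullet> p \<and> w \<bullet> p \<le> (\<Sum>x\<in>#X. max 0 (w \<bullet> x))"
    using assms unfolding zonotope_eq_zono
  proof (induction X arbitrary: p)
    case (add x X)
    then obtain q r where q: "q \<in> zono {0..1} X" "0 \<le> r" "r \<le> 1" "p = q + r *\<^sub>R x"
      unfolding zono_add_mset by auto
    have "min 0 (w \<bullet> x) \<le> r * (w \<bullet> x)" "r * (w \<bullet> x) \<le> max 0 (w \<bullet> x)"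
      using q(2,3) mult_right_mono[of r 1 "w \<bullet> x"] mult_right_mono_neg[of r 1 "w \<bullet> x"]
      by (auto simp: min_def max_def mult_nonneg_nonneg mult_nonneg_nonpos)
    then show ?case
      using add.IH[OF q(1)] q(4) by (simp add: inner_add_right)
  qed (simp add: zono_empty)
  then show "(\<Sum>x\<in>#X. min 0 (w \<bullet> x)) \<le> w \<bullet> p" "w \<bullet> p \<le> (\<Sum>x\<in>#X. max 0 (w \<bullet> x))"
    by blast+
qed

text \<open>Each vector outside \<open>H\<close> adds exactly 1 to the difference of the two sums,
  and vectors in \<open>H\<close> add nothing. So m(H) is the width of the zonotope in direction
  \<open>w\<close>.\<close>

lemma facet_width:
  fixes w :: "real ^ 'n"
  assumes "\<And>h. h \<in> H \<Longrightarrow> w \<bullet> h = 0" and "\<forall>x\<in>#X. x \<notin> H \<longrightarrow> \<bar>w \<bullet> x\<bar> = 1"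
  shows "\<exists>l::int. (\<Sum>x\<in>#X. min 0 (w \<bullet> x)) = of_int l \<and>
    (\<Sum>x\<in>#X. max 0 (w \<bullet> x)) = of_int (l + int (facet_mult X H))"
  using assms(2)
proof (induction X)
  case empty
  show ?case
    by (simp add: facet_mult_def)
next
  case (add x X)
  then obtain l :: int where l: "(\<Sum>x\<in>#X. min 0 (w \<bullet> x)) = of_int l"
      "(\<Sum>x\<in>#X. max 0 (w \<bullet> x)) = of_int (l + int (facet_mult X H))"
    by auto
  consider "x \<in> H" | "x \<notin> H" "w \<bullet> x = 1" | "x \<notin> H" "w \<bullet> x = -1"
    using add.prems by fastforce
  then show ?case
  proof cases
    case 1
    then show ?thesis
      using l assms(1) by (intro exI[of _ l]) (simp add: facet_mult_add_mset)
  next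
    case 2
    then show ?thesis
      using l by (intro exI[of _ l]) (simp add: facet_mult_add_mset)
  next
    case 3
    then show ?thesis
      using l by (intro exI[of _ "l - 1"]) (simp add: facet_mult_add_mset)
  qed
qed

lemma card_facet_values_le:
  assumes "\<rho> \<noteq> 0" "finite K" "\<And>z. z \<in> T \<Longrightarrow> \<exists>k\<in>K. \<rho> * (y \<bullet> z) = of_int k"
  shows "card ((\<bullet>) y ` T) \<le> card (K :: int set)"
proof (rule surj_card_le[OF assms(2), of _ "\<lambda>k. of_int k / \<rho>"], clarify)
  fix z assume "z \<in> T"
  then obtain k where "k \<in> K" "\<rho> * (y \<bullet> z) = of_int k"
    using assms(3) by blast
  then show "y \<bullet> z \<in> (\<lambda>k. of_int k / \<rho>) ` K"
    using assms(1) by (intro image_eqI[of _ _ k]) (auto simp: field_simps)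
qed

subsection \<open>Volume\<close>

lemma finite_bounded_int_lattice:
  fixes Z :: "(real ^ 'n) set"
  assumes "bounded Z"
  shows "finite (Z \<inter> int_lattice)"
proof -
  obtain r where r: "\<And>z. z \<in> Z \<Longrightarrow> norm z \<le> r"
    using assms by (auto simp: bounded_iff)
  let ?K = "{f. \<forall>i. f i \<in> {- \<lceil>r\<rceil>..\<lceil>r\<rceil>}} :: ('n \<Rightarrow> int) set"
  have "Z \<inter> int_lattice \<subseteq> (\<lambda>f. \<chi> i. of_int (f i)) ` ?K"
  proof
    fix z assume z: "z \<in> Z \<inter> int_lattice"
    then have "\<forall>i. \<exists>k::int. z $ i = of_int k"
      by (auto simp: int_lattice_def elim!: Ints_cases)
    then obtain f where f: "\<And>i. z $ i = of_int (f i)"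
      by metis
    have "\<bar>z $ i\<bar> \<le> r" for i
      using component_le_norm_cart[of z i] r[of z] z by (auto intro: order_trans)
    then have "\<bar>f i\<bar> \<le> \<lceil>r\<rceil>" for i
      using f[of i] le_of_int_ceiling[of r] by (metis of_int_abs of_int_le_iff order_trans)
    then have "f \<in> ?K"
      by (auto simp: abs_le_iff minus_le_iff)
    moreover have "z = (\<chi> i. of_int (f i))"
      by (simp add: vec_eq_iff f)
    ultimately show "z \<in> (\<lambda>f. \<chi> i. of_int (f i)) ` ?K"
      by blast
  qed
  moreover have "finite ?K"
    using finite_PiE[of "UNIV :: 'n set" "\<lambda>_. {- \<lceil>r\<rceil>..\<lceil>r\<rceil>}"] by (simp add: PiE_def Pi_def)
  ultimately show ?thesis
    using finite_surj by blast
qed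

lemma negligible_int_translates_hyperplane:
  fixes w :: "real ^ 'n"
  assumes "w \<noteq> 0"
  shows "negligible {v. w \<bullet> v \<in> \<int>}"
proof -
  have "{v. w \<bullet> v \<in> \<int>} = \<Union> (range (\<lambda>k::int. {v. w \<bullet> v = of_int k}))"
    by (auto elim: Ints_cases)
  also have "negligible \<dots>"
    using assms by (intro negligible_countable_Union) (auto intro: negligible_hyperplane)
  finally show ?thesis .
qed

lemma mem_translation_iff: "p \<in> (+) z ` A \<longleftrightarrow> p - z \<in> A" for p z :: "'a::ab_group_add"
proof
  assume "p - z \<in> A"
  then have "z + (p - z) \<in> (+) z ` A"
    by blast
  then show "p \<in> (+) z ` A"
    by simp
qed auto

text \<open>Average the number of lattice points of \<open>Z - v\<close> over \<open>v\<close> in the unit cube.\<close>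

lemma measure_eq_generic_lattice_count:
  fixes Z :: "(real ^ 'n) set"
  assumes Z: "compact Z" and N: "negligible N"
    and count: "\<And>v. v \<notin> N \<Longrightarrow> card {z \<in> int_lattice. z + v \<in> Z} = d"
  shows "measure lebesgue Z = real d"
proof -
  let ?Q = "cbox 0 One :: (real ^ 'n) set"
  \<comment> \<open>All lattice points counted for some \<open>v\<close> in the cube. They are
    finitely many, so sum and integral can be exchanged.\<close>
  define F where "F = {z \<in> int_lattice. \<exists>v\<in>?Q. z + v \<in> Z}"
  have "F \<subseteq> {p - v | p v. p \<in> Z \<and> v \<in> ?Q} \<inter> int_lattice"
  proof
    fix z assume "z \<in> F"
    then obtain v where "z \<in> int_lattice" "v \<in> ?Q" "z + v \<in> Z"
      by (auto simp: F_def)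
    moreover have "z = (z + v) - v"
      by simp
    ultimately show "z \<in> {p - v | p v. p \<in> Z \<and> v \<in> ?Q} \<inter> int_lattice"
      by blast
  qed
  moreover have "compact {p - v | p v. p \<in> Z \<and> v \<in> ?Q}"
    using Z by (intro compact_differences) auto
  ultimately have F: "finite F"
    using finite_bounded_int_lattice[OF compact_imp_bounded] finite_subset by blast
  \<comment> \<open>\<open>P z\<close> is the part of \<open>Z\<close> in the unit cell at
    \<open>z\<close>, and \<open>R z\<close> is that part moved back to the cube. The first family
    tiles \<open>Z\<close>; the second counts, at each \<open>v\<close> of the cube, the lattice
    points \<open>z\<close> with \<open>z + v\<close> in \<open>Z\<close>.\<close>
  define P where "P z = Z \<inter> (+) z ` ?Q" for z
  define R where "R z = (+) (- z) ` P z" for z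
  have compP: "compact (P z)" for z
    unfolding P_def using Z by (intro compact_Int compact_translation) auto
  have compR: "compact (R z)" for z
    unfolding R_def by (intro compact_translation compP)
  have memP: "p \<in> P z \<longleftrightarrow> p \<in> Z \<and> p - z \<in> ?Q" for p z
    unfolding P_def by (simp add: mem_translation_iff)
  have memR: "v \<in> R z \<longleftrightarrow> z + v \<in> Z \<and> v \<in> ?Q" for v z
    unfolding R_def mem_translation_iff memP by (simp add: add.commute)
  have PR: "measure lebesgue (P z) = measure lebesgue (R z)" for z
    unfolding R_def by (rule measure_translation[symmetric])
  \<comment> \<open>Closed unit cells overlap only in points with an integral coordinate.\<close>
  define M where "M = (\<Union>i. {x :: real ^ 'n. axis i 1 \<bullet> x \<in> \<int>})"
  have "negligible M"
    unfolding M_def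
    by (intro negligible_Union) (auto intro!: negligible_int_translates_hyperplane simp: axis_eq_0_iff)
  have Q: "v \<in> ?Q \<longleftrightarrow> (\<forall>i. 0 \<le> v $ i \<and> v $ i \<le> 1)" for v
  proof -
    have "(One :: real ^ 'n) $ i = 1" for i
    proof -
      have "axis i 1 \<in> (Basis :: (real ^ 'n) set)"
        by (auto simp: Basis_vec_def)
      then show ?thesis
        unfolding cart_eq_inner_axis[of One] by (simp add: inner_sum_left inner_Basis)
    qed
    then show ?thesis
      by (simp add: mem_box_cart)
  qed
  have intP: "((\<lambda>p. \<Sum>z\<in>F. indicat_real (P z) p) has_integral (\<Sum>z\<in>F. measure lebesgue (P z))) UNIV"
    using compP by (intro has_integral_sum F)
      (simp add: lmeasurable_compact flip: lmeasurable_iff_has_integral)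
  have intZ: "(indicat_real Z has_integral measure lebesgue Z) UNIV"
    using Z by (simp add: lmeasurable_compact flip: lmeasurable_iff_has_integral)
  have PZ: "(\<Sum>z\<in>F. indicat_real (P z) p) = indicat_real Z p" if "p \<in> UNIV - M" for p
  proof (cases "p \<in> Z")
    case True
    define z :: "real ^ 'n" where "z = (\<chi> i. of_int \<lfloor>p $ i\<rfloor>)"
    have zlat: "z \<in> int_lattice"
      by (simp add: z_def int_lattice_def)
    have "p - z \<in> ?Q"
      unfolding Q by (simp add: z_def) linarith
    then have zP: "p \<in> P z"
      using True by (simp add: memP)
    have "z \<in> F"
      using zlat \<open>p - z \<in> ?Q\<close> True unfolding F_def by (auto intro!: bexI[of _ "p - z"])
    have uniq: "y = z" if y: "y \<in> F" "p \<in> P y" for y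
    proof -
      have "y $ i = z $ i" for i
      proof -
        have "p $ i \<notin> \<int>"
          using \<open>p \<in> UNIV - M\<close> by (auto simp: M_def inner_axis')
        moreover obtain k :: int where k: "y $ i = of_int k"
          using y(1) by (auto simp: F_def int_lattice_def elim!: Ints_cases)
        moreover have "0 \<le> p $ i - y $ i" "p $ i - y $ i \<le> 1"
          using y(2) by (auto simp: memP Q)
        ultimately have "of_int k \<le> p $ i" "p $ i < of_int k + 1"
          by (auto simp: less_le)
        then have "\<lfloor>p $ i\<rfloor> = k"
          by (simp add: floor_unique)
        then show ?thesis
          by (simp add: z_def k)
      qed
      then show ?thesis
        by (simp add: vec_eq_iff)
    qed
    have "(\<Sum>y\<in>F. indicat_real (P y) p) = (\<Sum>y\<in>F. if y = z then 1 else 0)"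
    proof (intro sum.cong refl)
      fix y assume "y \<in> F"
      then have "p \<in> P y \<longleftrightarrow> y = z"
        using uniq zP by blast
      then show "indicat_real (P y) p = (if y = z then 1 else 0)"
        by (simp add: indicator_def)
    qed
    then show ?thesis
      using F \<open>z \<in> F\<close> True by simp
  next
    case False
    then show ?thesis
      by (simp add: memP indicator_def)
  qed
  have "(\<Sum>z\<in>F. measure lebesgue (P z)) = measure lebesgue Z"
    by (rule has_integral_unique[OF intP has_integral_spike[OF \<open>negligible M\<close> PZ intZ]])
  moreover have "(\<Sum>z\<in>F. measure lebesgue (R z)) = real d"
  proof -
    have 1: "((\<lambda>v. \<Sum>z\<in>F. indicat_real (R z) v) has_integral (\<Sum>z\<in>F. measure lebesgue (R z))) UNIV"
      using compR by (intro has_integral_sum F)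
        (simp add: lmeasurable_compact flip: lmeasurable_iff_has_integral)
    have "(indicat_real ?Q has_integral measure lebesgue ?Q) UNIV"
      using lmeasurable_cbox lmeasurable_iff_has_integral by blast
    then have "(indicat_real ?Q has_integral 1) UNIV"
      by simp
    then have 2: "((\<lambda>v. real d * indicat_real ?Q v) has_integral real d * 1) UNIV"
      by (rule has_integral_mult_right)
    have 3: "(\<Sum>z\<in>F. indicat_real (R z) v) = real d * indicat_real ?Q v" if "v \<in> UNIV - N" for v
    proof (cases "v \<in> ?Q")
      case True
      have "(\<Sum>z\<in>F. indicat_real (R z) v) = (\<Sum>z\<in>F. if z + v \<in> Z then 1 else 0)"
        using True by (intro sum.cong refl) (auto simp: memR indicator_def)
      also have "\<dots> = real (card {z \<in> F. z + v \<in> Z})"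
        using F by (simp add: sum.If_cases Int_def)
      also have "{z \<in> F. z + v \<in> Z} = {z \<in> int_lattice. z + v \<in> Z}"
        using True unfolding F_def by blast
      finally show ?thesis
        using count[of v] that True by simp
    next
      case False
      then show ?thesis
        by (simp add: memR indicator_def)
    qed
    show ?thesis
      using has_integral_unique[OF 1 has_integral_spike[OF N 3 2]] by simp
  qed
  ultimately show ?thesis
    by (simp add: PR)
qed

subsection \<open>The three dimension formulas\<close>

lemma power_kernel_rel_constraints_0:
  "power_kernel (rel_constraints e \<eta> X {0}) =
    power_kernel ((\<lambda>H. (\<eta> H, e (facet_mult X H))) ` facet_hyperplanes X)"
proof -
  have "dir_deriv 0 p = 0" for p :: "'a cpoly"
    using dir_deriv_scaleR_left[of 0 0 p] by simp
  then show ?thesis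
    by (auto simp: rel_constraints_def rel_facets_0 power_kernel_def)
qed

lemma dim_facet_kernel_le:
  fixes X :: "(real ^ 'n) multiset"
  assumes "zonotopal_case e I v"
    and span: "span (set_mset X) = UNIV" and uni: "unimodular X" and \<eta>: "facet_normals X \<eta>"
    and T: "finite T" "\<And>a. a \<in> int_lattice \<Longrightarrow> a + v \<in> zono I X \<Longrightarrow> a \<in> T"
  shows "cpoly_dim_le (power_kernel ((\<lambda>H. (\<eta> H, e (facet_mult X H))) ` facet_hyperplanes X)) (card T)"
proof -
  have "span ({0} \<union> set_mset X) = UNIV"
    using span by (simp add: span_insert_0)
  moreover have "set_mset X \<subseteq> int_lattice"
    using uni by (simp add: unimodular_def)
  ultimately obtain A where A: "lattice_transversal I v X {0} A"
      "cpoly_dim_le (power_kernel (rel_constraints e \<eta> X {0})) (card A)"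
    using lattice_transversal_dim[OF assms(1) subspace_single_0 _ _ unimodular_normalized_facets[OF span uni \<eta>]]
    by blast
  have "A \<subseteq> T"
    using A(1) T(2) by (auto simp: lattice_transversal_def)
  then show ?thesis
    using A(2) cpoly_dim_le_mono[OF _ order_refl card_mono[OF T(1)]]
    unfolding power_kernel_rel_constraints_0 by blast
qed

lemma cpoly_dim_le_dim:
  assumes "cpoly_dim_le V N"
  shows "cpoly_dim_le V (cpoly.dim V)"
proof -
  obtain B where B: "B \<subseteq> V" "cpoly.independent B" "V \<subseteq> cpoly.span B" "card B = cpoly.dim V"
    using cpoly.basis_exists by blast
  obtain E where "finite E" "V \<subseteq> cpoly.span E"
    using assms by (auto simp: cpoly_dim_le_def)
  then have "finite B"
    using cpoly.independent_span_bound[of E B] B(1,2) by blast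
  then show ?thesis
    using B by (auto simp: cpoly_dim_le_def)
qed

text \<open>The upper bound asks \<open>T\<close> to be large, the lower bound asks it to have few
  values under each normal; one \<open>T\<close> with both properties gives equality.\<close>

lemma dim_facet_kernel_eq:
  fixes X :: "(real ^ 'n) multiset"
  assumes "zonotopal_case e I v"
    and "span (set_mset X) = UNIV" "unimodular X" "facet_normals X \<eta>"
    and T: "finite T" "\<And>a. a \<in> int_lattice \<Longrightarrow> a + v \<in> zono I X \<Longrightarrow> a \<in> T"
    and card_values: "\<And>H. H \<in> facet_hyperplanes X \<Longrightarrow> card ((\<bullet>) (\<eta> H) ` T) \<le> e (facet_mult X H)"
  defines "V \<equiv> power_kernel ((\<lambda>H. (\<eta> H, e (facet_mult X H))) ` facet_hyperplanes X)"
  shows "cpoly_finite_dim V \<and> cpoly.dim V = card T"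
proof
  have le: "cpoly_dim_le V (card T)"
    unfolding V_def by (rule dim_facet_kernel_le[OF assms(1-4) T])
  show "cpoly_finite_dim V"
    by (rule cpoly_dim_le_imp_dim[OF le])
  have "card T \<le> cpoly.dim V"
    using card_values by (intro card_le_dim_power_kernel[OF T(1) _ cpoly_dim_le_dim[OF le, unfolded V_def], folded V_def]) auto
  then show "cpoly.dim V = card T"
    using cpoly_dim_le_imp_dim(2)[OF le] by simp
qed

lemma facet_range:
  fixes X :: "(real ^ 'n) multiset"
  assumes "normalized_facets \<eta> X {0}" "H \<in> facet_hyperplanes X"
  obtains \<rho> and l :: int where "\<rho> \<noteq> 0" "\<eta> H \<noteq> 0" "\<And>z. z \<in> int_lattice \<Longrightarrow> \<rho> * (\<eta> H \<bullet> z) \<in> \<int>"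
    "\<And>p. p \<in> zonotope X \<Longrightarrow> of_int l \<le> \<rho> * (\<eta> H \<bullet> p) \<and> \<rho> * (\<eta> H \<bullet> p) \<le> of_int (l + int (facet_mult X H))"
proof -
  have H: "H \<in> rel_facets X {0}"
    using assms(2) by (simp add: rel_facets_0)
  have n: "\<eta> H \<noteq> 0" "\<And>h. h \<in> H \<Longrightarrow> \<eta> H \<bullet> h = 0"
    using assms(1) H unfolding normalized_facets_def by blast+
  obtain \<rho> where \<rho>: "\<rho> \<noteq> 0" "\<forall>z\<in>int_lattice. \<rho> * (\<eta> H \<bullet> z) \<in> \<int>"
      "\<forall>x\<in>#X. x \<notin> H \<longrightarrow> \<bar>\<rho> * (\<eta> H \<bullet> x)\<bar> = 1"
    using assms(1) H unfolding normalized_facets_def by blast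
  obtain l :: int where l: "(\<Sum>x\<in>#X. min 0 (\<rho> *\<^sub>R \<eta> H \<bullet> x)) = of_int l"
      "(\<Sum>x\<in>#X. max 0 (\<rho> *\<^sub>R \<eta> H \<bullet> x)) = of_int (l + int (facet_mult X H))"
    using facet_width[of H "\<rho> *\<^sub>R \<eta> H" X] n(2) \<rho>(3) by auto
  have "of_int l \<le> \<rho> * (\<eta> H \<bullet> p) \<and> \<rho> * (\<eta> H \<bullet> p) \<le> of_int (l + int (facet_mult X H))"
    if "p \<in> zonotope X" for p
    using zonotope_inner_bounds[OF that, of "\<rho> *\<^sub>R \<eta> H"] unfolding l by simp
  then show ?thesis
    using that \<rho> n(1) by blast
qed

text \<open>A ball around \<open>p\<close> inside \<open>Z\<close> leaves room in the directions
  \<open>w\<close> and \<open>- w\<close>, so neither bound is attained.\<close>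

lemma facet_range_interior:
  fixes w :: "real ^ 'n"
  assumes "w \<noteq> 0" and "\<And>p. p \<in> Z \<Longrightarrow> a \<le> w \<bullet> p \<and> w \<bullet> p \<le> b" and "p \<in> interior Z"
  shows "a < w \<bullet> p" "w \<bullet> p < b"
proof -
  obtain e where e: "e > 0" "cball p e \<subseteq> Z"
    using assms(3) by (auto simp: mem_interior_cball)
  define \<delta> where "\<delta> = e / norm w"
  have "\<delta> > 0"
    using e(1) assms(1) by (simp add: \<delta>_def)
  have "p + \<delta> *\<^sub>R w \<in> Z" "p - \<delta> *\<^sub>R w \<in> Z"
    using e assms(1) by (auto intro!: subsetD[OF e(2)] simp: \<delta>_def dist_norm)
  then have "w \<bullet> p + \<delta> * (w \<bullet> w) \<le> b" "a \<le> w \<bullet> p - \<delta> * (w \<bullet> w)"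
    using assms(2) by (fastforce simp: inner_add_right inner_diff_right)+
  moreover have "\<delta> * (w \<bullet> w) > 0"
    using \<open>\<delta> > 0\<close> assms(1) by simp
  ultimately show "a < w \<bullet> p" "w \<bullet> p < b"
    by linarith+
qed

theorem proposition1p1:
  fixes X :: "(real ^ 'n) multiset"
    and \<eta> :: "(real ^ 'n) set \<Rightarrow> real ^ 'n"
  assumes nonzero: "0 \<notin># X"
    and spanning: "span (set_mset X) = UNIV"
    and unimod: "unimodular X"
    and normals: "facet_normals X \<eta>"
  shows "(cpoly_finite_dim (ideal_ker (external_ideal X \<eta>)) \<and>
          cpoly.dim (ideal_ker (external_ideal X \<eta>)) = card (zonotope X \<inter> int_lattice)) \<and>
         (cpoly_finite_dim (ideal_ker (central_ideal X \<eta>)) \<and>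
          real (cpoly.dim (ideal_ker (central_ideal X \<eta>))) = measure lebesgue (zonotope X)) \<and>
         (cpoly_finite_dim (ideal_ker (internal_ideal X \<eta>)) \<and>
          cpoly.dim (ideal_ker (internal_ideal X \<eta>)) = card (interior (zonotope X) \<inter> int_lattice))"
proof -
  let ?V = "\<lambda>e. power_kernel ((\<lambda>H. (\<eta> H, e (facet_mult X H))) ` facet_hyperplanes X)"
  have ker: "ideal_ker (external_ideal X \<eta>) = ?V (\<lambda>m. m + 1)"
    "ideal_ker (central_ideal X \<eta>) = ?V (\<lambda>m. m)"
    "ideal_ker (internal_ideal X \<eta>) = ?V (\<lambda>m. m - 1)"
    unfolding external_ideal_def central_ideal_def internal_ideal_def by (rule ideal_ker_powers)+
  have bounded: "bounded (zonotope X)"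
    using compact_zonotope by (rule compact_imp_bounded)
  note norm_facets = unimodular_normalized_facets[OF spanning unimod normals]

  have external: "cpoly_finite_dim (?V (\<lambda>m. m + 1)) \<and>
    cpoly.dim (?V (\<lambda>m. m + 1)) = card (zonotope X \<inter> int_lattice)"
  proof (rule dim_facet_kernel_eq[where e = "\<lambda>m. m + 1" and I = "{0..1}" and v = 0, OF _ spanning unimod normals])
    show "zonotopal_case (\<lambda>m. m + 1) {0..1} (0 :: real ^ 'n)"
      by (simp add: zonotopal_case_def)
    show fin: "finite (zonotope X \<inter> int_lattice)"
      using bounded by (rule finite_bounded_int_lattice)
    show "a \<in> zonotope X \<inter> int_lattice" if "a \<in> int_lattice" "a + 0 \<in> zono {0..1} X" for a
      using that by (simp add: zonotope_eq_zono)
    show "card ((\<bullet>) (\<eta> H) ` (zonotope X \<inter> int_lattice)) \<le> facet_mult X H + 1"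
      if "H \<in> facet_hyperplanes X" for H
      using norm_facets that
    proof (rule facet_range)
      fix \<rho> and l :: int
      assume \<rho>: "\<rho> \<noteq> 0" "\<And>z. z \<in> int_lattice \<Longrightarrow> \<rho> * (\<eta> H \<bullet> z) \<in> \<int>"
        and l: "\<And>p. p \<in> zonotope X \<Longrightarrow> of_int l \<le> \<rho> * (\<eta> H \<bullet> p) \<and> \<rho> * (\<eta> H \<bullet> p) \<le> of_int (l + int (facet_mult X H))"
      \<comment> \<open>A closed interval of length m(H) with integral ends contains m(H) + 1
        integers.\<close>
      have "card ((\<bullet>) (\<eta> H) ` (zonotope X \<inter> int_lattice)) \<le> card {l..l + int (facet_mult X H)}"
      proof (rule card_facet_values_le[OF \<rho>(1)])
        fix z assume z: "z \<in> zonotope X \<inter> int_lattice"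
        then obtain k where k: "\<rho> * (\<eta> H \<bullet> z) = of_int k"
          using \<rho>(2) by (auto elim: Ints_cases)
        then have "k \<in> {l..l + int (facet_mult X H)}"
          using l[of z] z by (simp only: atLeastAtMost_iff IntD1 of_int_le_iff)
        then show "\<exists>k\<in>{l..l + int (facet_mult X H)}. \<rho> * (\<eta> H \<bullet> z) = of_int k"
          using k by blast
      qed simp
      then show ?thesis
        by simp
    qed
  qed

  have internal: "cpoly_finite_dim (?V (\<lambda>m. m - 1)) \<and>
    cpoly.dim (?V (\<lambda>m. m - 1)) = card (interior (zonotope X) \<inter> int_lattice)"
  proof (rule dim_facet_kernel_eq[where e = "\<lambda>m. m - 1" and I = "{0<..<1}" and v = 0, OF _ spanning unimod normals])
    show "zonotopal_case (\<lambda>m. m - 1) {0<..<1} (0 :: real ^ 'n)"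
      by (simp add: zonotopal_case_def)
    show "finite (interior (zonotope X) \<inter> int_lattice)"
      using bounded by (intro finite_bounded_int_lattice bounded_interior)
    show "a \<in> interior (zonotope X) \<inter> int_lattice" if "a \<in> int_lattice" "a + 0 \<in> zono {0<..<1} X" for a
      using that zono_open_subset_interior[OF spanning] by auto
    show "card ((\<bullet>) (\<eta> H) ` (interior (zonotope X) \<inter> int_lattice)) \<le> facet_mult X H - 1"
      if "H \<in> facet_hyperplanes X" for H
      using norm_facets that
    proof (rule facet_range)
      fix \<rho> and l :: int
      assume \<rho>: "\<rho> \<noteq> 0" "\<eta> H \<noteq> 0" "\<And>z. z \<in> int_lattice \<Longrightarrow> \<rho> * (\<eta> H \<bullet> z) \<in> \<int>"
        and l: "\<And>p. p \<in> zonotope X \<Longrightarrow> of_int l \<le> \<rho> * (\<eta> H \<bullet> p) \<and> \<rho> * (\<eta> H \<bullet> p) \<le> of_int (l + int (facet_mult X H))"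
      \<comment> \<open>Interior points miss both ends, which leaves m(H) - 1 integers.\<close>
      have "card ((\<bullet>) (\<eta> H) ` (interior (zonotope X) \<inter> int_lattice)) \<le> card {l<..<l + int (facet_mult X H)}"
      proof (rule card_facet_values_le[OF \<rho>(1)])
        fix z assume z: "z \<in> interior (zonotope X) \<inter> int_lattice"
        then obtain k where k: "\<rho> * (\<eta> H \<bullet> z) = of_int k"
          using \<rho>(3) by (auto elim: Ints_cases)
        have "of_int l < (\<rho> *\<^sub>R \<eta> H) \<bullet> z" "(\<rho> *\<^sub>R \<eta> H) \<bullet> z < of_int (l + int (facet_mult X H))"
          using facet_range_interior[of "\<rho> *\<^sub>R \<eta> H" "zonotope X" "of_int l" "of_int (l + int (facet_mult X H))" z]
            \<rho>(1,2) l z by simp_all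
        then have "k \<in> {l<..<l + int (facet_mult X H)}"
          unfolding inner_scaleR_left k by (simp only: greaterThanLessThan_iff of_int_less_iff)
        then show "\<exists>k\<in>{l<..<l + int (facet_mult X H)}. \<rho> * (\<eta> H \<bullet> z) = of_int k"
          using k by blast
      qed simp
      then show ?thesis
        by simp
    qed
  qed

  have "\<exists>\<rho> l. \<rho> \<noteq> 0 \<and> \<eta> H \<noteq> 0 \<and> (\<forall>z\<in>int_lattice. \<rho> * (\<eta> H \<bullet> z) \<in> \<int>) \<and>
      (\<forall>p\<in>zonotope X. of_int l \<le> \<rho> * (\<eta> H \<bullet> p) \<and> \<rho> * (\<eta> H \<bullet> p) \<le> of_int (l + int (facet_mult X H)))"
    if "H \<in> facet_hyperplanes X" for H
    using norm_facets that by (rule facet_range) blast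
  then obtain \<rho> and l :: "(real ^ 'n) set \<Rightarrow> int" where
    \<rho>: "\<And>H. H \<in> facet_hyperplanes X \<Longrightarrow> \<rho> H \<noteq> 0 \<and> \<eta> H \<noteq> 0"
      "\<And>H z. H \<in> facet_hyperplanes X \<Longrightarrow> z \<in> int_lattice \<Longrightarrow> \<rho> H * (\<eta> H \<bullet> z) \<in> \<int>" and
    l: "\<And>H p. H \<in> facet_hyperplanes X \<Longrightarrow> p \<in> zonotope X \<Longrightarrow>
      of_int (l H) \<le> \<rho> H * (\<eta> H \<bullet> p) \<and> \<rho> H * (\<eta> H \<bullet> p) \<le> of_int (l H + int (facet_mult X H))"
    by metis
  \<comment> \<open>Outside \<open>N\<close> no scaled normal is integral at \<open>v\<close>, so
    translated lattice points never reach the integral ends of the range.\<close>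
  define N where "N = (\<Union>H\<in>facet_hyperplanes X. {v. (\<rho> H *\<^sub>R \<eta> H) \<bullet> v \<in> \<int>})"
  \<comment> \<open>A facet is the span of the vectors that it contains, so there are finitely
    many.\<close>
  have "facet_hyperplanes X \<subseteq> span ` Pow (set_mset X)"
    unfolding facet_hyperplanes_def by blast
  then have "finite (facet_hyperplanes X)"
    by (rule finite_subset) simp
  then have N: "negligible N"
    unfolding N_def using \<rho>(1)
    by (intro negligible_Union) (auto intro!: negligible_int_translates_hyperplane simp del: inner_scaleR_left)
  have central: "cpoly_finite_dim (?V (\<lambda>m. m)) \<and>
    cpoly.dim (?V (\<lambda>m. m)) = card {z \<in> int_lattice. z + v \<in> zonotope X}" if v: "v \<notin> N" for v
  proof (rule dim_facet_kernel_eq[where e = "\<lambda>m. m" and I = "{0..1}" and v = v, OF _ spanning unimod normals])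
    let ?T = "{z \<in> int_lattice. z + v \<in> zonotope X}"
    show "zonotopal_case (\<lambda>m. m) {0..1} v"
      by (simp add: zonotopal_case_def)
    have "?T = (+) (- v) ` zonotope X \<inter> int_lattice"
      by (auto simp: mem_translation_iff simp del: uminus_add_conv_diff)
    then show "finite ?T"
      using finite_bounded_int_lattice[OF bounded_translation[OF bounded]] by (simp only:)
    show "a \<in> ?T" if "a \<in> int_lattice" "a + v \<in> zono {0..1} X" for a
      using that by (simp add: zonotope_eq_zono)
    show "card ((\<bullet>) (\<eta> H) ` ?T) \<le> facet_mult X H" if H: "H \<in> facet_hyperplanes X" for H
    proof -
      define u where "u = \<rho> H * (\<eta> H \<bullet> v)"
      have "u \<notin> \<int>"
        using v H by (auto simp: N_def u_def)
      then have u: "of_int \<lfloor>u\<rfloor> < u" "u < of_int \<lfloor>u\<rfloor> + 1"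
        using floor_correct[of u] by (auto simp: less_le Ints_def)
      \<comment> \<open>The integers \<open>k\<close> for which \<open>k + u\<close> lies between
        \<open>l H\<close> and \<open>l H + m(H)\<close>; as \<open>u\<close> is not integral, there
        are exactly m(H) of them.\<close>
      let ?K = "{l H - \<lfloor>u\<rfloor>..<l H - \<lfloor>u\<rfloor> + int (facet_mult X H)}"
      have "card ((\<bullet>) (\<eta> H) ` ?T) \<le> card ?K"
      proof (rule card_facet_values_le)
        show "\<rho> H \<noteq> 0"
          using \<rho>(1)[OF H] by simp
        fix z assume z: "z \<in> ?T"
        then obtain k where k: "\<rho> H * (\<eta> H \<bullet> z) = of_int k"
          using \<rho>(2)[OF H] by (auto elim: Ints_cases)
        have "\<rho> H * (\<eta> H \<bullet> (z + v)) = of_int k + u"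
          by (simp add: inner_add_right distrib_left k u_def)
        then have "of_int (l H) \<le> of_int k + u" "of_int k + u \<le> of_int (l H + int (facet_mult X H))"
          using l[OF H, of "z + v"] z by simp_all
        then have "of_int (l H - \<lfloor>u\<rfloor>) < (of_int (k + 1) :: real)"
          "(of_int k :: real) < of_int (l H - \<lfloor>u\<rfloor> + int (facet_mult X H))"
          using u unfolding of_int_add of_int_diff of_int_1 by linarith+
        then have "k \<in> ?K"
          unfolding of_int_less_iff by simp
        then show "\<exists>k\<in>?K. \<rho> H * (\<eta> H \<bullet> z) = of_int k"
          using k by blast
      qed simp
      then show ?thesis
        by simp
    qed
  qed
  obtain v where "v \<notin> N"
    using N non_negligible_UNIV by (metis UNIV_eq_I)
  then have "cpoly_finite_dim (?V (\<lambda>m. m))"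
    using central by blast
  \<comment> \<open>The dimension is independent of \<open>v\<close>, so the count is constant
    outside \<open>N\<close>, as the averaging requires.\<close>
  moreover have "measure lebesgue (zonotope X) = real (cpoly.dim (?V (\<lambda>m. m)))"
    using central by (intro measure_eq_generic_lattice_count[OF compact_zonotope N]) simp
  ultimately show ?thesis
    unfolding ker using external internal by simp
qed

end
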